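(* (i) Let $\delta_1,\delta_2,\delta_3>0$ satisfy $\delta_1\ne\delta_2$ and $2(\delta_1+\delta_2)>\delta_3-6>\max\{2\delta_1-\delta_2,\,2\delta_2-\delta_1\}$, and let $(\lambda,\boldsymbol\mu)$ and $(\tilde\lambda,\tilde{\boldsymbol\mu})$ be admissible parameters such that $\mathcal K_{\lambda,\boldsymbol\mu}(0)=\mathrm{diag}(\delta_1,\delta_2,\delta_3)$ and $\mathcal K_{\tilde\lambda,\tilde{\boldsymbol\mu}}(0)=\mathrm{diag}(\delta_2,\delta_1,\delta_3)$. Then the multiplication operators $M^{(\lambda,\boldsymbol\mu)}$ and $M^{(\tilde\lambda,\tilde{\boldsymbol\mu})}$ are not unitarily equivalent, although $\mathcal K_{\lambda,\boldsymbol\mu}(z)$ and $\mathcal K_{\tilde\lambda,\tilde{\boldsymbol\mu}}(z)$ are unitarily equivalent for every $z\in\mathbb D$. (ii) Let $\delta_1,\delta_2,\delta_3>0$ satisfy $\delta_3>\delta_2>3+\frac{\delta_3}{2}$ and $\delta_1<\min\{2\delta_3-\delta_2,\,2\delta_2-\delta_3\}-6$, and let $(\lambda,\boldsymbol\mu)$ and $(\widehat\lambda,\widehat{\boldsymbol\mu})$ be admissible parameters such that $\mathcal K_{\lambda,\boldsymbol\mu}(0)=\mathrm{diag}(\delta_1,\delta_2,\delta_3)$ and $\mathcal K_{\widehat\lambda,\widehat{\boldsymbol\mu}}(0)=\mathrm{diag}(\delta_1,\delta_3,\delta_2)$. Then the multiplication operators $M^{(\lambda,\boldsymbol\mu)}$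 and $M^{(\widehat\lambda,\widehat{\boldsymbol\mu})}$ are not unitarily equivalent, although $\mathcal K_{\lambda,\boldsymbol\mu}(z)$ and $\mathcal K_{\widehat\lambda,\widehat{\boldsymbol\mu}}(z)$ are unitarily equivalent for every $z\in\mathbb D$.
   Context: Admissible parameters: a real $\lambda>1$ and $\boldsymbol\mu=(1,\mu_1,\mu_2)$ with $\mu_1,\mu_2>0$. Put $m=2$, $\mu_0=1$, $2\lambda_j=2\lambda-m+2j$, let $(x)_k=x(x+1)\cdots(x+k-1)$, and $$d_\ell=\sum_{j=0}^{\ell}\binom{\ell}{j}^2\frac{(\ell-j)!}{(2\lambda_j)_{\ell-j}}\mu_j^2,\quad 0\le\ell\le 2,\qquad \mathrm B=\mathrm{diag}(d_0,d_1,d_2).$$ Let $\mathbb S_2$ be the $3\times3$ matrix (indices $0,1,2$) with $(\mathbb S_2)_{\ell,\ell-1}=\ell$ and other entries $0$, and $D(x)=\mathrm{diag}((1-x)^2,1-x,1)$. The reproducing kernel $$K^{(\lambda,\boldsymbol\mu)}(z,w)=(1-z\bar w)^{-2\lambda-2}D(z\bar w)\exp(\bar w\,\mathbb S_2)\,\mathrm B\,\exp(z\,\mathbb S_2^* )D(z\bar w)$$ on the open unit disc $\mathbb D$ determines a Hilbert space $\mathbf A^{(\lambda,\boldsymbol\mu)}(\mathbb D)$ of $\mathbb C^3$-valued holomorphic functions, and $M^{(\lambda,\boldsymbol\mu)}$ is multiplication by the coordinate function on it. (It is known that $M^{(\lambda,\boldsymbol\mu)}$ is bounded, homogeneous and irreducible,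 and its adjoint is in the Cowen–Douglas class $\mathrm B_3(\mathbb D)$.) The normalized kernel of a kernel $K$ with $K(0,0)$ invertible is $\tilde K(z,w)=K(0,0)^{1/2}K(z,0)^{-1}K(z,w)K(0,w)^{-1}K(0,0)^{1/2}$. Set $\tilde h(z)=\tilde K^{(\lambda,\boldsymbol\mu)}(z,z)^t$ ($t$ = transpose), the metric of the bundle of the adjoint of the multiplication operator; $\mathcal K_{\lambda,\boldsymbol\mu}(z)=\bar\partial(\tilde h^{-1}\partial\tilde h)(z)$ is its curvature, acting on $\mathbb C^3$ with inner product $\langle x,y\rangle=y^*\tilde h(z)x$. Curvatures at $z$ are unitarily equivalent if intertwined by a unitary map between the corresponding inner product spaces. *)

theory Defs
  imports "HOL-Analysis.Analysis"
begin

type_synonym cvec3 = "complex ^ 3"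
type_synonym cmat3 = "complex ^ 3 ^ 3"

abbreviation unit_disc :: "complex set" where
  "unit_disc \<equiv> ball 0 1"


section \<open>Complex 3x3 matrices\<close>

text \<open>
  Positions 1, 2, 3 of vectors and matrices carry the mathematical indices 0, 1, 2.
  The type \<^typ>\<open>cmat3\<close> inherits the componentwise product, so \<open>*\<close>, \<open>^\<close> and \<open>inverse\<close> are
  not the matrix operations; \<open>**\<close>, \<open>matrix_inv\<close> and the functions below are used instead.
  Multiplication by a scalar c is written \<open>mat c ** A\<close>.
\<close>

definition diag3 :: "complex \<Rightarrow> complex \<Rightarrow> complex \<Rightarrow> cmat3" where
  "diag3 a b c = vector [vector [a, 0, 0], vector [0, b, 0], vector [0, 0, c]]"

definition conj_transpose :: "cmat3 \<Rightarrow> cmat3" where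
  "conj_transpose A = (\<chi> i j. cnj (A $ j $ i))"

definition mat_exp :: "cmat3 \<Rightarrow> cmat3" where
  "mat_exp A = (\<Sum>n. (1 / fact n) *\<^sub>R (((\<lambda>X. A ** X) ^^ n) (mat 1)))"

text \<open>The standard Hermitian inner product; linear in the first argument, whereas the library's
  \<open>\<bullet>\<close> on this type is only the real inner product.\<close>

definition cdot :: "cvec3 \<Rightarrow> cvec3 \<Rightarrow> complex" where
  "cdot x y = (\<Sum>i\<in>UNIV. x $ i * cnj (y $ i))"

definition pos_semidef :: "cmat3 \<Rightarrow> bool" where
  "pos_semidef A \<longleftrightarrow> conj_transpose A = A \<and> (\<forall>x. 0 \<le> Re (cdot (A *v x) x))"

text \<open>The positive square root; meaningful for positive semidefinite A.\<close>

definition mat_sqrt :: "cmat3 \<Rightarrow> cmat3" where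
  "mat_sqrt A = (THE R. pos_semidef R \<and> R ** R = A)"


section \<open>The kernels\<close>

text \<open>Only the values of \<open>\<mu>\<close> at 0, 1, 2 are relevant.\<close>

definition admissible :: "real \<Rightarrow> (nat \<Rightarrow> real) \<Rightarrow> bool" where
  "admissible l \<mu> \<longleftrightarrow> 1 < l \<and> \<mu> 0 = 1 \<and> 0 < \<mu> 1 \<and> 0 < \<mu> 2"

text \<open>Here \<open>2 * l - 2 + 2 * j\<close> is \<open>2\<lambda>\<^sub>j\<close> for m = 2.\<close>

definition d_coeff :: "real \<Rightarrow> (nat \<Rightarrow> real) \<Rightarrow> nat \<Rightarrow> real" where
  "d_coeff l \<mu> k =
     (\<Sum>j = 0..k. (real (k choose j))\<^sup>2 * fact (k - j)
                   / pochhammer (2 * l - 2 + 2 * real j) (k - j) * (\<mu> j)\<^sup>2)"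

definition B_mat :: "real \<Rightarrow> (nat \<Rightarrow> real) \<Rightarrow> cmat3" where
  "B_mat l \<mu> = diag3 (of_real (d_coeff l \<mu> 0)) (of_real (d_coeff l \<mu> 1)) (of_real (d_coeff l \<mu> 2))"

definition S_mat :: cmat3 where
  "S_mat = vector [vector [0, 0, 0], vector [1, 0, 0], vector [0, 2, 0]]"

definition D_mat :: "complex \<Rightarrow> cmat3" where
  "D_mat x = diag3 ((1 - x)\<^sup>2) (1 - x) 1"

text \<open>For z, w in the disc \<open>1 - z * cnj w\<close> has positive real part, so the principal branch used by
  \<open>powr\<close> is the intended one.\<close>

definition K_ker :: "real \<Rightarrow> (nat \<Rightarrow> real) \<Rightarrow> complex \<Rightarrow> complex \<Rightarrow> cmat3" where
  "K_ker l \<mu> z w =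
     mat ((1 - z * cnj w) powr of_real (- 2 * l - 2))
       ** D_mat (z * cnj w) ** mat_exp (mat (cnj w) ** S_mat) ** B_mat l \<mu>
       ** mat_exp (mat z ** conj_transpose S_mat) ** D_mat (z * cnj w)"


section \<open>Reproducing kernel Hilbert spaces and multiplication operators\<close>

text \<open>
  A space of functions on the disc is a set of total functions that vanish off the disc, so that
  equality of functions is equality on the disc.
\<close>

definition complex_hilbert_space ::
    "(complex \<Rightarrow> cvec3) set \<Rightarrow> ((complex \<Rightarrow> cvec3) \<Rightarrow> (complex \<Rightarrow> cvec3) \<Rightarrow> complex) \<Rightarrow> bool" where
  "complex_hilbert_space H ip \<longleftrightarrow>
     (\<lambda>z. 0) \<in> H \<and>
     (\<forall>f\<in>H. \<forall>g\<in>H. (\<lambda>z. f z + g z) \<in> H) \<and>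
     (\<forall>c. \<forall>f\<in>H. (\<lambda>z. c *s f z) \<in> H) \<and>
     (\<forall>f\<in>H. \<forall>g\<in>H. \<forall>k\<in>H. ip (\<lambda>z. f z + g z) k = ip f k + ip g k) \<and>
     (\<forall>c. \<forall>f\<in>H. \<forall>g\<in>H. ip (\<lambda>z. c *s f z) g = c * ip f g) \<and>
     (\<forall>f\<in>H. \<forall>g\<in>H. ip g f = cnj (ip f g)) \<and>
     (\<forall>f\<in>H. f \<noteq> (\<lambda>z. 0) \<longrightarrow> 0 < Re (ip f f)) \<and>
     (\<forall>X :: nat \<Rightarrow> complex \<Rightarrow> cvec3.
        (\<forall>n. X n \<in> H) \<and>
        (\<forall>e>0. \<exists>N. \<forall>m\<ge>N. \<forall>n\<ge>N.
           Re (ip (\<lambda>z. X m z - X n z) (\<lambda>z. X m z - X n z)) < e) \<longrightarrow>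
        (\<exists>f\<in>H. (\<lambda>n. Re (ip (\<lambda>z. X n z - f z) (\<lambda>z. X n z - f z))) \<longlonglongrightarrow> 0))"

definition kernel_section ::
    "(complex \<Rightarrow> complex \<Rightarrow> cmat3) \<Rightarrow> complex \<Rightarrow> cvec3 \<Rightarrow> complex \<Rightarrow> cvec3" where
  "kernel_section K w x = (\<lambda>z. if z \<in> unit_disc then K z w *v x else 0)"

text \<open>\<open>(H, ip)\<close> is the (unique) Hilbert space of holomorphic functions on the disc with reproducing
  kernel K.\<close>

definition is_rkhs ::
    "(complex \<Rightarrow> complex \<Rightarrow> cmat3) \<Rightarrow> (complex \<Rightarrow> cvec3) set
      \<Rightarrow> ((complex \<Rightarrow> cvec3) \<Rightarrow> (complex \<Rightarrow> cvec3) \<Rightarrow> complex) \<Rightarrow> bool" where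
  "is_rkhs K H ip \<longleftrightarrow>
     complex_hilbert_space H ip \<and>
     (\<forall>f\<in>H. (\<forall>i. (\<lambda>z. f z $ i) holomorphic_on unit_disc) \<and> (\<forall>z. z \<notin> unit_disc \<longrightarrow> f z = 0)) \<and>
     (\<forall>w\<in>unit_disc. \<forall>x. kernel_section K w x \<in> H \<and>
        (\<forall>f\<in>H. ip f (kernel_section K w x) = cdot (f w) x))"

definition mult_op :: "(complex \<Rightarrow> cvec3) \<Rightarrow> complex \<Rightarrow> cvec3" where
  "mult_op f = (\<lambda>z. z *s f z)"

definition unitarily_equivalent_ops ::
    "(complex \<Rightarrow> cvec3) set \<Rightarrow> ((complex \<Rightarrow> cvec3) \<Rightarrow> (complex \<Rightarrow> cvec3) \<Rightarrow> complex)
      \<Rightarrow> ((complex \<Rightarrow> cvec3) \<Rightarrow> complex \<Rightarrow> cvec3)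
      \<Rightarrow> (complex \<Rightarrow> cvec3) set \<Rightarrow> ((complex \<Rightarrow> cvec3) \<Rightarrow> (complex \<Rightarrow> cvec3) \<Rightarrow> complex)
      \<Rightarrow> ((complex \<Rightarrow> cvec3) \<Rightarrow> complex \<Rightarrow> cvec3) \<Rightarrow> bool" where
  "unitarily_equivalent_ops H ip T H' ip' T' \<longleftrightarrow>
     (\<exists>U. bij_betw U H H' \<and>
          (\<forall>f\<in>H. \<forall>g\<in>H. U (\<lambda>z. f z + g z) = (\<lambda>z. U f z + U g z)) \<and>
          (\<forall>c. \<forall>f\<in>H. U (\<lambda>z. c *s f z) = (\<lambda>z. c *s U f z)) \<and>
          (\<forall>f\<in>H. \<forall>g\<in>H. ip' (U f) (U g) = ip f g) \<and>
          (\<forall>f\<in>H. U (T f) = T' (U f)))"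


section \<open>Curvature\<close>

definition normalized_kernel ::
    "(complex \<Rightarrow> complex \<Rightarrow> cmat3) \<Rightarrow> complex \<Rightarrow> complex \<Rightarrow> cmat3" where
  "normalized_kernel K z w =
     mat_sqrt (K 0 0) ** matrix_inv (K z 0) ** K z w ** matrix_inv (K 0 w) ** mat_sqrt (K 0 0)"

definition metric :: "real \<Rightarrow> (nat \<Rightarrow> real) \<Rightarrow> complex \<Rightarrow> cmat3" where
  "metric l \<mu> z = transpose (normalized_kernel (K_ker l \<mu>) z z)"

text \<open>The Wirtinger derivatives \<open>(\<partial>\<^sub>x - \<i>\<partial>\<^sub>y)/2\<close> and \<open>(\<partial>\<^sub>x + \<i>\<partial>\<^sub>y)/2\<close>, entrywise for matrix functions.\<close>

definition del :: "(complex \<Rightarrow> cmat3) \<Rightarrow> complex \<Rightarrow> cmat3" where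
  "del F z = (\<chi> i j. (frechet_derivative (\<lambda>u. F u $ i $ j) (at z) 1
                       - \<i> * frechet_derivative (\<lambda>u. F u $ i $ j) (at z) \<i>) / 2)"

definition delbar :: "(complex \<Rightarrow> cmat3) \<Rightarrow> complex \<Rightarrow> cmat3" where
  "delbar F z = (\<chi> i j. (frechet_derivative (\<lambda>u. F u $ i $ j) (at z) 1
                          + \<i> * frechet_derivative (\<lambda>u. F u $ i $ j) (at z) \<i>) / 2)"

definition curvature :: "real \<Rightarrow> (nat \<Rightarrow> real) \<Rightarrow> complex \<Rightarrow> cmat3" where
  "curvature l \<mu> z = delbar (\<lambda>u. matrix_inv (metric l \<mu> u) ** del (metric l \<mu>) u) z"

definition curvatures_unitarily_equivalent ::
    "real \<Rightarrow> (nat \<Rightarrow> real) \<Rightarrow> real \<Rightarrow> (nat \<Rightarrow> real) \<Rightarrow> complex \<Rightarrow> bool" where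
  "curvatures_unitarily_equivalent l \<mu> l' \<mu>' z \<longleftrightarrow>
     (\<exists>U :: cmat3. invertible U \<and>
        (\<forall>x y. cdot (metric l' \<mu>' z *v (U *v x)) (U *v y) = cdot (metric l \<mu> z *v x) y) \<and>
        U ** curvature l \<mu> z = curvature l' \<mu>' z ** U)"

end

theory Submission
  imports Defs "HOL-Complex_Analysis.Complex_Analysis"
begin

text \<open>
  On the diagonal the kernel factors through unipotent matrices, so the metric is
  \<open>Y\<^sup>* \<Delta> Y\<close> with \<open>\<Delta>\<close> diagonal and depending on \<open>\<lambda>\<close> and \<open>\<bar>z\<bar>\<close> only, and the curvature at z is
  \<open>(1 - \<bar>z\<bar>\<^sup>2)\<^sup>-\<^sup>2 Y\<^sup>-\<^sup>1 C Y\<close> where C is the diagonal curvature at 0. Its trace determines \<open>\<lambda>\<close>;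
  hence, if the diagonals at 0 are permutations of each other, a rescaled permutation matrix
  intertwines the two curvatures at every point.

  A unitary equivalence of the multiplication operators sends a vector-valued polynomial p to \<open>\<Phi> p\<close>
  for one holomorphic matrix function \<open>\<Phi>\<close>, so the kernels satisfy
  \<open>K' = \<Phi> K \<Phi>\<^sup>*\<close> and the curvatures are intertwined by one constant matrix W. At 0 this makes W a
  monomial matrix realizing the permutation. The \<open>\<partial>\<close>-derivative of the curvature at 0 has non-zero
  entries at exactly the two subdiagonal positions, a pattern which that permutation does not respect.
\<close>

text \<open>Reading off \<open>\<Phi>\<close> from the images of the constants presupposes that the
  polynomials lie in the space and that only 0 is orthogonal to them. Neither is part of
  \<open>is_rkhs\<close>. To obtain both, the functionals taking a function to a Taylor coefficient
  at 0 are shown to be bounded, and the expansion of the kernel shows that each of their Riesz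
  representatives is a combination of z^N e_1, z^(N-1) e_2 and z^(N-2) e_3. For each N this leaves a
  coefficient matrix to invert; its pivots are non-zero because \<mu>_1 and \<mu>_2 are.

  The matrix W is constant because the normalization at 0 removes \<open>\<Phi> z\<close> from the
  relation between the metrics and leaves only \<open>\<Phi> 0\<close>.

  The inequalities enter through the order of the diagonal entries: delta_3 exceeds the two others
  in (i), delta_1 is below the two others in (ii). The extreme value leaves one row of W with at
  most its diagonal entry, and the derivative relation makes that entry vanish as well.\<close>

unbundle no Formal_Power_Series.fps_syntax

section \<open>Matrices\<close>

text \<open>A matrix given by its nine entries: with the simp rules below, an identity between
  matrix products becomes nine scalar identities.\<close>

definition m3 :: "complex \<Rightarrow> complex \<Rightarrow> complex \<Rightarrow> complex \<Rightarrow> complex \<Rightarrow> complex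
    \<Rightarrow> complex \<Rightarrow> complex \<Rightarrow> complex \<Rightarrow> cmat3" where
  "m3 a b c d e f g h i = vector [vector [a, b, c], vector [d, e, f], vector [g, h, i]]"

lemma m3_nth [simp]:
  "m3 a b c d e f g h i $ 1 $ 1 = a" "m3 a b c d e f g h i $ 1 $ 2 = b"
  "m3 a b c d e f g h i $ 1 $ 3 = c" "m3 a b c d e f g h i $ 2 $ 1 = d"
  "m3 a b c d e f g h i $ 2 $ 2 = e" "m3 a b c d e f g h i $ 2 $ 3 = f"
  "m3 a b c d e f g h i $ 3 $ 1 = g" "m3 a b c d e f g h i $ 3 $ 2 = h"
  "m3 a b c d e f g h i $ 3 $ 3 = i"
  by (simp_all add: m3_def)

lemma cmat3_eqI:
  fixes A B :: cmat3
  assumes "A $ 1 $ 1 = B $ 1 $ 1" "A $ 1 $ 2 = B $ 1 $ 2" "A $ 1 $ 3 = B $ 1 $ 3"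
    "A $ 2 $ 1 = B $ 2 $ 1" "A $ 2 $ 2 = B $ 2 $ 2" "A $ 2 $ 3 = B $ 2 $ 3"
    "A $ 3 $ 1 = B $ 3 $ 1" "A $ 3 $ 2 = B $ 3 $ 2" "A $ 3 $ 3 = B $ 3 $ 3"
  shows "A = B"
  using assms by (simp add: vec_eq_iff forall_3)

lemma m3_eta: "m3 (A $ 1 $ 1) (A $ 1 $ 2) (A $ 1 $ 3) (A $ 2 $ 1) (A $ 2 $ 2) (A $ 2 $ 3)
    (A $ 3 $ 1) (A $ 3 $ 2) (A $ 3 $ 3) = A"
  by (rule cmat3_eqI) simp_all

lemma m3_mult [simp]:
  "m3 a b c d e f g h i ** m3 a' b' c' d' e' f' g' h' i' =
     m3 (a*a' + b*d' + c*g') (a*b' + b*e' + c*h') (a*c' + b*f' + c*i')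
        (d*a' + e*d' + f*g') (d*b' + e*e' + f*h') (d*c' + e*f' + f*i')
        (g*a' + h*d' + i*g') (g*b' + h*e' + i*h') (g*c' + h*f' + i*i')"
  by (rule cmat3_eqI) (simp_all add: matrix_matrix_mult_def sum_3)

lemma m3_add [simp]:
  "m3 a b c d e f g h i + m3 a' b' c' d' e' f' g' h' i' =
     m3 (a+a') (b+b') (c+c') (d+d') (e+e') (f+f') (g+g') (h+h') (i+i')"
  by (rule cmat3_eqI) simp_all

lemma m3_eq_iff: "m3 a b c d e f g h i = m3 a' b' c' d' e' f' g' h' i' \<longleftrightarrow>
   a = a' \<and> b = b' \<and> c = c' \<and> d = d' \<and> e = e' \<and> f = f' \<and> g = g' \<and> h = h' \<and> i = i'"
  by (auto simp: vec_eq_iff forall_3)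

lemma mat_m3: "mat x = m3 x 0 0 0 x 0 0 0 x"
  by (rule cmat3_eqI) (simp_all add: mat_def)

lemma zero_m3: "(0 :: cmat3) = m3 0 0 0 0 0 0 0 0 0"
  by (rule cmat3_eqI) simp_all

lemma diag3_m3: "diag3 a b c = m3 a 0 0 0 b 0 0 0 c"
  by (simp add: diag3_def m3_def)

lemma transpose_m3 [simp]: "transpose (m3 a b c d e f g h i) = m3 a d g b e h c f i"
  by (rule cmat3_eqI) (simp_all add: transpose_def)

lemma conj_transpose_m3 [simp]: "conj_transpose (m3 a b c d e f g h i) =
    m3 (cnj a) (cnj d) (cnj g) (cnj b) (cnj e) (cnj h) (cnj c) (cnj f) (cnj i)"
  by (rule cmat3_eqI) (simp_all add: conj_transpose_def)

lemma scaleR_m3 [simp]: "r *\<^sub>R m3 a b c d e f g h i =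
    m3 (of_real r * a) (of_real r * b) (of_real r * c) (of_real r * d) (of_real r * e) (of_real r * f) (of_real r * g) (of_real r * h) (of_real r * i)"
  by (rule cmat3_eqI) (simp_all add: scaleR_conv_of_real[where 'a = complex])

lemma matrix_inv_eqI:
  fixes A B :: cmat3
  assumes "A ** B = mat 1"
  shows "matrix_inv A = B"
proof -
  have "B ** A = mat 1" using assms by (simp add: matrix_left_right_inverse)
  then have "invertible A" using assms by (auto simp: invertible_def)
  then have "matrix_inv A ** A = mat 1"
    unfolding invertible_def matrix_inv_def by (rule someI2_ex) simp
  then have "matrix_inv A ** A ** B = B" by simp
  then show ?thesis by (simp add: assms flip: matrix_mul_assoc)
qed

lemma matrix_add_rdistrib: "((B :: cmat3) + C) ** A = B ** A + C ** A"
  by (simp add: matrix_matrix_mult_def vec_eq_iff sum.distrib distrib_right)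

lemma mat_commute: "(A :: cmat3) ** mat x = mat x ** A"
proof -
  obtain a b c d e f g h i where "A = m3 a b c d e f g h i" by (metis m3_eta)
  then show ?thesis by (simp add: mat_m3 mult.commute)
qed

lemma mat_mult_mat: "mat x ** (mat y :: cmat3) = mat (x * y)"
  by (simp add: mat_m3)

section \<open>Unipotent one-parameter groups\<close>

definition Nil3 :: "complex \<Rightarrow> complex \<Rightarrow> cmat3" where
  "Nil3 s t = m3 0 0 0 s 0 0 0 t 0"

text \<open>The exponential of \<open>mat c ** Nil3 s t\<close>, whose series stops after the
  quadratic term. Hence \<open>Lo s t\<close> and its transpose \<open>Up s t\<close> turn sums of
  parameters into products, which is how factors are cancelled and regrouped later.\<close>

definition Lo :: "complex \<Rightarrow> complex \<Rightarrow> complex \<Rightarrow> cmat3" where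
  "Lo s t c = m3 1 0 0 (c * s) 1 0 (c\<^sup>2 * s * t / 2) (c * t) 1"

definition Up :: "complex \<Rightarrow> complex \<Rightarrow> complex \<Rightarrow> cmat3" where
  "Up s t c = transpose (Lo s t c)"

lemma Up_m3: "Up s t c = m3 1 (c * s) (c\<^sup>2 * s * t / 2) 0 1 (c * t) 0 0 1"
  by (simp add: Up_def Lo_def)

lemma Lo_add: "Lo s t c ** Lo s t c' = Lo s t (c + c')"
  by (simp add: Lo_def m3_eq_iff algebra_simps power2_eq_square add_divide_distrib)

lemma Lo_0 [simp]: "Lo s t 0 = mat 1"
  by (simp add: Lo_def mat_m3)

lemma Up_add: "Up s t c ** Up s t c' = Up s t (c + c')"
  by (simp add: Up_m3 m3_eq_iff algebra_simps power2_eq_square add_divide_distrib)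

lemma Up_0 [simp]: "Up s t 0 = mat 1"
  by (simp add: Up_m3 mat_m3)

lemma transpose_Up [simp]: "transpose (Up s t c) = Lo s t c"
  by (simp add: Up_def)

lemma transpose_Lo [simp]: "transpose (Lo s t c) = Up s t c"
  by (simp add: Up_def)

lemma mat_exp_nilpotent:
  assumes "A ** (A ** A) = 0"
  shows "mat_exp A = mat 1 + A + (1 / 2) *\<^sub>R (A ** A)"
proof -
  define P where "P n = ((\<lambda>X. A ** X) ^^ n) (mat 1)" for n
  have P3: "P (n + 3) = 0" for n
  proof (induction n)
    case 0
    then show ?case using assms by (simp add: P_def eval_nat_numeral)
  next
    case (Suc n)
    have "P (Suc (n + 3)) = A ** P (n + 3)" unfolding P_def funpow.simps o_apply ..
    then show ?case by (simp only: add_Suc Suc) simp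
  qed
  have "mat_exp A = (\<Sum>n\<in>{..<3}. (1 / fact n) *\<^sub>R P n)"
    unfolding mat_exp_def P_def[symmetric]
  proof (rule suminf_finite)
    fix n :: nat assume "n \<notin> {..<3}"
    then have "P n = 0" using P3[of "n - 3"] by simp
    then show "(1 / fact n) *\<^sub>R P n = 0" by simp
  qed simp
  also have "\<dots> = mat 1 + A + (1 / 2) *\<^sub>R (A ** A)"
    by (simp add: P_def numeral_3_eq_3 lessThan_Suc add_ac)
  finally show ?thesis .
qed

lemma mat_exp_Nil3: "mat_exp (mat c ** Nil3 s t) = Lo s t c"
  by (subst mat_exp_nilpotent)
    (simp_all add: Nil3_def mat_m3 Lo_def zero_m3 m3_eq_iff power2_eq_square)

lemma mat_exp_transpose_Nil3: "mat_exp (mat c ** transpose (Nil3 s t)) = Up s t c"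
  by (subst mat_exp_nilpotent)
    (simp_all add: Nil3_def mat_m3 Up_m3 zero_m3 m3_eq_iff power2_eq_square)

lemma S_mat_Nil3: "S_mat = Nil3 1 2"
  by (simp add: S_mat_def Nil3_def m3_def)

lemma K_ker_Lo_Up:
  "K_ker l \<mu> z w = mat ((1 - z * cnj w) powr of_real (- 2 * l - 2)) ** D_mat (z * cnj w)
     ** Lo 1 2 (cnj w) ** B_mat l \<mu> ** Up 1 2 z ** D_mat (z * cnj w)"
proof -
  have "conj_transpose S_mat = transpose (Nil3 1 2)"
    by (simp add: S_mat_Nil3 Nil3_def)
  then show ?thesis
    by (simp add: K_ker_def S_mat_Nil3 mat_exp_Nil3 mat_exp_transpose_Nil3)
qed

section \<open>Uniqueness of the positive square root of a diagonal matrix\<close>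

lemma cdot_sum_columns:
  fixes X R :: cmat3
  assumes "conj_transpose X = X"
  shows "(\<Sum>i\<in>UNIV. cdot (R *v column i X) (column i X)) = trace (X ** R ** X)"
proof -
  have c: "cnj (X $ a $ b) = X $ b $ a" for a b
    by (metis (mono_tags, lifting) assms conj_transpose_def vec_lambda_beta)
  show ?thesis
    by (simp add: cdot_def trace_def sum_3 matrix_matrix_mult_def matrix_vector_mult_def column_def c
        algebra_simps)
qed

text \<open>The description by \<open>THE\<close> requires uniqueness. If R is another positive root
  and X = R - S, then R X + X S = R R - S S = 0, so the traces of X R X and X S X add up to 0. As X
  is Hermitian, \<open>cdot_sum_columns\<close> turns both traces into sums of non-negative values
  of quadratic forms at the columns of X; the form of S is definite, so X = 0.\<close>

lemma mat_sqrt_diag3: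
  assumes "a > 0" "b > 0" "c > 0"
  shows "mat_sqrt (diag3 (of_real (a\<^sup>2)) (of_real (b\<^sup>2)) (of_real (c\<^sup>2))) =
    diag3 (of_real a) (of_real b) (of_real c)" (is "mat_sqrt ?A = ?S")
  unfolding mat_sqrt_def
proof (rule the_equality)
  have pos: "cdot (?S *v x) x = of_real (a * (cmod (x $ 1))\<^sup>2 + b * (cmod (x $ 2))\<^sup>2 + c * (cmod (x $ 3))\<^sup>2)"
    for x
    unfolding diag3_m3
    by (simp add: cdot_def matrix_vector_mult_def sum_3 mult.assoc flip: complex_norm_square)
  have S2: "?S ** ?S = ?A"
    by (simp add: diag3_m3 power2_eq_square)
  show "pos_semidef ?S \<and> ?S ** ?S = ?A"
    unfolding pos_semidef_def S2 pos using assms by (simp add: diag3_m3)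
  fix R assume R: "pos_semidef R \<and> R ** R = ?A"
  define X where "X = R - ?S"
  have hX: "conj_transpose X = X"
  proof -
    have "conj_transpose R = R" "conj_transpose ?S = ?S"
      using R by (simp_all add: pos_semidef_def diag3_m3)
    then show ?thesis
      by (simp add: X_def conj_transpose_def vec_eq_iff)
  qed
  have "R ** X + X ** ?S = 0"
  proof -
    have R_eq: "R = X + ?S" by (simp add: X_def)
    have "R ** R = R ** X + R ** ?S"
      by (subst (2) R_eq) (rule matrix_add_ldistrib)
    also have "R ** ?S = X ** ?S + ?S ** ?S"
      by (subst R_eq) (rule matrix_add_rdistrib)
    finally have "R ** R = R ** X + (X ** ?S + ?S ** ?S)" .
    then show ?thesis using R S2 by (simp add: add.assoc[symmetric])
  qed
  then have "trace (X ** (R ** X + X ** ?S)) = 0"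
    by (simp add: trace_def)
  then have "trace (X ** R ** X) + trace (X ** ?S ** X) = 0"
    using trace_mul_sym[of X "X ** ?S"]
    by (simp add: matrix_add_ldistrib trace_add matrix_mul_assoc)
  then have "Re ((\<Sum>i\<in>UNIV. cdot (R *v column i X) (column i X)) +
      (\<Sum>i\<in>UNIV. cdot (?S *v column i X) (column i X))) = 0"
    by (simp add: cdot_sum_columns[OF hX])
  moreover have "Re (cdot (R *v column i X) (column i X)) \<ge> 0" for i
    using R by (simp add: pos_semidef_def)
  moreover have "Re (cdot (?S *v column i X) (column i X)) \<ge> 0" for i
    unfolding pos using assms by simp
  ultimately have z: "Re (cdot (?S *v column i X) (column i X)) = 0" for i
    using exhaust_3[of i] unfolding sum_3 plus_complex.sel(1) by (smt (verit))
  have "X $ j $ i = 0" for i j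
  proof -
    have "a * (cmod (X $ 1 $ i))\<^sup>2 + b * (cmod (X $ 2 $ i))\<^sup>2 + c * (cmod (X $ 3 $ i))\<^sup>2 = 0"
      using z[of i] unfolding pos by (simp add: column_def)
    moreover have "0 \<le> a * (cmod (X $ 1 $ i))\<^sup>2" "0 \<le> b * (cmod (X $ 2 $ i))\<^sup>2" "0 \<le> c * (cmod (X $ 3 $ i))\<^sup>2"
      using assms by auto
    ultimately have "a * (cmod (X $ 1 $ i))\<^sup>2 = 0 \<and> b * (cmod (X $ 2 $ i))\<^sup>2 = 0 \<and> c * (cmod (X $ 3 $ i))\<^sup>2 = 0"
      by linarith
    then have "X $ 1 $ i = 0 \<and> X $ 2 $ i = 0 \<and> X $ 3 $ i = 0"
      using assms by simp
    then show ?thesis by (metis exhaust_3)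
  qed
  then have "X = 0" by (simp add: vec_eq_iff)
  then show "R = ?S" by (simp add: X_def)
qed

section \<open>The metric\<close>

lemma d_coeff_0: "\<mu> 0 = 1 \<Longrightarrow> d_coeff l \<mu> 0 = 1"
  by (simp add: d_coeff_def)

lemma d_coeff_1: "\<mu> 0 = 1 \<Longrightarrow> d_coeff l \<mu> 1 = 1 / (2 * l - 2) + (\<mu> 1)\<^sup>2"
  by (simp add: d_coeff_def atLeast0_atMost_Suc)

lemma d_coeff_2: "\<mu> 0 = 1 \<Longrightarrow> d_coeff l \<mu> 2 =
    2 / ((2 * l - 2) * (2 * l - 1)) + 4 * (\<mu> 1)\<^sup>2 / (2 * l) + (\<mu> 2)\<^sup>2"
  by (simp add: d_coeff_def numeral_2_eq_2 atLeast0_atMost_Suc pochhammer_Suc)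

lemma d_coeff_1_pos: "admissible l \<mu> \<Longrightarrow> 0 < d_coeff l \<mu> 1"
  by (simp add: admissible_def d_coeff_1 add_pos_pos del: One_nat_def)

lemma d_coeff_2_pos: "admissible l \<mu> \<Longrightarrow> 0 < d_coeff l \<mu> 2"
  by (simp add: admissible_def d_coeff_2 add_pos_pos)

text \<open>With R the square root of \<open>B_mat\<close>, the conjugate R^-1 S R of
  \<open>S_mat\<close> is \<open>Nil3 s t\<close> for s = \<open>s_of l \<mu>\<close> and t =
  \<open>t_of l \<mu>\<close>. Beside \<lambda>, these two numbers are all that the normalized
  kernel retains of the parameters.\<close>

definition s_of :: "real \<Rightarrow> (nat \<Rightarrow> real) \<Rightarrow> real" where
  "s_of l \<mu> = 1 / sqrt (d_coeff l \<mu> 1)"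

definition t_of :: "real \<Rightarrow> (nat \<Rightarrow> real) \<Rightarrow> real" where
  "t_of l \<mu> = 2 * sqrt (d_coeff l \<mu> 1) / sqrt (d_coeff l \<mu> 2)"

lemma s_of_pos: "admissible l \<mu> \<Longrightarrow> 0 < s_of l \<mu>"
  by (simp add: s_of_def d_coeff_1_pos del: One_nat_def)

lemma t_of_pos: "admissible l \<mu> \<Longrightarrow> 0 < t_of l \<mu>"
  by (simp add: t_of_def d_coeff_1_pos d_coeff_2_pos del: One_nat_def)

definition Dpow :: "complex \<Rightarrow> cmat3" where
  "Dpow p = diag3 (p ^ 4) (p\<^sup>2) 1"

definition defect :: "complex \<Rightarrow> complex" where
  "defect z = 1 - z * cnj z"

lemma defect_of_real: "defect z = of_real (1 - (cmod z)\<^sup>2)"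
  by (simp add: defect_def flip: complex_norm_square)

lemma defect_pos: "z \<in> unit_disc \<Longrightarrow> 0 < 1 - (cmod z)\<^sup>2"
  by (simp add: abs_square_less_1)

lemma defect_nonzero: "z \<in> unit_disc \<Longrightarrow> defect z \<noteq> 0"
  using defect_pos[of z] unfolding defect_of_real of_real_eq_0_iff by linarith

lemma defect_slit: "z \<in> unit_disc \<Longrightarrow> defect z \<notin> \<real>\<^sub>\<le>\<^sub>0"
  using defect_pos[of z] unfolding defect_of_real complex_nonpos_Reals_iff by simp

lemma cnj_defect [simp]: "cnj (defect z) = defect z"
  by (simp add: defect_of_real)

text \<open>The unipotent factor Y of the overview. For real s and t, \<open>frame_adj\<close> is
  its conjugate transpose; it is written out as a product so that each factor can be differentiated
  as an exponential.\<close>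

definition frame :: "complex \<Rightarrow> complex \<Rightarrow> complex \<Rightarrow> cmat3" where
  "frame s t z = Up s t (cnj z / defect z) ** Lo s t (- z)"

definition frame_adj :: "complex \<Rightarrow> complex \<Rightarrow> complex \<Rightarrow> cmat3" where
  "frame_adj s t z = Up s t (- cnj z) ** Lo s t (z / defect z)"

lemma K_ker_0_right: "K_ker l \<mu> z 0 = B_mat l \<mu> ** Up 1 2 z"
  by (simp add: K_ker_Lo_Up D_mat_def diag3_m3 mat_m3 B_mat_def Up_m3)

lemma K_ker_0_left: "K_ker l \<mu> 0 w = Lo 1 2 (cnj w) ** B_mat l \<mu>"
  by (simp add: K_ker_Lo_Up D_mat_def diag3_m3 mat_m3 B_mat_def Lo_def)

text \<open>Consecutive diagonal entries of \<open>D_mat (1 - p)\<close> have ratio p, so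
  conjugation by this matrix divides the nilpotent generator by p.\<close>

lemma D_Lo: 
  assumes "p \<noteq> 0"
  shows "D_mat (1 - p) ** Lo 1 2 c = Lo 1 2 (c / p) ** D_mat (1 - p)"
  using assms by (simp add: D_mat_def diag3_m3 Lo_def m3_eq_iff field_simps power2_eq_square)

lemma D_Up: 
  assumes "p \<noteq> 0"
  shows "Up 1 2 c ** D_mat (1 - p) = D_mat (1 - p) ** Up 1 2 (c / p)"
  using assms by (simp add: D_mat_def diag3_m3 Up_m3 m3_eq_iff field_simps power2_eq_square)

text \<open>Both factors \<open>D_mat\<close> are moved inwards past the unipotent factors and meet
  around \<open>B_mat\<close>, where together they give \<open>Dpow\<close>.\<close>

lemma K_ker_diagonal:
  assumes "z \<in> unit_disc"
  shows "K_ker l \<mu> z z = mat (defect z powr of_real (- 2 * l - 2)) ** Lo 1 2 (cnj z / defect z) **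
     Dpow (defect z) ** B_mat l \<mu> ** Up 1 2 (z / defect z)"
proof -
  have D: "D_mat (z * cnj z) = D_mat (1 - defect z)"
    by (simp add: defect_def)
  have E: "D_mat (1 - defect z) ** B_mat l \<mu> ** D_mat (1 - defect z) = Dpow (defect z) ** B_mat l \<mu>"
    by (simp add: D_mat_def B_mat_def Dpow_def diag3_m3 m3_eq_iff power2_eq_square power4_eq_xxxx)
  have "K_ker l \<mu> z z = mat (defect z powr of_real (- 2 * l - 2)) **
     (D_mat (1 - defect z) ** Lo 1 2 (cnj z)) ** B_mat l \<mu> ** (Up 1 2 z ** D_mat (1 - defect z))"
    unfolding K_ker_Lo_Up D by (simp add: defect_def matrix_mul_assoc)
  also have "\<dots> = mat (defect z powr of_real (- 2 * l - 2)) ** Lo 1 2 (cnj z / defect z) **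
      (D_mat (1 - defect z) ** B_mat l \<mu> ** D_mat (1 - defect z)) ** Up 1 2 (z / defect z)"
    unfolding D_Lo[OF defect_nonzero[OF assms]] D_Up[OF defect_nonzero[OF assms]]
    by (simp add: matrix_mul_assoc)
  finally show ?thesis unfolding E by (simp add: matrix_mul_assoc)
qed

text \<open>The values \<open>K_ker l \<mu> z 0\<close> and \<open>K_ker l \<mu> 0 z\<close> are
  unipotent up to \<open>B_mat\<close>. Once everything is conjugated by the square root R of
  \<open>B_mat\<close>, all powers of R cancel and the generator with entries 1, 2 has become the
  one with entries s, t. The transpose in \<open>metric\<close> then reverses the factors and
  exchanges \<open>Up\<close> and \<open>Lo\<close>.\<close>

lemma metric_eq:
  assumes "admissible l \<mu>" "z \<in> unit_disc"
  shows "metric l \<mu> z = frame_adj (s_of l \<mu>) (t_of l \<mu>) z **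
     (mat (defect z powr of_real (- 2 * l - 2)) ** Dpow (defect z)) ** frame (s_of l \<mu>) (t_of l \<mu>) z"
proof -
  define r1 r2 where "r1 = sqrt (d_coeff l \<mu> 1)" "r2 = sqrt (d_coeff l \<mu> 2)"
  have r: "r1 > 0" "r2 > 0"
    using assms by (simp_all add: r1_r2_def d_coeff_1_pos d_coeff_2_pos del: One_nat_def)
  define s t where "s = complex_of_real (s_of l \<mu>)" "t = complex_of_real (t_of l \<mu>)"
  have st: "s = of_real (1 / r1)" "t = of_real (2 * r1 / r2)"
    by (simp_all add: s_t_def s_of_def t_of_def r1_r2_def)
  define R Ri where "R = diag3 1 (of_real r1) (of_real r2)"
    "Ri = diag3 1 (of_real (1 / r1)) (of_real (1 / r2))"
  have B: "B_mat l \<mu> = diag3 (of_real (1\<^sup>2)) (of_real (r1\<^sup>2)) (of_real (r2\<^sup>2))"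
    using assms d_coeff_1_pos[OF assms(1)] d_coeff_2_pos[OF assms(1)]
    by (simp add: B_mat_def r1_r2_def admissible_def d_coeff_0)
  have sqrtB: "mat_sqrt (B_mat l \<mu>) = R"
    unfolding B using mat_sqrt_diag3[of 1 r1 r2] r by (simp add: R_Ri_def)
  have RR: "B_mat l \<mu> = R ** R" and RRi: "R ** Ri = mat 1" and RiR: "Ri ** R = mat 1"
    using r by (simp_all add: B R_Ri_def diag3_m3 mat_m3 power2_eq_square)
  have L: "Lo 1 2 c ** R = R ** Lo s t c" and U: "R ** Up 1 2 c = Up s t c ** R" for c
    using r by (simp_all add: R_Ri_def diag3_m3 Lo_def Up_m3 st m3_eq_iff field_simps)
  define P where "P = defect z powr of_real (- 2 * l - 2)"
  define p where "p = defect z"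
  have Kz0: "matrix_inv (K_ker l \<mu> z 0) = Up 1 2 (- z) ** (Ri ** Ri)"
  proof (rule matrix_inv_eqI)
    have "K_ker l \<mu> z 0 ** (Up 1 2 (- z) ** (Ri ** Ri)) =
       R ** R ** (Up 1 2 z ** Up 1 2 (- z)) ** Ri ** Ri"
      by (simp only: K_ker_0_right RR matrix_mul_assoc)
    also have "\<dots> = R ** (R ** Ri) ** Ri"
      by (simp add: Up_add matrix_mul_assoc)
    also have "\<dots> = mat 1" by (simp add: RRi)
    finally show "K_ker l \<mu> z 0 ** (Up 1 2 (- z) ** (Ri ** Ri)) = mat 1" .
  qed
  have K0z: "matrix_inv (K_ker l \<mu> 0 z) = Ri ** Ri ** Lo 1 2 (- cnj z)"
  proof (rule matrix_inv_eqI)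
    have "K_ker l \<mu> 0 z ** (Ri ** Ri ** Lo 1 2 (- cnj z)) =
       Lo 1 2 (cnj z) ** (R ** (R ** Ri) ** Ri) ** Lo 1 2 (- cnj z)"
      by (simp only: K_ker_0_left RR matrix_mul_assoc)
    also have "\<dots> = Lo 1 2 (cnj z) ** Lo 1 2 (- cnj z)"
      by (simp add: RRi)
    also have "\<dots> = mat 1" by (simp add: Lo_add)
    finally show "K_ker l \<mu> 0 z ** (Ri ** Ri ** Lo 1 2 (- cnj z)) = mat 1" .
  qed
  have DR: "Dpow p ** R = R ** Dpow p"
    by (simp add: Dpow_def R_Ri_def diag3_m3 mult.commute)
  have K00: "K_ker l \<mu> 0 0 = B_mat l \<mu>"
    by (simp add: K_ker_0_left)
  have "normalized_kernel (K_ker l \<mu>) z z = R ** (Up 1 2 (- z) ** (Ri ** Ri)) **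
      (mat P ** Lo 1 2 (cnj z / p) ** Dpow p ** (R ** R) ** Up 1 2 (z / p)) **
      (Ri ** Ri ** Lo 1 2 (- cnj z)) ** R"
    unfolding normalized_kernel_def K00 sqrtB Kz0 K0z K_ker_diagonal[OF assms(2)] P_def p_def
    by (simp only: RR)
  also have "\<dots> = (R ** Up 1 2 (- z)) ** Ri ** Ri **
      mat P ** Lo 1 2 (cnj z / p) ** (Dpow p ** R) ** (R ** Up 1 2 (z / p)) **
      Ri ** Ri ** (Lo 1 2 (- cnj z) ** R)"
    by (simp only: matrix_mul_assoc)
  also have "\<dots> = Up s t (- z) ** (R ** Ri) ** (Ri **
      mat P) ** (Lo 1 2 (cnj z / p) ** R) ** Dpow p ** Up s t (z / p) ** (R ** Ri) ** (Ri ** R) ** Lo s t (- cnj z)"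
    unfolding U L[of "- cnj z"] DR by (simp only: matrix_mul_assoc)
  also have "\<dots> = Up s t (- z) ** mat P ** Ri ** R ** Lo s t (cnj z / p) ** Dpow p ** Up s t (z / p) ** Lo s t (- cnj z)"
    unfolding L RRi RiR mat_commute[of Ri P] by (simp only: matrix_mul_rid matrix_mul_assoc)
  also have "\<dots> = Up s t (- z) ** mat P ** (Ri ** R) ** Lo s t (cnj z / p) ** Dpow p ** Up s t (z / p) ** Lo s t (- cnj z)"
    by (simp only: matrix_mul_assoc)
  also have "\<dots> = Up s t (- z) ** Lo s t (cnj z / p) ** (mat P ** Dpow p) ** Up s t (z / p) ** Lo s t (- cnj z)"
  proof -
    have PL: "Lo s t (cnj z / p) ** (mat P ** X) = mat P ** (Lo s t (cnj z / p) ** X)" for X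
      by (simp only: matrix_mul_assoc mat_commute[of "Lo s t (cnj z / p)" P])
    then show ?thesis
      unfolding RiR matrix_mul_rid by (simp only: PL matrix_mul_assoc[symmetric])
  qed
  finally have N: "normalized_kernel (K_ker l \<mu>) z z = Up s t (- z) ** Lo s t (cnj z / p) ** (mat P ** Dpow p) ** Up s t (z / p) ** Lo s t (- cnj z)" .
  have W: "transpose (Dpow p) ** transpose (mat P) = mat P ** Dpow p"
    by (simp add: Dpow_def diag3_m3 mat_m3 mult.commute)
  show ?thesis
    unfolding metric_def N frame_def frame_adj_def s_t_def[symmetric]
    by (simp only: matrix_transpose_mul W) (simp only: transpose_Lo transpose_Up matrix_mul_assoc P_def p_def)
qed

section \<open>Wirtinger calculus\<close>

text \<open>A real derivative is written in v and its conjugate, so a and b are the two Wirtinger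
  derivatives. Unlike \<open>del\<close> and \<open>delbar\<close>, the predicate asserts
  differentiability and is therefore stable under sums, products and composition.\<close>

definition has_wirtinger :: "(complex \<Rightarrow> complex) \<Rightarrow> complex \<Rightarrow> complex \<Rightarrow> complex \<Rightarrow> bool" where
  "has_wirtinger f a b z \<longleftrightarrow> (f has_derivative (\<lambda>v. a * v + b * cnj v)) (at z)"

definition has_wirtinger_mat :: "(complex \<Rightarrow> cmat3) \<Rightarrow> cmat3 \<Rightarrow> cmat3 \<Rightarrow> complex \<Rightarrow> bool" where
  "has_wirtinger_mat F A B z \<longleftrightarrow> (\<forall>i j. has_wirtinger (\<lambda>u. F u $ i $ j) (A $ i $ j) (B $ i $ j) z)"

lemma has_wirtinger_const: "has_wirtinger (\<lambda>u. c) 0 0 z"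
  by (simp add: has_wirtinger_def)

lemma has_wirtinger_cnj: "has_wirtinger cnj 0 1 z"
  by (simp add: has_wirtinger_def has_derivative_cnj has_derivative_ident)

lemma has_wirtinger_ident: "has_wirtinger (\<lambda>u. u) 1 0 z"
  by (simp add: has_wirtinger_def)

lemma has_wirtinger_uminus:
  "has_wirtinger f a b z \<Longrightarrow> has_wirtinger (\<lambda>u. - f u) (- a) (- b) z"
  unfolding has_wirtinger_def
  by (rule has_derivative_eq_rhs, erule has_derivative_minus) (auto simp: fun_eq_iff)

lemma has_wirtinger_add:
  "has_wirtinger f a b z \<Longrightarrow> has_wirtinger g a' b' z \<Longrightarrow>
    has_wirtinger (\<lambda>u. f u + g u) (a + a') (b + b') z"
  unfolding has_wirtinger_def
  by (rule has_derivative_eq_rhs, erule (1) has_derivative_add) (auto simp: fun_eq_iff algebra_simps)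

lemma has_wirtinger_sum:
  "(\<And>i. i \<in> I \<Longrightarrow> has_wirtinger (f i) (a i) (b i) z) \<Longrightarrow>
    has_wirtinger (\<lambda>u. \<Sum>i\<in>I. f i u) (\<Sum>i\<in>I. a i) (\<Sum>i\<in>I. b i) z"
  by (induction I rule: infinite_finite_induct) (auto simp: has_wirtinger_const has_wirtinger_add)

lemma has_wirtinger_mult:
  "has_wirtinger f a b z \<Longrightarrow> has_wirtinger g a' b' z \<Longrightarrow>
    has_wirtinger (\<lambda>u. f u * g u) (a * g z + f z * a') (b * g z + f z * b') z"
  unfolding has_wirtinger_def
  by (rule has_derivative_eq_rhs, erule (1) has_derivative_mult) (auto simp: fun_eq_iff algebra_simps)

lemma has_wirtinger_chain:
  assumes "has_wirtinger f a b z" "(g has_field_derivative g') (at (f z))"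
  shows "has_wirtinger (\<lambda>u. g (f u)) (g' * a) (g' * b) z"
proof -
  have "((\<lambda>u. g (f u)) has_derivative (\<lambda>v. g' * (a * v + b * cnj v))) (at z)"
    using assms has_derivative_compose unfolding has_wirtinger_def has_field_derivative_def by blast
  then show ?thesis by (simp add: has_wirtinger_def algebra_simps)
qed

lemma has_wirtinger_cong:
  assumes "has_wirtinger f a b z" "open S" "z \<in> S" "\<And>u. u \<in> S \<Longrightarrow> f u = g u"
  shows "has_wirtinger g a b z"
  using assms unfolding has_wirtinger_def by (blast intro: has_derivative_transform_within_open)

lemma has_wirtinger_mat_cong:
  assumes "has_wirtinger_mat F A B z" "open S" "z \<in> S" "\<And>u. u \<in> S \<Longrightarrow> F u = G u"
  shows "has_wirtinger_mat G A B z"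
  unfolding has_wirtinger_mat_def
proof (intro allI)
  fix i j
  show "has_wirtinger (\<lambda>u. G u $ i $ j) (A $ i $ j) (B $ i $ j) z"
    by (rule has_wirtinger_cong[of "\<lambda>u. F u $ i $ j", OF _ assms(2,3)])
      (use assms(1,4) in \<open>auto simp: has_wirtinger_mat_def\<close>)
qed

lemma del_eqI:
  assumes "has_wirtinger_mat F A B z"
  shows "del F z = A"
proof -
  have "frechet_derivative (\<lambda>u. F u $ i $ j) (at z) = (\<lambda>v. A $ i $ j * v + B $ i $ j * cnj v)" for i j
    by (rule frechet_derivative_at[symmetric])
      (use assms in \<open>simp add: has_wirtinger_mat_def has_wirtinger_def\<close>)
  then show ?thesis
    by (simp add: del_def vec_eq_iff algebra_simps)
qed

lemma delbar_eqI:
  assumes "has_wirtinger_mat F A B z"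
  shows "delbar F z = B"
proof -
  have "frechet_derivative (\<lambda>u. F u $ i $ j) (at z) = (\<lambda>v. A $ i $ j * v + B $ i $ j * cnj v)" for i j
    by (rule frechet_derivative_at[symmetric])
      (use assms in \<open>simp add: has_wirtinger_mat_def has_wirtinger_def\<close>)
  then show ?thesis
    by (simp add: delbar_def vec_eq_iff algebra_simps)
qed

lemma has_wirtinger_mat_const: "has_wirtinger_mat (\<lambda>u. C) 0 0 z"
  by (simp add: has_wirtinger_mat_def has_wirtinger_const)

lemma has_wirtinger_mat_mult:
  assumes "has_wirtinger_mat F A B z" "has_wirtinger_mat G A' B' z"
  shows "has_wirtinger_mat (\<lambda>u. F u ** G u) (A ** G z + F z ** A') (B ** G z + F z ** B') z"
  unfolding has_wirtinger_mat_def
proof (intro allI)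
  fix i j
  have "has_wirtinger (\<lambda>u. \<Sum>k\<in>UNIV. F u $ i $ k * G u $ k $ j)
     (\<Sum>k\<in>UNIV. A $ i $ k * G z $ k $ j + F z $ i $ k * A' $ k $ j)
     (\<Sum>k\<in>UNIV. B $ i $ k * G z $ k $ j + F z $ i $ k * B' $ k $ j) z"
    using assms by (intro has_wirtinger_sum has_wirtinger_mult) (auto simp: has_wirtinger_mat_def)
  then show "has_wirtinger (\<lambda>u. (F u ** G u) $ i $ j)
      ((A ** G z + F z ** A') $ i $ j) ((B ** G z + F z ** B') $ i $ j) z"
    by (simp add: matrix_matrix_mult_def sum.distrib)
qed

lemma has_wirtinger_mat_m3:
  assumes "has_wirtinger f1 a1 b1 z" "has_wirtinger f2 a2 b2 z" "has_wirtinger f3 a3 b3 z"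
    "has_wirtinger f4 a4 b4 z" "has_wirtinger f5 a5 b5 z" "has_wirtinger f6 a6 b6 z"
    "has_wirtinger f7 a7 b7 z" "has_wirtinger f8 a8 b8 z" "has_wirtinger f9 a9 b9 z"
  shows "has_wirtinger_mat (\<lambda>u. m3 (f1 u) (f2 u) (f3 u) (f4 u) (f5 u) (f6 u) (f7 u) (f8 u) (f9 u))
    (m3 a1 a2 a3 a4 a5 a6 a7 a8 a9) (m3 b1 b2 b3 b4 b5 b6 b7 b8 b9) z"
  using assms by (simp add: has_wirtinger_mat_def forall_3)

lemma has_wirtinger_power2:
  "has_wirtinger f a b z \<Longrightarrow> has_wirtinger (\<lambda>u. (f u)\<^sup>2) (2 * f z * a) (2 * f z * b) z"
  using has_wirtinger_mult[of f a b z f a b] by (simp add: power2_eq_square algebra_simps)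

lemma has_wirtinger_cmult:
  "has_wirtinger f a b z \<Longrightarrow> has_wirtinger (\<lambda>u. c * f u) (c * a) (c * b) z"
  using has_wirtinger_mult[OF has_wirtinger_const] by fastforce

text \<open>The derivative of an exponential is its generator times the exponential.\<close>

lemma has_wirtinger_mat_Lo:
  assumes "has_wirtinger f a b z"
  shows "has_wirtinger_mat (\<lambda>u. Lo s t (f u)) (mat a ** Nil3 s t ** Lo s t (f z))
    (mat b ** Nil3 s t ** Lo s t (f z)) z"
proof -
  have "has_wirtinger_mat (\<lambda>u. m3 1 0 0 (s * f u) 1 0 ((s * t / 2) * (f u)\<^sup>2) (t * f u) 1)
    (m3 0 0 0 (s * a) 0 0 ((s * t / 2) * (2 * f z * a)) (t * a) 0)
    (m3 0 0 0 (s * b) 0 0 ((s * t / 2) * (2 * f z * b)) (t * b) 0) z"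
    by (intro has_wirtinger_mat_m3 has_wirtinger_const has_wirtinger_cmult has_wirtinger_power2 assms)
  then show ?thesis
    by (simp add: Lo_def Nil3_def mat_m3 mult_ac)
qed

lemma has_wirtinger_mat_Up:
  assumes "has_wirtinger f a b z"
  shows "has_wirtinger_mat (\<lambda>u. Up s t (f u)) (mat a ** transpose (Nil3 s t) ** Up s t (f z))
    (mat b ** transpose (Nil3 s t) ** Up s t (f z)) z"
proof -
  have "has_wirtinger_mat (\<lambda>u. m3 1 (s * f u) ((s * t / 2) * (f u)\<^sup>2) 0 1 (t * f u) 0 0 1)
    (m3 0 (s * a) ((s * t / 2) * (2 * f z * a)) 0 0 (t * a) 0 0 0)
    (m3 0 (s * b) ((s * t / 2) * (2 * f z * b)) 0 0 (t * b) 0 0 0) z"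
    by (intro has_wirtinger_mat_m3 has_wirtinger_const has_wirtinger_cmult has_wirtinger_power2 assms)
  then show ?thesis
    by (simp add: Up_m3 Nil3_def mat_m3 mult_ac)
qed

lemma has_wirtinger_defect: "has_wirtinger defect (- cnj z) (- z) z"
  unfolding defect_def
  using has_wirtinger_add[OF has_wirtinger_const[of 1] has_wirtinger_uminus[OF
      has_wirtinger_mult[OF has_wirtinger_ident has_wirtinger_cnj]], of z]
  by simp

text \<open>For q = \<open>cnj z / defect z\<close> the holomorphic derivative is q^2. This Riccati
  equation is the reason why the connection becomes polynomial in q.\<close>

lemma has_wirtinger_cnj_over_defect:
  assumes "z \<in> unit_disc"
  shows "has_wirtinger (\<lambda>u. cnj u / defect u) ((cnj z / defect z)\<^sup>2) (1 / (defect z)\<^sup>2) z"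
proof -
  have nz: "defect z \<noteq> 0" using assms by (rule defect_nonzero)
  have "((\<lambda>x. 1 / x) has_field_derivative - 1 / (defect z)\<^sup>2) (at (defect z))"
    using nz by (auto intro!: derivative_eq_intros simp: power2_eq_square)
  from has_wirtinger_mult[OF has_wirtinger_cnj has_wirtinger_chain[OF has_wirtinger_defect this]]
  have "has_wirtinger (\<lambda>u. cnj u * (1 / defect u)) (0 * (1 / defect z) + cnj z * (- 1 / (defect z)\<^sup>2 * - cnj z))
     (1 * (1 / defect z) + cnj z * (- 1 / (defect z)\<^sup>2 * - z)) z" .
  \<comment> \<open>With p = \<open>defect z\<close>, the numerator over p^2 is p + z (cnj z), which
    is 1.\<close>
  moreover have "1 * (1 / defect z) + cnj z * (- 1 / (defect z)\<^sup>2 * - z) = 1 / (defect z)\<^sup>2"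
    using nz by (simp add: field_simps power2_eq_square) (simp add: defect_def algebra_simps)
  ultimately show ?thesis
    by (simp add: power2_eq_square)
qed

lemma has_wirtinger_over_defect:
  assumes "z \<in> unit_disc"
  shows "has_wirtinger (\<lambda>u. u / defect u) (1 / (defect z)\<^sup>2) ((z / defect z)\<^sup>2) z"
proof -
  have nz: "defect z \<noteq> 0" using assms by (rule defect_nonzero)
  have "((\<lambda>x. 1 / x) has_field_derivative - 1 / (defect z)\<^sup>2) (at (defect z))"
    using nz by (auto intro!: derivative_eq_intros simp: power2_eq_square)
  from has_wirtinger_mult[OF has_wirtinger_ident has_wirtinger_chain[OF has_wirtinger_defect this]]
  have "has_wirtinger (\<lambda>u. u * (1 / defect u)) (1 * (1 / defect z) + z * (- 1 / (defect z)\<^sup>2 * - cnj z))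
     (0 * (1 / defect z) + z * (- 1 / (defect z)\<^sup>2 * - z)) z" .
  moreover have "1 * (1 / defect z) + z * (- 1 / (defect z)\<^sup>2 * - cnj z) = 1 / (defect z)\<^sup>2"
    using nz by (simp add: field_simps power2_eq_square) (simp add: defect_def algebra_simps)
  ultimately show ?thesis
    by (simp add: power2_eq_square)
qed

text \<open>The diagonal factor of the metric, with e in place of 2\<lambda>: the matrix
  diag(p^(2-e), p^(-e), p^(-e-2)) for p = \<open>defect z\<close>.\<close>

definition weight :: "complex \<Rightarrow> complex \<Rightarrow> cmat3" where
  "weight e z = mat (defect z powr (- e - 2)) ** Dpow (defect z)"

text \<open>Each exponent of p is multiplied by the logarithmic derivative - (cnj z) / p of p, which
  gives the diagonal e - 2, e, e + 2. Only the holomorphic derivative enters the connection, so the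
  other one is left unspecified.\<close>

lemma has_wirtinger_weight:
  assumes "z \<in> unit_disc"
  shows "\<exists>B. has_wirtinger_mat (weight e)
    (weight e z ** (mat (cnj z / defect z) ** diag3 (e - 2) e (e + 2))) B z"
proof -
  define p where "p = defect z"
  have nz: "p \<noteq> 0" using assms by (simp add: p_def defect_nonzero)
  define g where "g k x = x powr (- e - 2) * x ^ k" for k :: nat and x :: complex
  have D: "(g k has_field_derivative (of_nat k - e - 2) / p * g k p) (at p)" for k
  proof -
    have "(g k has_field_derivative ((- e - 2) * p powr (- e - 3)) * p ^ k +
        p powr (- e - 2) * (of_nat k * p ^ (k - 1))) (at p)"
      unfolding g_def
      using DERIV_mult[OF has_field_derivative_powr[of p "- e - 2"] DERIV_power[OF DERIV_ident, where n = k]]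
        defect_slit[OF assms]
      by (simp add: p_def diff_diff_eq ac_simps)
    moreover have "p powr (- e - 3) = p powr (- e - 2) / p"
      using nz powr_diff[of p "- e - 2" 1] by (simp add: diff_diff_eq)
    moreover have "of_nat k * p ^ (k - 1) = of_nat k * p ^ k / p"
      using nz by (cases k) auto
    moreover have "(- e - 2) * (p powr (- e - 2) / p) * p ^ k + p powr (- e - 2) * (of_nat k * p ^ k / p) =
        (of_nat k - e - 2) / p * g k p"
      using nz by (simp add: g_def field_simps)
    ultimately show ?thesis by simp
  qed
  have W: "has_wirtinger (\<lambda>u. g k (defect u)) ((of_nat k - e - 2) / p * g k p * (- cnj z))
      ((of_nat k - e - 2) / p * g k p * (- z)) z" for k
    using has_wirtinger_chain[OF has_wirtinger_defect D[unfolded p_def]] by (simp add: p_def)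
  have eq: "weight e u = m3 (g 4 (defect u)) 0 0 0 (g 2 (defect u)) 0 0 0 (g 0 (defect u))" for u
    by (simp add: weight_def Dpow_def diag3_m3 mat_m3 g_def)
  have "has_wirtinger_mat (weight e)
     (m3 ((of_nat 4 - e - 2) / p * g 4 p * (- cnj z)) 0 0 0 ((of_nat 2 - e - 2) / p * g 2 p * (- cnj z)) 0
       0 0 ((of_nat 0 - e - 2) / p * g 0 p * (- cnj z)))
     (m3 ((of_nat 4 - e - 2) / p * g 4 p * (- z)) 0 0 0 ((of_nat 2 - e - 2) / p * g 2 p * (- z)) 0
       0 0 ((of_nat 0 - e - 2) / p * g 0 p * (- z))) z"
    unfolding eq by (intro has_wirtinger_mat_m3 has_wirtinger_const W)
  moreover have "m3 ((of_nat 4 - e - 2) / p * g 4 p * (- cnj z)) 0 0 0 ((of_nat 2 - e - 2) / p * g 2 p * (- cnj z)) 0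
       0 0 ((of_nat 0 - e - 2) / p * g 0 p * (- cnj z)) =
     weight e z ** (mat (cnj z / defect z) ** diag3 (e - 2) e (e + 2))"
    unfolding eq by (simp add: mat_m3 diag3_m3 m3_eq_iff p_def[symmetric] nz field_simps)
  ultimately show ?thesis by metis
qed

section \<open>The curvature\<close>

text \<open>This is diag(e - 2, e, e + 2) plus the commutator of \<open>Nil3 s t\<close> with its
  transpose. The commutator has trace 0, so the trace is 3 e.\<close>

definition curv0 :: "complex \<Rightarrow> complex \<Rightarrow> complex \<Rightarrow> cmat3" where
  "curv0 e s t = diag3 (e - 2 - s\<^sup>2) (e + s\<^sup>2 - t\<^sup>2) (e + 2 + t\<^sup>2)"

text \<open>The polynomial in q that vanishes at 0 and has derivative
  \<open>Up s t (- q) ** curv0 e s t ** Up s t q\<close>.\<close>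

definition conn_primitive :: "complex \<Rightarrow> complex \<Rightarrow> complex \<Rightarrow> complex \<Rightarrow> cmat3" where
  "conn_primitive e s t q = m3
     ((e - 2 - s\<^sup>2) * q) (- (s * (2 + 2 * s\<^sup>2 - t\<^sup>2) / 2) * q\<^sup>2) ((s * t * (t\<^sup>2 - s\<^sup>2) / 2) * (q\<^sup>2 * q))
     0 ((e + s\<^sup>2 - t\<^sup>2) * q) (- (t * (2 + 2 * t\<^sup>2 - s\<^sup>2) / 2) * q\<^sup>2)
     0 0 ((e + 2 + t\<^sup>2) * q)"

definition connection :: "complex \<Rightarrow> complex \<Rightarrow> complex \<Rightarrow> complex \<Rightarrow> cmat3" where
  "connection e s t z = Lo s t z ** conn_primitive e s t (cnj z / defect z) ** Lo s t (- z)"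

definition hmetric :: "complex \<Rightarrow> complex \<Rightarrow> complex \<Rightarrow> complex \<Rightarrow> cmat3" where
  "hmetric e s t z = frame_adj s t z ** weight e z ** frame s t z"

definition hcurvature :: "complex \<Rightarrow> complex \<Rightarrow> complex \<Rightarrow> complex \<Rightarrow> cmat3" where
  "hcurvature e s t z = mat (1 / (defect z)\<^sup>2) ** (Lo s t z ** Up s t (- (cnj z / defect z))) **
     curv0 e s t ** frame s t z"

text \<open>The bracket on the left collects what three factors of the metric contribute to its
  logarithmic derivative: the generator from \<open>Lo\<close>, the multiple of q from
  \<open>weight\<close>, the multiple of q^2 from \<open>Up\<close>. Conjugated by
  \<open>Up s t q\<close>, it is the connection up to the generator.\<close>

lemma conn_primitive_eq:
  "(Nil3 s t + mat q ** diag3 (e - 2) e (e + 2) + mat (q\<^sup>2) ** transpose (Nil3 s t)) ** Up s t q =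
     Up s t q ** (conn_primitive e s t q + Nil3 s t)"
  by (simp add: Nil3_def mat_m3 diag3_m3 Up_m3 conn_primitive_def m3_eq_iff)
    (simp add: field_simps power2_eq_square)

lemma Nil3_Lo: "Nil3 s t ** Lo s t c = Lo s t c ** Nil3 s t"
  by (simp add: Nil3_def Lo_def mult_ac)

text \<open>Consecutive entries of \<open>weight e z\<close> have ratio p^2 with p =
  \<open>defect z\<close>. This factor cancels the 1/p^2 in the derivative of z/p when the generator
  is moved past the weight.\<close>

lemma Nil3_weight:
  "Nil3 s t ** weight e z = mat ((defect z)\<^sup>2) ** weight e z ** Nil3 s t"
  by (simp add: Nil3_def weight_def Dpow_def diag3_m3 mat_m3 m3_eq_iff power2_eq_square power4_eq_xxxx)

lemma mat_mult_left_commute: "(A :: cmat3) ** (mat x ** B) = mat x ** (A ** B)"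
  by (simp add: matrix_mul_assoc mat_commute)

text \<open>The product rule, followed by moving every logarithmic derivative to the right end,
  shows that the connection matrix h^-1 \<open>del\<close> h is
  \<open>connection e s t\<close>.\<close>

lemma has_wirtinger_hmetric:
  assumes "z \<in> unit_disc"
  shows "\<exists>B. has_wirtinger_mat (hmetric e s t) (hmetric e s t z ** connection e s t z) B z"
proof -
  define p q where "p = defect z" "q = cnj z / defect z"
  have p: "p \<noteq> 0" using assms by (simp add: p_q_def defect_nonzero)
  define N where "N = Nil3 s t"
  define L where "L = diag3 (e - 2) e (e + 2)"
  define W where "W = weight e z"
  obtain B where B: "has_wirtinger_mat (weight e) (W ** (mat q ** L)) B z"
    using has_wirtinger_weight[OF assms] unfolding p_q_def L_def W_def by blast
  have F1: "has_wirtinger_mat (\<lambda>u. Up s t (- cnj u))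
      (mat (- 0) ** transpose N ** Up s t (- cnj z)) (mat (- 1) ** transpose N ** Up s t (- cnj z)) z"
    unfolding N_def by (intro has_wirtinger_mat_Up has_wirtinger_uminus has_wirtinger_cnj)
  have F2: "has_wirtinger_mat (\<lambda>u. Lo s t (u / defect u))
      (mat (1 / p\<^sup>2) ** N ** Lo s t (z / p)) (mat ((z / p)\<^sup>2) ** N ** Lo s t (z / p)) z"
    unfolding N_def p_q_def
    by (intro has_wirtinger_mat_Lo has_wirtinger_over_defect assms)
  have F3: "has_wirtinger_mat (\<lambda>u. Up s t (cnj u / defect u))
      (mat (q\<^sup>2) ** transpose N ** Up s t q) (mat (1 / p\<^sup>2) ** transpose N ** Up s t q) z"
    unfolding N_def p_q_def
    by (intro has_wirtinger_mat_Up has_wirtinger_cnj_over_defect assms)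
  have F4: "has_wirtinger_mat (\<lambda>u. Lo s t (- u))
      (mat (- 1) ** N ** Lo s t (- z)) (mat (- 0) ** N ** Lo s t (- z)) z"
    unfolding N_def by (intro has_wirtinger_mat_Lo has_wirtinger_uminus has_wirtinger_ident)
  let ?A = "((mat (- 0) ** transpose N ** Up s t (- cnj z)) ** Lo s t (z / p) +
       Up s t (- cnj z) ** (mat (1 / p\<^sup>2) ** N ** Lo s t (z / p))) ** W +
      (Up s t (- cnj z) ** Lo s t (z / p)) ** (W ** (mat q ** L))"
  let ?A' = "?A ** (Up s t q ** Lo s t (- z)) +
      ((Up s t (- cnj z) ** Lo s t (z / p)) ** W) **
       ((mat (q\<^sup>2) ** transpose N ** Up s t q) ** Lo s t (- z) +
        Up s t q ** (mat (- 1) ** N ** Lo s t (- z)))"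
  have "\<exists>B'. has_wirtinger_mat (\<lambda>u. Up s t (- cnj u) ** Lo s t (u / defect u) ** weight e u **
      (Up s t (cnj u / defect u) ** Lo s t (- u))) ?A' B' z"
    unfolding p_q_def W_def
    by (rule exI, rule has_wirtinger_mat_mult[OF has_wirtinger_mat_mult[OF has_wirtinger_mat_mult[OF F1 F2] B]
      has_wirtinger_mat_mult[OF F3 F4], unfolded p_q_def W_def])
  moreover have "?A' = hmetric e s t z ** connection e s t z"
  proof -
    let ?U = "Up s t (- cnj z)" and ?V = "Lo s t (z / p)" and ?X = "Up s t q" and ?Y = "Lo s t (- z)"
    have 0: "mat (- 0) ** C = 0" for C :: cmat3
      by (simp add: matrix_matrix_mult_def vec_eq_iff mat_def)
    \<comment> \<open>The generator produced by the factor with parameter z/p commutes with that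
      factor and absorbs 1/p^2 on its way through W.\<close>
    have NV: "mat (1 / p\<^sup>2) ** (?U ** (N ** (?V ** (W ** C)))) = ?U ** (?V ** (W ** (N ** C)))" for C
    proof -
      have NVX: "N ** (?V ** X) = ?V ** (N ** X)" for X
        unfolding N_def by (simp only: matrix_mul_assoc Nil3_Lo)
      have "mat (1 / p\<^sup>2) ** (?U ** (N ** (?V ** (W ** C)))) = ?U ** (?V ** (mat (1 / p\<^sup>2) ** ((N ** W) ** C)))"
        by (simp only: NVX mat_mult_left_commute matrix_mul_assoc[symmetric])
      also have "\<dots> = ?U ** (?V ** (mat (1 / p\<^sup>2) ** mat (p\<^sup>2) ** (W ** (N ** C))))"
        unfolding N_def W_def Nil3_weight p_q_def by (simp only: matrix_mul_assoc)
      finally show ?thesis using p by (simp add: mat_mult_mat)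
    qed
    have "?A' = ?U ** (?V ** (W ** ((N + mat q ** L + mat (q\<^sup>2) ** transpose N) ** ?X ** ?Y)))
        + ?U ** (?V ** (W ** (?X ** (mat (- 1) ** (N ** ?Y)))))"
      using NV by (simp add: 0 matrix_add_ldistrib matrix_add_rdistrib mat_mult_left_commute Nil3_Lo[folded N_def]
          add_ac flip: matrix_mul_assoc)
    also have "(N + mat q ** L + mat (q\<^sup>2) ** transpose N) ** ?X = ?X ** (conn_primitive e s t q + N)"
      unfolding N_def L_def by (rule conn_primitive_eq)
    also have "?U ** (?V ** (W ** (?X ** (conn_primitive e s t q + N) ** ?Y)))
        + ?U ** (?V ** (W ** (?X ** (mat (- 1) ** (N ** ?Y))))) =
        ?U ** (?V ** (W ** (?X ** ((conn_primitive e s t q + N + mat (- 1) ** N) ** ?Y))))"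
      by (simp only: matrix_add_ldistrib matrix_add_rdistrib matrix_mul_assoc[symmetric])
    \<comment> \<open>The last factor \<open>Lo s t (- z)\<close> contributes minus the generator
      and so removes the surplus N of \<open>conn_primitive_eq\<close>.\<close>
    also have "conn_primitive e s t q + N + mat (- 1) ** N = conn_primitive e s t q"
      by (simp add: conn_primitive_def N_def Nil3_def mat_m3)
    \<comment> \<open>Inserting \<open>?Y ** Lo s t z\<close>, which is the identity, completes
      \<open>frame\<close> on the left and leaves the connection on the right.\<close>
    also have "?U ** (?V ** (W ** (?X ** (conn_primitive e s t q ** ?Y)))) =
       ?U ** ?V ** W ** (?X ** (?Y ** Lo s t z)) ** conn_primitive e s t q ** ?Y"
      by (simp add: Lo_add matrix_mul_assoc)
    finally show ?thesis
      unfolding hmetric_def connection_def frame_def frame_adj_def W_def p_q_def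
      by (simp only: matrix_mul_assoc)
  qed
  ultimately show ?thesis
    unfolding hmetric_def frame_def frame_adj_def by simp
qed

text \<open>The outer factors \<open>Lo s t z\<close> and \<open>Lo s t (- z)\<close> are
  holomorphic, so the antiholomorphic derivative only meets the polynomial in q. Its derivative in q
  is the matrix Q below, and q has antiholomorphic derivative 1/p^2.\<close>

lemma has_wirtinger_connection:
  assumes "z \<in> unit_disc"
  shows "\<exists>A. has_wirtinger_mat (connection e s t) A (hcurvature e s t z) z"
proof -
  define p q where "p = defect z" "q = cnj z / defect z"
  have p: "p \<noteq> 0" using assms by (simp add: p_q_def defect_nonzero)
  define Q where "Q = Up s t (- q) ** curv0 e s t ** Up s t q"
  have Q_eq: "Q = m3 (e - 2 - s\<^sup>2) (- (s * (2 + 2 * s\<^sup>2 - t\<^sup>2) * q)) (s * t * (t\<^sup>2 - s\<^sup>2) / 2 * (3 * q\<^sup>2)) 0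
      (e + s\<^sup>2 - t\<^sup>2) (- (t * (2 + 2 * t\<^sup>2 - s\<^sup>2) * q)) 0 0 (e + 2 + t\<^sup>2)"
    unfolding Q_def curv0_def diag3_m3 Up_m3 m3_mult m3_eq_iff
    by (simp add: field_simps power2_eq_square)
  have Q: "has_wirtinger (\<lambda>u. cnj u / defect u) (q\<^sup>2) (1 / p\<^sup>2) z"
    using has_wirtinger_cnj_over_defect[OF assms] by (simp add: p_q_def)
  note Q2 = has_wirtinger_power2[OF Q] 
  note Q3 = has_wirtinger_mult[OF Q2 Q]
  have "\<exists>A. has_wirtinger_mat (\<lambda>u. conn_primitive e s t (cnj u / defect u)) A (mat (1 / p\<^sup>2) ** Q) z"
  proof -
    have q: "cnj z / defect z = q" by (simp add: p_q_def)
    have q3: "3 * q\<^sup>2 * (1 / p\<^sup>2) = 2 * q * (1 / p\<^sup>2) * q + q\<^sup>2 * (1 / p\<^sup>2)"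
      by (simp add: power2_eq_square algebra_simps)
    have "\<exists>a. has_wirtinger (\<lambda>u. (cnj u / defect u)\<^sup>2) a (2 * q * (1 / p\<^sup>2)) z"
      by (rule exI, rule Q2[unfolded q])
    moreover have "\<exists>a. has_wirtinger (\<lambda>u. (cnj u / defect u)\<^sup>2 * (cnj u / defect u)) a (3 * q\<^sup>2 * (1 / p\<^sup>2)) z"
      unfolding q3 by (rule exI, rule Q3[unfolded q])
    ultimately obtain a2 a3 where *: "has_wirtinger (\<lambda>u. (cnj u / defect u)\<^sup>2) a2 (2 * q * (1 / p\<^sup>2)) z"
      "has_wirtinger (\<lambda>u. (cnj u / defect u)\<^sup>2 * (cnj u / defect u)) a3 (3 * q\<^sup>2 * (1 / p\<^sup>2)) z"
      by blast
    note m = has_wirtinger_mat_m3[OF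
        has_wirtinger_cmult[OF Q, of "e - 2 - s\<^sup>2"]
        has_wirtinger_cmult[OF *(1), of "- (s * (2 + 2 * s\<^sup>2 - t\<^sup>2) / 2)"]
        has_wirtinger_cmult[OF *(2), of "s * t * (t\<^sup>2 - s\<^sup>2) / 2"]
        has_wirtinger_const[of 0]
        has_wirtinger_cmult[OF Q, of "e + s\<^sup>2 - t\<^sup>2"]
        has_wirtinger_cmult[OF *(1), of "- (t * (2 + 2 * t\<^sup>2 - s\<^sup>2) / 2)"]
        has_wirtinger_const[of 0] has_wirtinger_const[of 0]
        has_wirtinger_cmult[OF Q, of "e + 2 + t\<^sup>2"]]
    have Qm: "mat (1 / p\<^sup>2) ** Q =
      m3 ((e - 2 - s\<^sup>2) * (1 / p\<^sup>2)) (- (s * (2 + 2 * s\<^sup>2 - t\<^sup>2) / 2) * (2 * q * (1 / p\<^sup>2)))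
       (s * t * (t\<^sup>2 - s\<^sup>2) / 2 * (3 * q\<^sup>2 * (1 / p\<^sup>2))) 0
       ((e + s\<^sup>2 - t\<^sup>2) * (1 / p\<^sup>2)) (- (t * (2 + 2 * t\<^sup>2 - s\<^sup>2) / 2) * (2 * q * (1 / p\<^sup>2))) 0 0
       ((e + 2 + t\<^sup>2) * (1 / p\<^sup>2))"
      unfolding Q_eq mat_m3 m3_mult by (simp add: m3_eq_iff)
    show ?thesis unfolding conn_primitive_def Qm by (rule exI, rule m)
  qed
  then obtain A where A: "has_wirtinger_mat (\<lambda>u. conn_primitive e s t (cnj u / defect u)) A (mat (1 / p\<^sup>2) ** Q) z"
    by blast
  have F1: "has_wirtinger_mat (\<lambda>u. Lo s t u)
      (mat 1 ** Nil3 s t ** Lo s t z) (mat 0 ** Nil3 s t ** Lo s t z) z"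
    by (intro has_wirtinger_mat_Lo has_wirtinger_ident)
  have F2: "has_wirtinger_mat (\<lambda>u. Lo s t (- u))
      (mat (- 1) ** Nil3 s t ** Lo s t (- z)) (mat (- 0) ** Nil3 s t ** Lo s t (- z)) z"
    by (intro has_wirtinger_mat_Lo has_wirtinger_uminus has_wirtinger_ident)
  have 0: "mat 0 ** C = 0" "mat (- 0) ** C = 0" "C ** 0 = 0" "0 ** C = 0" for C :: cmat3
    by (simp_all add: matrix_matrix_mult_def vec_eq_iff mat_def)
  have eq: "(mat 0 ** Nil3 s t ** Lo s t z ** conn_primitive e s t q +
      Lo s t z ** (mat (1 / p\<^sup>2) ** Q)) ** Lo s t (- z) +
      Lo s t z ** conn_primitive e s t q ** (mat (- 0) ** Nil3 s t ** Lo s t (- z)) = hcurvature e s t z"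
    unfolding hcurvature_def frame_def Q_def p_q_def
    by (simp add: 0 mat_mult_left_commute flip: matrix_mul_assoc)
  have q: "cnj z / defect z = q" by (simp add: p_q_def)
  show ?thesis
    unfolding connection_def eq[symmetric]
    by (rule exI, rule has_wirtinger_mat_mult[OF has_wirtinger_mat_mult[OF F1 A] F2, unfolded q])
qed

section \<open>Closed form of the curvature\<close>

lemma metric_hmetric:
  assumes "admissible l \<mu>" "z \<in> unit_disc"
  shows "metric l \<mu> z = hmetric (2 * l) (s_of l \<mu>) (t_of l \<mu>) z"
  unfolding metric_eq[OF assms] hmetric_def weight_def by simp

lemma frame_inverse: "frame s t z ** (Lo s t z ** Up s t (- (cnj z / defect z))) = mat 1"
proof -
  have "frame s t z ** (Lo s t z ** Up s t (- (cnj z / defect z))) =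
    Up s t (cnj z / defect z) ** (Lo s t (- z) ** Lo s t z) ** Up s t (- (cnj z / defect z))"
    by (simp only: frame_def matrix_mul_assoc)
  then show ?thesis by (simp add: Lo_add Up_add)
qed

lemma frame_inverse': "Lo s t z ** Up s t (- (cnj z / defect z)) ** frame s t z = mat 1"
  using frame_inverse matrix_left_right_inverse by blast

lemma frame_adj_inverse: "Lo s t (- (z / defect z)) ** Up s t (cnj z) ** frame_adj s t z = mat 1"
proof -
  have "Lo s t (- (z / defect z)) ** Up s t (cnj z) ** frame_adj s t z =
    Lo s t (- (z / defect z)) ** (Up s t (cnj z) ** Up s t (- cnj z)) ** Lo s t (z / defect z)"
    by (simp only: frame_adj_def matrix_mul_assoc)
  then show ?thesis by (simp add: Lo_add Up_add)
qed

lemma hmetric_inverse: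
  assumes "z \<in> unit_disc"
  shows "matrix_inv (hmetric e s t z) ** hmetric e s t z = mat 1"
proof -
  have p: "defect z \<noteq> 0" using assms by (rule defect_nonzero)
  define W' where "W' = mat (1 / defect z powr (- e - 2)) ** diag3 (1 / defect z ^ 4) (1 / (defect z)\<^sup>2) 1"
  have W: "weight e z ** W' = mat 1"
    using p by (simp add: W'_def weight_def Dpow_def diag3_m3 mat_m3)
  have adj: "frame_adj s t z ** (Lo s t (- (z / defect z)) ** Up s t (cnj z)) = mat 1"
    using frame_adj_inverse matrix_left_right_inverse by blast
  have "hmetric e s t z ** ((Lo s t z ** Up s t (- (cnj z / defect z))) ** W' **
       (Lo s t (- (z / defect z)) ** Up s t (cnj z))) =
     frame_adj s t z ** (weight e z ** ((frame s t z ** (Lo s t z ** Up s t (- (cnj z / defect z)))) ** W')) **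
       (Lo s t (- (z / defect z)) ** Up s t (cnj z))"
    unfolding hmetric_def by (simp only: matrix_mul_assoc)
  also have "\<dots> = mat 1"
    by (simp only: frame_inverse matrix_mul_lid matrix_mul_rid W adj)
  finally have *: "hmetric e s t z ** ((Lo s t z ** Up s t (- (cnj z / defect z))) ** W' **
       (Lo s t (- (z / defect z)) ** Up s t (cnj z))) = mat 1" .
  show ?thesis
    unfolding matrix_inv_eqI[OF *] using * matrix_left_right_inverse by blast
qed

lemma curvature_hcurvature:
  assumes adm: "admissible l \<mu>" and z: "z \<in> unit_disc"
  shows "curvature l \<mu> z = hcurvature (2 * l) (s_of l \<mu>) (t_of l \<mu>) z"
proof -
  let ?e = "complex_of_real (2 * l)" and ?s = "complex_of_real (s_of l \<mu>)" and ?t = "complex_of_real (t_of l \<mu>)"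
  have conn: "matrix_inv (metric l \<mu> u) ** del (metric l \<mu>) u = connection ?e ?s ?t u"
    if u: "u \<in> unit_disc" for u
  proof -
    obtain B where "has_wirtinger_mat (hmetric ?e ?s ?t) (hmetric ?e ?s ?t u ** connection ?e ?s ?t u) B u"
      using has_wirtinger_hmetric[OF u] by blast
    then have "has_wirtinger_mat (metric l \<mu>) (hmetric ?e ?s ?t u ** connection ?e ?s ?t u) B u"
      by (rule has_wirtinger_mat_cong[OF _ open_ball u]) (use metric_hmetric[OF adm] in simp)
    then have "del (metric l \<mu>) u = hmetric ?e ?s ?t u ** connection ?e ?s ?t u"
      by (rule del_eqI)
    then show ?thesis
      using metric_hmetric[OF adm u] hmetric_inverse[OF u, of ?e ?s ?t] by (simp add: matrix_mul_assoc)
  qed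
  obtain A where "has_wirtinger_mat (connection ?e ?s ?t) A (hcurvature ?e ?s ?t z) z"
    using has_wirtinger_connection[OF z] by blast
  then have "has_wirtinger_mat (\<lambda>u. matrix_inv (metric l \<mu> u) ** del (metric l \<mu>) u) A (hcurvature ?e ?s ?t z) z"
    by (rule has_wirtinger_mat_cong[OF _ open_ball z]) (use conn in simp)
  then show ?thesis
    unfolding curvature_def by (rule delbar_eqI)
qed

lemma curvature_0:
  assumes "admissible l \<mu>"
  shows "curvature l \<mu> 0 = curv0 (2 * l) (s_of l \<mu>) (t_of l \<mu>)"
  using curvature_hcurvature[OF assms, of 0] by (simp add: hcurvature_def frame_def defect_def)

section \<open>Intertwining curvatures\<close>

lemma conj_transpose_mult: "conj_transpose (A ** B) = conj_transpose B ** conj_transpose A"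
  by (simp add: conj_transpose_def matrix_matrix_mult_def vec_eq_iff mult.commute)

lemma cdot_conj_transpose: "cdot x (A *v y) = cdot (conj_transpose A *v x) y"
  by (simp add: cdot_def conj_transpose_def matrix_vector_mult_def sum_3 algebra_simps)

lemma conj_transpose_frame:
  assumes "cnj s = s" "cnj t = t"
  shows "conj_transpose (frame s t z) = frame_adj s t z"
  unfolding frame_def frame_adj_def conj_transpose_mult
  using assms by (simp add: Lo_def Up_m3 del: m3_mult)

lemma conj_transpose_inverse:
  assumes "A ** B = mat 1"
  shows "conj_transpose B ** conj_transpose A = mat 1"
proof -
  have "conj_transpose (mat 1) = mat 1" by (simp add: mat_m3)
  then show ?thesis using assms by (simp flip: conj_transpose_mult)
qed

text \<open>Read in the frames Y and Y', both metrics are \<open>weight e z\<close> and both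
  curvatures are the diagonal matrices \<open>curv0\<close> up to one common scalar. A matrix T that
  respects these data therefore gives the required unitary map after changing frames.\<close>

lemma hcurvatures_equivalent:
  assumes real: "cnj s = s" "cnj t = t" "cnj s' = s'" "cnj t' = t'"
    and T: "T ** T = mat 1" "T ** curv0 e s t = curv0 e s' t' ** T"
      "conj_transpose T ** weight e z ** T = weight e z"
  shows "\<exists>U. invertible U \<and>
    (\<forall>x y. cdot (hmetric e s' t' z *v (U *v x)) (U *v y) = cdot (hmetric e s t z *v x) y) \<and>
    U ** hcurvature e s t z = hcurvature e s' t' z ** U"
proof -
  define Y Y' where "Y = frame s t z" "Y' = frame s' t' z"
  define Z Z' where "Z = Lo s t z ** Up s t (- (cnj z / defect z))"
    "Z' = Lo s' t' z ** Up s' t' (- (cnj z / defect z))"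
  have inv: "Y ** Z = mat 1" "Z ** Y = mat 1" "Y' ** Z' = mat 1" "Z' ** Y' = mat 1"
    unfolding Y_Y'_def Z_Z'_def by (rule frame_inverse frame_inverse')+
  define c where "c = 1 / (defect z)\<^sup>2"
  have curv: "hcurvature e s t z = mat c ** Z ** curv0 e s t ** Y"
    "hcurvature e s' t' z = mat c ** Z' ** curv0 e s' t' ** Y'"
    unfolding hcurvature_def Y_Y'_def Z_Z'_def c_def by (simp_all only:)
  have met: "hmetric e s t z = conj_transpose Y ** weight e z ** Y"
    "hmetric e s' t' z = conj_transpose Y' ** weight e z ** Y'"
    unfolding hmetric_def Y_Y'_def using real by (simp_all add: conj_transpose_frame)
  define U where "U = Z' ** T ** Y"
  have Y'U: "Y' ** U = T ** Y"
    by (simp add: U_def matrix_mul_assoc inv)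
  have "U ** (Z ** T ** Y') = Z' ** (T ** (Y ** Z) ** T) ** Y'"
    by (simp only: U_def matrix_mul_assoc)
  then have "U ** (Z ** T ** Y') = mat 1"
    by (simp add: inv T)
  then have "invertible U"
    unfolding invertible_def using matrix_left_right_inverse by blast
  moreover have "cdot (hmetric e s' t' z *v (U *v x)) (U *v y) = cdot (hmetric e s t z *v x) y" for x y
  proof -
    have "conj_transpose U ** hmetric e s' t' z ** U = conj_transpose (Y' ** U) ** weight e z ** (Y' ** U)"
      unfolding met conj_transpose_mult by (simp only: matrix_mul_assoc)
    also have "\<dots> = conj_transpose Y ** (conj_transpose T ** weight e z ** T) ** Y"
      unfolding Y'U conj_transpose_mult by (simp only: matrix_mul_assoc)
    finally have "conj_transpose U ** hmetric e s' t' z ** U = hmetric e s t z"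
      by (simp add: T met)
    then show ?thesis
      by (simp add: cdot_conj_transpose matrix_vector_mul_assoc matrix_mul_assoc)
  qed
  moreover have "U ** hcurvature e s t z = hcurvature e s' t' z ** U"
  proof -
    have "U ** hcurvature e s t z = mat c ** (Z' ** T ** (Y ** Z) ** curv0 e s t ** Y)"
      unfolding curv U_def by (simp only: mat_mult_left_commute matrix_mul_assoc[symmetric])
    also have "\<dots> = mat c ** Z' ** (T ** curv0 e s t) ** Y"
      by (simp add: inv matrix_mul_assoc)
    also have "\<dots> = mat c ** Z' ** curv0 e s' t' ** (T ** Y)"
      unfolding T by (simp only: matrix_mul_assoc)
    also have "\<dots> = hcurvature e s' t' z ** U"
      unfolding Y'U[symmetric] curv by (simp only: matrix_mul_assoc)
    finally show ?thesis .
  qed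
  ultimately show ?thesis by blast
qed

text \<open>A transposition of coordinates is unitary for \<open>weight e z\<close> only after
  rescaling: neighbouring weights have ratio p^2, hence the entries p and 1/p.\<close>

definition swap12 :: "complex \<Rightarrow> cmat3" where
  "swap12 p = m3 0 (1 / p) 0 p 0 0 0 0 1"

definition swap23 :: "complex \<Rightarrow> cmat3" where
  "swap23 p = m3 1 0 0 0 0 (1 / p) 0 p 0"

lemma swap_involution:
  "p \<noteq> 0 \<Longrightarrow> swap12 p ** swap12 p = mat 1" "p \<noteq> 0 \<Longrightarrow> swap23 p ** swap23 p = mat 1"
  by (simp_all add: swap12_def swap23_def mat_m3)

lemma swap_weight:
  assumes "z \<in> unit_disc"
  shows "conj_transpose (swap12 (defect z)) ** weight e z ** swap12 (defect z) = weight e z"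
    "conj_transpose (swap23 (defect z)) ** weight e z ** swap23 (defect z) = weight e z"
  using defect_nonzero[OF assms]
  by (simp_all add: swap12_def swap23_def weight_def Dpow_def diag3_m3 mat_m3 m3_eq_iff
      power2_eq_square power4_eq_xxxx)

text \<open>Constant matrices pass through both derivatives. In h^-1 \<open>del\<close> h the left
  factor A cancels, while B conjugates first the connection and then the curvature.\<close>

lemma metric_gauge:
  assumes adm: "admissible l \<mu>" "admissible l' \<mu>'"
    and A: "A ** Ai = mat 1" and B: "B ** Bi = mat 1"
    and gauge: "\<And>z. z \<in> unit_disc \<Longrightarrow> metric l' \<mu>' z = A ** metric l \<mu> z ** B"
    and z: "z \<in> unit_disc"
  shows "B ** curvature l' \<mu>' z = curvature l \<mu> z ** B"
proof -
  let ?h = "hmetric (2 * l) (s_of l \<mu>) (t_of l \<mu>)" and ?h' = "hmetric (2 * l') (s_of l' \<mu>') (t_of l' \<mu>')"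
  let ?c = "connection (2 * l) (s_of l \<mu>) (t_of l \<mu>)" and ?c' = "connection (2 * l') (s_of l' \<mu>') (t_of l' \<mu>')"
  have h: "?h' u = A ** ?h u ** B" if "u \<in> unit_disc" for u
    using gauge[OF that] metric_hmetric[OF adm(1) that] metric_hmetric[OF adm(2) that] by simp
  have c: "?c' u = Bi ** ?c u ** B" if u: "u \<in> unit_disc" for u
  proof -
    obtain B1 where "has_wirtinger_mat ?h (?h u ** ?c u) B1 u"
      using has_wirtinger_hmetric[OF u] by blast
    note has_wirtinger_mat_mult[OF has_wirtinger_mat_mult[OF has_wirtinger_mat_const[of A] this] has_wirtinger_mat_const[of B]]
    then have "has_wirtinger_mat ?h' ((0 ** ?h u + A ** (?h u ** ?c u)) ** B + A ** ?h u ** 0)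
        ((0 ** ?h u + A ** B1) ** B + A ** ?h u ** 0) u"
      by (rule has_wirtinger_mat_cong[OF _ open_ball u]) (use h in simp)
    then have "del ?h' u = (0 ** ?h u + A ** (?h u ** ?c u)) ** B + A ** ?h u ** 0"
      by (rule del_eqI)
    moreover obtain B2 where "has_wirtinger_mat ?h' (?h' u ** ?c' u) B2 u"
      using has_wirtinger_hmetric[OF u] by blast
    then have "del ?h' u = ?h' u ** ?c' u"
      by (rule del_eqI)
    moreover have "0 ** M = 0" "M ** 0 = 0" for M :: cmat3
      by (simp_all add: matrix_matrix_mult_def vec_eq_iff)
    ultimately have "?h' u ** ?c' u = A ** ?h u ** ?c u ** B"
      by (simp add: matrix_mul_assoc)
    also have "\<dots> = A ** ?h u ** (B ** Bi) ** ?c u ** B"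
      by (simp add: B)
    also have "\<dots> = ?h' u ** (Bi ** ?c u ** B)"
      unfolding h[OF u] by (simp only: matrix_mul_assoc)
    finally have "matrix_inv (?h' u) ** (?h' u ** ?c' u) = matrix_inv (?h' u) ** (?h' u ** (Bi ** ?c u ** B))"
      by simp
    then show ?thesis
      by (simp only: matrix_mul_assoc hmetric_inverse[OF u] matrix_mul_lid)
  qed
  obtain A1 where "has_wirtinger_mat ?c A1 (hcurvature (2 * l) (s_of l \<mu>) (t_of l \<mu>) z) z"
    using has_wirtinger_connection[OF z] by blast
  note has_wirtinger_mat_mult[OF has_wirtinger_mat_mult[OF has_wirtinger_mat_const[of Bi] this] has_wirtinger_mat_const[of B]]
  then have "has_wirtinger_mat ?c' ((0 ** ?c z + Bi ** A1) ** B + Bi ** ?c z ** 0)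
     ((0 ** ?c z + Bi ** hcurvature (2 * l) (s_of l \<mu>) (t_of l \<mu>) z) ** B + Bi ** ?c z ** 0) z"
    by (rule has_wirtinger_mat_cong[OF _ open_ball z]) (use c in simp)
  then have "delbar ?c' z = (0 ** ?c z + Bi ** hcurvature (2 * l) (s_of l \<mu>) (t_of l \<mu>) z) ** B + Bi ** ?c z ** 0"
    by (rule delbar_eqI)
  moreover obtain A2 where "has_wirtinger_mat ?c' A2 (hcurvature (2 * l') (s_of l' \<mu>') (t_of l' \<mu>') z) z"
    using has_wirtinger_connection[OF z] by blast
  then have "delbar ?c' z = hcurvature (2 * l') (s_of l' \<mu>') (t_of l' \<mu>') z"
    by (rule delbar_eqI)
  moreover have "0 ** M = 0" "M ** 0 = 0" for M :: cmat3
    by (simp_all add: matrix_matrix_mult_def vec_eq_iff)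
  ultimately have "curvature l' \<mu>' z = Bi ** curvature l \<mu> z ** B"
    using curvature_hcurvature[OF adm(1) z] curvature_hcurvature[OF adm(2) z] by simp
  then have "B ** curvature l' \<mu>' z = (B ** Bi) ** curvature l \<mu> z ** B"
    by (simp only: matrix_mul_assoc)
  then show ?thesis by (simp add: B)
qed

text \<open>The curvature without its scalar factor, which cancels in any intertwining relation and
  need not be differentiated.\<close>

definition curv_core :: "complex \<Rightarrow> complex \<Rightarrow> complex \<Rightarrow> complex \<Rightarrow> cmat3" where
  "curv_core e s t z = Lo s t z ** Up s t (- (cnj z / defect z)) ** curv0 e s t **
     (Up s t (cnj z / defect z) ** Lo s t (- z))"

lemma hcurvature_core: "hcurvature e s t z = mat (1 / (defect z)\<^sup>2) ** curv_core e s t z"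
  by (simp add: hcurvature_def curv_core_def frame_def matrix_mul_assoc)

text \<open>At 0 both q and its holomorphic derivative q^2 vanish, so only the two factors
  \<open>Lo\<close> contribute. The result is the commutator of \<open>Nil3 s t\<close> with
  \<open>curv0 e s t\<close>.\<close>

lemma has_wirtinger_curv_core_0:
  "\<exists>B. has_wirtinger_mat (curv_core e s t)
     (Nil3 s t ** curv0 e s t + mat (- 1) ** (curv0 e s t ** Nil3 s t)) B 0"
proof -
  have q: "has_wirtinger (\<lambda>u. cnj u / defect u) 0 1 0"
    using has_wirtinger_cnj_over_defect[of 0] by (simp add: defect_def)
  have F1: "has_wirtinger_mat (\<lambda>u. Lo s t u)
      (mat 1 ** Nil3 s t ** Lo s t 0) (mat 0 ** Nil3 s t ** Lo s t 0) 0"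
    by (intro has_wirtinger_mat_Lo has_wirtinger_ident)
  have F2: "has_wirtinger_mat (\<lambda>u. Lo s t (- u))
      (mat (- 1) ** Nil3 s t ** Lo s t (- 0)) (mat (- 0) ** Nil3 s t ** Lo s t (- 0)) 0"
    by (intro has_wirtinger_mat_Lo has_wirtinger_uminus has_wirtinger_ident)
  note F3 = has_wirtinger_mat_Up[OF q, of s t]
  note F4 = has_wirtinger_mat_Up[OF has_wirtinger_uminus[OF q], of s t]
  note F = has_wirtinger_mat_mult[OF has_wirtinger_mat_mult[OF has_wirtinger_mat_mult[OF F1 F4]
        has_wirtinger_mat_const[of "curv0 e s t"]] has_wirtinger_mat_mult[OF F3 F2]]
  have 0: "0 ** M = 0" "M ** 0 = 0" "mat 0 = (0 :: cmat3)" for M :: cmat3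
    by (simp_all add: matrix_matrix_mult_def vec_eq_iff mat_def)
  let ?M = "((mat 1 ** Nil3 s t ** Lo s t 0) ** Up s t (- (cnj 0 / defect 0)) +
      Lo s t 0 ** (mat (- 0) ** transpose (Nil3 s t) ** Up s t (- (cnj 0 / defect 0)))) ** curv0 e s t +
      Lo s t 0 ** Up s t (- (cnj 0 / defect 0)) ** 0"
  let ?N = "(mat 0 ** transpose (Nil3 s t) ** Up s t (cnj 0 / defect 0)) ** Lo s t (- 0) +
      Up s t (cnj 0 / defect 0) ** (mat (- 1) ** Nil3 s t ** Lo s t (- 0))"
  have eq: "?M ** (Up s t (cnj 0 / defect 0) ** Lo s t (- 0)) + Lo s t 0 ** Up s t (- (cnj 0 / defect 0)) ** curv0 e s t ** ?N =
      Nil3 s t ** curv0 e s t + mat (- 1) ** (curv0 e s t ** Nil3 s t)"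
    by (simp add: 0 mat_mult_left_commute)
  show ?thesis
    unfolding curv_core_def eq[symmetric] by (rule exI, rule F)
qed

lemma mat_cancel:
  assumes "mat c ** X = mat c ** (Y :: cmat3)" "c \<noteq> 0"
  shows "X = Y"
proof -
  have "mat (1 / c) ** (mat c ** X) = mat (1 / c) ** (mat c ** Y)"
    using assms by simp
  then show ?thesis
    using assms(2) by (simp add: matrix_mul_assoc mat_mult_mat)
qed

text \<open>The first three equations are entries of the intertwining relation at 0. The last two
  are entries (2,1) and (3,2) of its holomorphic derivative at 0, which equates W [N', C'] with
  [N, C] W for the generators N, N' and the curvatures C, C' at 0.\<close>

lemma curvature_intertwiner:
  assumes adm: "admissible l \<mu>" "admissible l' \<mu>'"
    and W: "\<And>z. z \<in> unit_disc \<Longrightarrow> W ** curvature l' \<mu>' z = curvature l \<mu> z ** W"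
    and C: "curvature l \<mu> 0 = diag3 a b c" "curvature l' \<mu>' 0 = diag3 a' b' c'"
  shows "W $ i $ 1 * a' = diag3 a b c $ i $ i * W $ i $ 1"
    "W $ i $ 2 * b' = diag3 a b c $ i $ i * W $ i $ 2"
    "W $ i $ 3 * c' = diag3 a b c $ i $ i * W $ i $ 3"
    "W $ 2 $ 2 * (s_of l' \<mu>' * (a' - b')) = s_of l \<mu> * (a - b) * W $ 1 $ 1"
    "W $ 3 $ 3 * (t_of l' \<mu>' * (b' - c')) = t_of l \<mu> * (b - c) * W $ 2 $ 2"
proof -
  have W0: "W ** diag3 a' b' c' = diag3 a b c ** W"
    using W[of 0] C by simp
  have entry: "(W ** diag3 a' b' c') $ i $ j = (diag3 a b c ** W) $ i $ j" for j
    by (simp only: W0)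
  show "W $ i $ 1 * a' = diag3 a b c $ i $ i * W $ i $ 1"
    "W $ i $ 2 * b' = diag3 a b c $ i $ i * W $ i $ 2"
    "W $ i $ 3 * c' = diag3 a b c $ i $ i * W $ i $ 3"
    using entry[of 1] entry[of 2] entry[of 3] exhaust_3[of i]
    by (auto simp: matrix_matrix_mult_def sum_3 diag3_m3)
  let ?s = "complex_of_real (s_of l \<mu>)" and ?t = "complex_of_real (t_of l \<mu>)"
  let ?s' = "complex_of_real (s_of l' \<mu>')" and ?t' = "complex_of_real (t_of l' \<mu>')"
  let ?K = "curv_core (of_real (2 * l)) ?s ?t" and ?K' = "curv_core (of_real (2 * l')) ?s' ?t'"
  have K: "W ** ?K' z = ?K z ** W" if z: "z \<in> unit_disc" for z
  proof -
    have "mat (1 / (defect z)\<^sup>2) ** (W ** ?K' z) = W ** curvature l' \<mu>' z"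
      unfolding curvature_hcurvature[OF adm(2) z] hcurvature_core by (rule mat_mult_left_commute[symmetric])
    also have "\<dots> = mat (1 / (defect z)\<^sup>2) ** (?K z ** W)"
      unfolding W[OF z] curvature_hcurvature[OF adm(1) z] hcurvature_core by (simp only: matrix_mul_assoc)
    finally show ?thesis
      by (rule mat_cancel) (simp add: defect_nonzero[OF z])
  qed
  let ?D = "Nil3 ?s ?t ** diag3 a b c + mat (- 1) ** (diag3 a b c ** Nil3 ?s ?t)"
  let ?D' = "Nil3 ?s' ?t' ** diag3 a' b' c' + mat (- 1) ** (diag3 a' b' c' ** Nil3 ?s' ?t')"
  have c0: "curv0 (of_real (2 * l)) ?s ?t = diag3 a b c" "curv0 (of_real (2 * l')) ?s' ?t' = diag3 a' b' c'"
    using curvature_0[OF adm(1)] curvature_0[OF adm(2)] C by simp_all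
  obtain B where B: "has_wirtinger_mat ?K ?D B 0"
    using has_wirtinger_curv_core_0[of "of_real (2 * l)" ?s ?t] unfolding c0 ..
  obtain B' where B': "has_wirtinger_mat ?K' ?D' B' 0"
    using has_wirtinger_curv_core_0[of "of_real (2 * l')" ?s' ?t'] unfolding c0 ..
  have z0: "(0 :: complex) \<in> unit_disc" by simp
  \<comment> \<open>The same function is differentiated in two ways: directly, and through its other
    form \<open>W ** ?K' z\<close>, which is valid on the disc.\<close>
  have "del (\<lambda>z. ?K z ** W) 0 = ?D ** W + ?K 0 ** 0"
    by (rule del_eqI[OF has_wirtinger_mat_mult[OF B has_wirtinger_mat_const]])
  moreover have "del (\<lambda>z. ?K z ** W) 0 = 0 ** ?K' 0 + W ** ?D'"
    by (rule del_eqI[OF has_wirtinger_mat_cong[OF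
        has_wirtinger_mat_mult[OF has_wirtinger_mat_const B'] open_ball z0 K]])
  moreover have "0 ** M = 0" "M ** 0 = 0" for M :: cmat3
    by (simp_all add: matrix_matrix_mult_def vec_eq_iff)
  ultimately have "W ** ?D' = ?D ** W" by simp
  then have entries: "(W ** ?D') $ 2 $ 1 = (?D ** W) $ 2 $ 1" "(W ** ?D') $ 3 $ 2 = (?D ** W) $ 3 $ 2"
    by (simp_all only:)
  have D: "?D = m3 0 0 0 (?s * (a - b)) 0 0 0 (?t * (b - c)) 0"
    "?D' = m3 0 0 0 (?s' * (a' - b')) 0 0 0 (?t' * (b' - c')) 0"
    by (simp_all add: diag3_m3 mat_m3 Nil3_def m3_eq_iff algebra_simps)
  show "W $ 2 $ 2 * (s_of l' \<mu>' * (a' - b')) = s_of l \<mu> * (a - b) * W $ 1 $ 1"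
    "W $ 3 $ 3 * (t_of l' \<mu>' * (b' - c')) = t_of l \<mu> * (b - c) * W $ 2 $ 2"
    using entries unfolding D by (simp_all add: matrix_matrix_mult_def sum_3)
qed

section \<open>Hilbert spaces of functions\<close>

text \<open>The space is a carrier set with an explicit form rather than a type, so Cauchy-Schwarz
  and Riesz representation are derived from the clauses of
  \<open>complex_hilbert_space\<close>.\<close>

locale function_hilbert_space =
  fixes H :: "(complex \<Rightarrow> cvec3) set"
    and ip :: "(complex \<Rightarrow> cvec3) \<Rightarrow> (complex \<Rightarrow> cvec3) \<Rightarrow> complex"
  assumes hilbert: "complex_hilbert_space H ip"
begin

abbreviation sqnorm :: "(complex \<Rightarrow> cvec3) \<Rightarrow> real" where
  "sqnorm f \<equiv> Re (ip f f)"

lemma zero_in: "(\<lambda>z. 0) \<in> H"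
  and add_in: "f \<in> H \<Longrightarrow> g \<in> H \<Longrightarrow> (\<lambda>z. f z + g z) \<in> H"
  and scale_in: "f \<in> H \<Longrightarrow> (\<lambda>z. c *s f z) \<in> H"
  and ip_add: "f \<in> H \<Longrightarrow> g \<in> H \<Longrightarrow> h \<in> H \<Longrightarrow> ip (\<lambda>z. f z + g z) h = ip f h + ip g h"
  and ip_scale: "f \<in> H \<Longrightarrow> g \<in> H \<Longrightarrow> ip (\<lambda>z. c *s f z) g = c * ip f g"
  and ip_cnj: "f \<in> H \<Longrightarrow> g \<in> H \<Longrightarrow> ip g f = cnj (ip f g)"
  and sqnorm_pos: "f \<in> H \<Longrightarrow> f \<noteq> (\<lambda>z. 0) \<Longrightarrow> 0 < sqnorm f"
  using hilbert unfolding complex_hilbert_space_def by blast+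

lemma complete:
  assumes "\<And>n. X n \<in> H"
    and "\<And>e. 0 < e \<Longrightarrow> \<exists>N. \<forall>m\<ge>N. \<forall>n\<ge>N. sqnorm (\<lambda>z. X m z - X n z) < e"
  obtains f where "f \<in> H" "(\<lambda>n. sqnorm (\<lambda>z. X n z - f z)) \<longlonglongrightarrow> 0"
  using hilbert assms unfolding complex_hilbert_space_def by blast

lemma ip_add_right: "f \<in> H \<Longrightarrow> g \<in> H \<Longrightarrow> h \<in> H \<Longrightarrow> ip h (\<lambda>z. f z + g z) = ip h f + ip h g"
  using ip_cnj[of "\<lambda>z. f z + g z" h] ip_cnj[of f h] ip_cnj[of g h] by (simp add: ip_add add_in)

lemma ip_scale_right: "f \<in> H \<Longrightarrow> g \<in> H \<Longrightarrow> ip g (\<lambda>z. c *s f z) = cnj c * ip g f"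
  using ip_cnj[of "\<lambda>z. c *s f z" g] ip_cnj[of f g] by (simp add: ip_scale scale_in)

lemma diff_eq: "(\<lambda>z. f z - g z) = (\<lambda>z. f z + (- 1) *s g z)" for f g :: "complex \<Rightarrow> cvec3"
  by (auto simp: vec_eq_iff)

lemma diff_in: "f \<in> H \<Longrightarrow> g \<in> H \<Longrightarrow> (\<lambda>z. f z - g z) \<in> H"
  unfolding diff_eq by (intro add_in scale_in)

lemma ip_diff: "f \<in> H \<Longrightarrow> g \<in> H \<Longrightarrow> h \<in> H \<Longrightarrow> ip (\<lambda>z. f z - g z) h = ip f h - ip g h"
  unfolding diff_eq using ip_add[of f "\<lambda>z. (- 1) *s g z" h] scale_in[of g "- 1"] ip_scale[of g h "- 1"]
  by simp

lemma ip_diff_right: "f \<in> H \<Longrightarrow> g \<in> H \<Longrightarrow> h \<in> H \<Longrightarrow> ip h (\<lambda>z. f z - g z) = ip h f - ip h g"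
  using ip_cnj[of "\<lambda>z. f z - g z" h] ip_cnj[of f h] ip_cnj[of g h] by (simp add: ip_diff diff_in)

lemma ip_zero: "f \<in> H \<Longrightarrow> ip (\<lambda>z. 0) f = 0"
  using ip_scale[OF zero_in, of f 0] by simp

lemma sqnorm_nonneg: "f \<in> H \<Longrightarrow> 0 \<le> sqnorm f"
  using sqnorm_pos[of f] ip_zero[OF zero_in] by (cases "f = (\<lambda>z. 0)") auto

lemma ip_self: "f \<in> H \<Longrightarrow> ip f f = of_real (sqnorm f)"
  using ip_cnj[of f f] by (simp add: complex_eq_iff)

lemma sqnorm_add_real:
  assumes "f \<in> H" "h \<in> H"
  shows "sqnorm (\<lambda>z. f z + of_real t *s h z) = sqnorm f + 2 * t * Re (ip f h) + t\<^sup>2 * sqnorm h"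
proof -
  have th: "(\<lambda>z. of_real t *s h z) \<in> H" using assms by (simp add: scale_in)
  have "Re (ip h f) = Re (ip f h)"
    using ip_cnj[OF assms] by simp
  then show ?thesis
    using assms th
    by (simp add: ip_add ip_add_right add_in ip_scale ip_scale_right power2_eq_square algebra_simps)
qed

lemma Cauchy_Schwarz:
  assumes "f \<in> H" "g \<in> H"
  shows "(cmod (ip f g))\<^sup>2 \<le> sqnorm f * sqnorm g"
proof (cases "g = (\<lambda>z. 0)")
  case True
  then show ?thesis using assms ip_cnj[OF assms] by (simp add: ip_zero)
next
  case False
  define N where "N = sqnorm g"
  have pos: "0 < N" unfolding N_def using False assms sqnorm_pos by blast
  have gg: "ip g g = of_real N" unfolding N_def using assms ip_self by blast
  define c where "c = ip f g / of_real N"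
  have cg: "(\<lambda>z. c *s g z) \<in> H" using assms by (simp add: scale_in)
  have "ip (\<lambda>z. f z - c *s g z) (\<lambda>z. f z - c *s g z) =
      ip f f - cnj c * ip f g - (c * ip g f - c * cnj c * ip g g)"
    using assms cg by (simp add: ip_diff ip_diff_right diff_in ip_scale ip_scale_right algebra_simps)
  also have "c * ip g f = c * cnj c * ip g g"
    unfolding gg using ip_cnj[OF assms] pos by (simp add: c_def)
  also have "cnj c * ip f g = of_real ((cmod (ip f g))\<^sup>2 / N)"
    by (simp add: c_def mult.commute[of "cnj (ip f g)"] flip: complex_norm_square)
  finally have "sqnorm (\<lambda>z. f z - c *s g z) = sqnorm f - (cmod (ip f g))\<^sup>2 / N"
    by simp
  then have "(cmod (ip f g))\<^sup>2 / N \<le> sqnorm f"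
    using sqnorm_nonneg[OF diff_in[OF assms(1) cg]] by simp
  then have "(cmod (ip f g))\<^sup>2 \<le> sqnorm f * N"
    using pos by (simp add: pos_divide_le_eq)
  then show ?thesis by (simp add: N_def)
qed

text \<open>The representing vector minimizes \<open>\<lambda>f. sqnorm f - 2 * Re (\<phi> f)\<close>.\<close>

lemma Riesz:
  assumes add: "\<And>f g. f \<in> H \<Longrightarrow> g \<in> H \<Longrightarrow> \<phi> (\<lambda>z. f z + g z) = \<phi> f + \<phi> g"
    and scale: "\<And>c f. f \<in> H \<Longrightarrow> \<phi> (\<lambda>z. c *s f z) = c * \<phi> f"
    and bound: "\<And>f. f \<in> H \<Longrightarrow> (cmod (\<phi> f))\<^sup>2 \<le> C * sqnorm f"
  obtains g where "g \<in> H" "\<And>f. f \<in> H \<Longrightarrow> ip f g = \<phi> f"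
proof -
  define F where "F f = sqnorm f - 2 * Re (\<phi> f)" for f
  have F_add: "F (\<lambda>z. f z + of_real t *s h z) =
      F f + 2 * t * (Re (ip f h) - Re (\<phi> h)) + t\<^sup>2 * sqnorm h" if "f \<in> H" "h \<in> H" for f h t
    unfolding F_def using that by (simp add: sqnorm_add_real add scale scale_in algebra_simps)
  \<comment> \<open>By the inequality of arithmetic and geometric means, 4 |C| x is at most (|C| +
    x)^2 for x = \<open>sqnorm f\<close>.\<close>
  have F_lower: "- \<bar>C\<bar> \<le> F f" if "f \<in> H" for f
  proof -
    have "(Re (\<phi> f))\<^sup>2 \<le> (cmod (\<phi> f))\<^sup>2"
      by (simp add: cmod_power2)
    also have "\<dots> \<le> C * sqnorm f" by (rule bound[OF that])
    also have "\<dots> \<le> \<bar>C\<bar> * sqnorm f"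
      using sqnorm_nonneg[OF that] by (simp add: mult_right_mono)
    finally have *: "(Re (\<phi> f))\<^sup>2 \<le> \<bar>C\<bar> * sqnorm f" .
    have "4 * (\<bar>C\<bar> * sqnorm f) \<le> (\<bar>C\<bar> + sqnorm f)\<^sup>2"
      using zero_le_power2[of "\<bar>C\<bar> - sqnorm f"] by (simp add: power2_eq_square algebra_simps)
    then have "(2 * Re (\<phi> f))\<^sup>2 \<le> (\<bar>C\<bar> + sqnorm f)\<^sup>2"
      using * by (simp add: power_mult_distrib)
    then have "2 * Re (\<phi> f) \<le> \<bar>C\<bar> + sqnorm f"
      by (rule power2_le_imp_le) (use sqnorm_nonneg[OF that] in simp)
    then show ?thesis by (simp add: F_def)
  qed
  define I where "I = Inf (F ` H)"
  have bdd: "bdd_below (F ` H)" using F_lower by (auto intro!: bdd_belowI)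
  have I_le: "I \<le> F f" if "f \<in> H" for f
    unfolding I_def using bdd that by (simp add: cInf_lower)
  have "\<exists>f\<in>H. F f < I + 1 / (real n + 1)" for n
  proof (rule ccontr)
    assume "\<not> (\<exists>f\<in>H. F f < I + 1 / (real n + 1))"
    then have "I + 1 / (real n + 1) \<le> I"
      unfolding I_def using zero_in by (intro cInf_greatest) (auto simp: not_less)
    then show False by (simp add: add_nonneg_pos not_le)
  qed
  then obtain X where X: "\<And>n. X n \<in> H" "\<And>n. F (X n) < I + 1 / (real n + 1)" by metis
  \<comment> \<open>The value of F at the midpoint of X m and X n is at least I. Since F is
    quadratic, this bounds the squared distance of the two points by their excesses over I.\<close>
  have cauchy: "sqnorm (\<lambda>z. X m z - X n z) < 2 / (real m + 1) + 2 / (real n + 1)" for m n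
  proof -
    define h where "h = (\<lambda>z. X m z - X n z)"
    have h: "h \<in> H" unfolding h_def using X by (simp add: diff_in)
    have "(\<lambda>z. X n z + of_real 1 *s h z) = X m" by (auto simp: h_def fun_eq_iff)
    then have "F (X m) = F (X n) + 2 * (Re (ip (X n) h) - Re (\<phi> h)) + sqnorm h"
      using F_add[OF X(1) h, of n 1] by simp
    moreover have "I \<le> F (\<lambda>z. X n z + of_real (1 / 2) *s h z)"
      by (intro I_le add_in scale_in X h)
    then have "I \<le> F (X n) + (Re (ip (X n) h) - Re (\<phi> h)) + sqnorm h / 4"
      using F_add[OF X(1) h, of n "1 / 2"] by (simp add: power2_eq_square)
    ultimately have "sqnorm h \<le> 2 * (F (X m) - I) + 2 * (F (X n) - I)"
      by argo
    moreover have "2 / (real k + 1) = 2 * (1 / (real k + 1))" for k by simp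
    ultimately show ?thesis unfolding h_def[symmetric] using X(2)[of m] X(2)[of n] by argo
  qed
  obtain g where g: "g \<in> H" "(\<lambda>n. sqnorm (\<lambda>z. X n z - g z)) \<longlonglongrightarrow> 0"
  proof (rule complete[OF X(1)])
    fix e :: real assume "0 < e"
    then obtain N where N: "4 / e < real N" using reals_Archimedean2 by blast
    have "sqnorm (\<lambda>z. X m z - X n z) < e" if "m \<ge> N" "n \<ge> N" for m n
    proof -
      have "2 / (real k + 1) \<le> e / 2" if "k \<ge> N" for k
      proof -
        have "4 / e \<le> real k + 1" using N that by linarith
        then show ?thesis using \<open>0 < e\<close> by (simp add: field_simps)
      qed
      from this[OF that(1)] this[OF that(2)] show ?thesis using cauchy[of m n] by linarith
    qed
    then show "\<exists>N. \<forall>m\<ge>N. \<forall>n\<ge>N. sqnorm (\<lambda>z. X m z - X n z) < e" by blast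
  qed
  have re: "Re (ip g h) = Re (\<phi> h)" if h: "h \<in> H" for h
  proof -
    define a where "a n = Re (ip (X n) h) - Re (\<phi> h)" for n
    \<comment> \<open>Adding 1 keeps M positive even when h = 0.\<close>
    define M where "M = sqnorm h + 1"
    have M: "M > 0" using sqnorm_nonneg[OF h] by (simp add: M_def)
    have a_bound: "(a n)\<^sup>2 \<le> M / (real n + 1)" for n
    proof -
      \<comment> \<open>This t minimizes 2 t (a n) + t^2 M, an upper bound for the change of F along
        h. As F cannot drop below I, the slope a n has to be small.\<close>
      define t where "t = - a n / M"
      have "I \<le> F (\<lambda>z. X n z + of_real t *s h z)"
        by (intro I_le add_in scale_in X h)
      then have "I \<le> F (X n) + 2 * t * a n + t\<^sup>2 * sqnorm h"
        unfolding F_add[OF X(1) h] a_def .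
      moreover have "t\<^sup>2 * sqnorm h \<le> t\<^sup>2 * M"
        by (simp add: M_def mult_left_mono)
      moreover have "2 * t * a n + t\<^sup>2 * M = - ((a n)\<^sup>2 / M)"
        using M by (simp add: t_def power2_eq_square field_simps)
      ultimately have "(a n)\<^sup>2 / M \<le> 1 / (real n + 1)"
        using X(2)[of n] by linarith
      then show ?thesis using M by (simp add: field_simps)
    qed
    have "(\<lambda>n. M / (real n + 1)) \<longlonglongrightarrow> 0"
      using tendsto_mult_right_zero[OF LIMSEQ_inverse_real_of_nat, of M]
      by (simp add: divide_inverse add.commute)
    then have "(\<lambda>n. (a n)\<^sup>2) \<longlonglongrightarrow> 0"
      by (rule Lim_null_comparison[rotated]) (simp add: a_bound)
    then have a0: "a \<longlonglongrightarrow> 0" by simp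
    have "(\<lambda>n. Re (ip (\<lambda>z. X n z - g z) h)) \<longlonglongrightarrow> 0"
    proof -
      have le: "(Re (ip (\<lambda>z. X n z - g z) h))\<^sup>2 \<le> sqnorm (\<lambda>z. X n z - g z) * sqnorm h" for n
      proof -
        have "(Re (ip (\<lambda>z. X n z - g z) h))\<^sup>2 \<le> (cmod (ip (\<lambda>z. X n z - g z) h))\<^sup>2"
          by (simp add: cmod_power2)
        also have "\<dots> \<le> sqnorm (\<lambda>z. X n z - g z) * sqnorm h"
          by (intro Cauchy_Schwarz diff_in X g h)
        finally show ?thesis .
      qed
      have "(\<lambda>n. sqnorm (\<lambda>z. X n z - g z) * sqnorm h) \<longlonglongrightarrow> 0"
        using g(2) by (rule tendsto_mult_left_zero)
      then have "(\<lambda>n. (Re (ip (\<lambda>z. X n z - g z) h))\<^sup>2) \<longlonglongrightarrow> 0"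
        by (rule Lim_null_comparison[rotated]) (use le in simp)
      then show ?thesis by simp
    qed
    from tendsto_diff[OF a0 this] have "(\<lambda>n. Re (ip g h) - Re (\<phi> h)) \<longlonglongrightarrow> 0"
      using X g h by (simp add: a_def ip_diff)
    then show ?thesis by (simp add: LIMSEQ_const_iff)
  qed
  have "ip f g = \<phi> f" if f: "f \<in> H" for f
  proof (rule complex_eqI)
    show "Re (ip f g) = Re (\<phi> f)"
      using re[OF f] ip_cnj[OF f g(1)] by simp
    \<comment> \<open>Imaginary parts are obtained from the real identity applied to i f.\<close>
    have "Re (ip g (\<lambda>z. \<i> *s f z)) = Re (\<phi> (\<lambda>z. \<i> *s f z))"
      by (rule re[OF scale_in[OF f]])
    then show "Im (ip f g) = Im (\<phi> f)"
      using f g ip_cnj[OF f g(1)] by (simp add: ip_scale_right scale)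
  qed
  then show thesis using that g by blast
qed

end

section \<open>Taylor coefficients of the kernel\<close>

text \<open>The coefficient of x^n in (1 - x)^(-\<beta>). Accordingly,
  \<open>neg_binom_shift \<beta> i n\<close> is that of x^i (1 - x)^(-\<beta>).\<close>

definition neg_binom :: "real \<Rightarrow> nat \<Rightarrow> real" where
  "neg_binom \<beta> n = pochhammer \<beta> n / fact n"

definition neg_binom_shift :: "real \<Rightarrow> nat \<Rightarrow> nat \<Rightarrow> real" where
  "neg_binom_shift \<beta> i n = (if n < i then 0 else neg_binom \<beta> (n - i))"

lemma neg_binom_shift_0 [simp]: "neg_binom_shift \<beta> 0 n = neg_binom \<beta> n"
  by (simp add: neg_binom_shift_def)

lemma neg_binom_0 [simp]: "neg_binom \<beta> 0 = 1"
  by (simp add: neg_binom_def)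

lemma neg_binom_pos: "0 < \<beta> \<Longrightarrow> 0 < neg_binom \<beta> n"
  by (simp add: neg_binom_def pochhammer_pos)

lemma neg_binom_Suc: "neg_binom \<beta> (Suc n) = (\<beta> + n) / (n + 1) * neg_binom \<beta> n"
  by (simp add: neg_binom_def pochhammer_Suc field_simps)

lemma neg_binom_Suc': "neg_binom \<beta> (Suc n) = \<beta> / (n + 1) * neg_binom (\<beta> + 1) n"
  by (simp add: neg_binom_def pochhammer_rec field_simps)

lemma neg_binom_add_one:
  assumes "\<beta> > 0"
  shows "neg_binom (\<beta> + 1) n = (\<beta> + n) / \<beta> * neg_binom \<beta> n"
proof -
  have "\<beta> / (n + 1) * neg_binom (\<beta> + 1) n = (\<beta> + n) / (n + 1) * neg_binom \<beta> n"
    using neg_binom_Suc neg_binom_Suc' by metis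
  then show ?thesis using assms by (simp add: field_simps)
qed

lemma neg_binom_shift_1: "\<beta> > 1 \<Longrightarrow> neg_binom_shift \<beta> 1 n = n / (\<beta> + n - 1) * neg_binom \<beta> n"
  using neg_binom_Suc[of \<beta> "n - 1"] by (cases n) (auto simp: neg_binom_shift_def)

lemma neg_binom_shift_2:
  assumes "\<beta> > 2"
  shows "neg_binom_shift \<beta> 2 n = real n * (real n - 1) / ((\<beta> + n - 1) * (\<beta> + n - 2)) * neg_binom \<beta> n"
proof (cases "n < 2")
  case True
  then have "n = 0 \<or> n = 1" by linarith
  then show ?thesis by (auto simp: neg_binom_shift_def)
next
  case False
  then obtain k where n: "n = Suc (Suc k)" by (metis add_2_eq_Suc le_Suc_ex not_less)
  define x where "x = \<beta> + k"
  have x: "x > 0" "\<beta> + real n - 1 = x + 1" "\<beta> + real n - 2 = x" using assms by (simp_all add: n x_def)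
  have "neg_binom \<beta> n = (x + 1) / (real k + 2) * (x / (real k + 1) * neg_binom \<beta> k)"
    by (simp add: n neg_binom_Suc x_def add_ac)
  moreover have "neg_binom_shift \<beta> 2 n = neg_binom \<beta> k" by (simp add: n neg_binom_shift_def)
  moreover have "real n * (real n - 1) = (real k + 2) * (real k + 1)" by (simp add: n add_ac)
  ultimately show ?thesis
    unfolding x(2,3) using x(1) by simp
qed

lemma has_fps_expansion_one_minus_powr:
  fixes y :: complex
  shows "(\<lambda>z. (1 - z * y) powr of_real (- \<beta>)) has_fps_expansion Abs_fps (\<lambda>n. of_real (neg_binom \<beta> n) * y ^ n)"
proof -
  have "((\<lambda>x. (1 + x) powr of_real (- \<beta>)) \<circ> (\<lambda>z. (- y) * z)) has_fps_expansion
      fps_compose (fps_binomial (of_real (- \<beta>))) (fps_const (- y) * fps_X)"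
    by (intro has_fps_expansion_compose has_fps_expansion_binomial_complex has_fps_expansion_mult
        has_fps_expansion_const has_fps_expansion_fps_X) simp
  moreover have "fps_compose (fps_binomial (of_real (- \<beta>))) (fps_const (- y) * fps_X) =
      Abs_fps (\<lambda>n. of_real (neg_binom \<beta> n) * y ^ n)"
  proof (rule fps_ext)
    fix n
    have "(- y) ^ n * ((of_real (- \<beta>) :: complex) gchoose n) = of_real (neg_binom \<beta> n) * y ^ n"
      by (simp add: gbinomial_pochhammer neg_binom_def pochhammer_of_real power_minus[of y] flip: power_add mult.assoc)
    then show "fps_nth (fps_compose (fps_binomial (of_real (- \<beta>))) (fps_const (- y) * fps_X)) n =
        fps_nth (Abs_fps (\<lambda>n. of_real (neg_binom \<beta> n) * y ^ n)) n"
      by (simp add: fps_compose_linear)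
  qed
  ultimately show ?thesis
    by (simp add: o_def mult.commute)
qed

lemma has_fps_expansion_one_minus_powr_mult:
  fixes c y :: complex
  shows "(\<lambda>z. c * ((1 - z * y) powr of_real (- \<beta>) * z ^ i)) has_fps_expansion
     Abs_fps (\<lambda>n. c * (of_real (neg_binom_shift \<beta> i n) * y ^ (n - i)))"
proof -
  have "(\<lambda>z. c * ((1 - z * y) powr of_real (- \<beta>) * z ^ i)) has_fps_expansion
      fps_const c * (Abs_fps (\<lambda>n. of_real (neg_binom \<beta> n) * y ^ n) * fps_X ^ i)"
    by (intro has_fps_expansion_mult has_fps_expansion_const has_fps_expansion_one_minus_powr
        has_fps_expansion_power has_fps_expansion_fps_X)
  moreover have "fps_const c * (Abs_fps (\<lambda>n. of_real (neg_binom \<beta> n) * y ^ n) * fps_X ^ i) =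
      Abs_fps (\<lambda>n. c * (of_real (neg_binom_shift \<beta> i n) * y ^ (n - i)))"
    by (rule fps_ext) (simp add: fps_X_power_mult_right_nth neg_binom_shift_def)
  ultimately show ?thesis by simp
qed

definition pw :: "real \<Rightarrow> complex \<Rightarrow> complex \<Rightarrow> complex" where
  "pw \<beta> y z = (1 - z * y) powr of_real (- \<beta>)"

text \<open>Factors such as \<open>1 *\<close> and \<open>z ^ 0\<close> are kept so that every entry
  is literally a sum of terms \<open>c * (pw b y z * z ^ i)\<close>, the shape for which the Taylor
  expansion in z is known.\<close>

lemma K_ker_entries:
  fixes l :: real
  assumes "z \<in> unit_disc" "w \<in> unit_disc" "\<mu> 0 = 1"
  defines "a \<equiv> 2 * l - 2" and "y \<equiv> cnj w"
  shows "K_ker l \<mu> z w = m3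
    (1 * (pw a y z * z ^ 0)) (1 * (pw (a + 1) y z * z ^ 1)) (1 * (pw (a + 2) y z * z ^ 2))
    (y * (pw (a + 1) y z * z ^ 0))
    (y * (pw (a + 2) y z * z ^ 1) + of_real (d_coeff l \<mu> 1) * (pw (a + 2) y z * z ^ 0))
    (y * (pw (a + 3) y z * z ^ 2) + 2 * of_real (d_coeff l \<mu> 1) * (pw (a + 3) y z * z ^ 1))
    (y\<^sup>2 * (pw (a + 2) y z * z ^ 0))
    (y\<^sup>2 * (pw (a + 3) y z * z ^ 1) + 2 * of_real (d_coeff l \<mu> 1) * y * (pw (a + 3) y z * z ^ 0))
    (y\<^sup>2 * (pw (a + 4) y z * z ^ 2) + 4 * of_real (d_coeff l \<mu> 1) * y * (pw (a + 4) y z * z ^ 1)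
      + of_real (d_coeff l \<mu> 2) * (pw (a + 4) y z * z ^ 0))"
proof -
  define u where "u = 1 - z * y"
  have "norm (z * y) < 1"
    using mult_strict_mono'[of "norm z" 1 "norm w" 1] assms by (simp add: norm_mult y_def)
  then have u: "u \<noteq> 0" by (auto simp: u_def)
  \<comment> \<open>The five exponents differ by integers, so every power that occurs is P times a
    natural power of u.\<close>
  define P where "P = pw (a + 4) y z"
  have P: "pw (a + real i) y z = P * u ^ (4 - i)" if "i \<le> 4" for i
  proof -
    have "P * u ^ (4 - i) = u powr (of_real (- (a + 4))) * u powr (of_nat (4 - i))"
      using u by (simp add: P_def pw_def u_def powr_nat')
    also have "\<dots> = u powr (of_real (- (a + real i)))"
      unfolding powr_add[symmetric] using that by (simp add: of_nat_diff)
    finally show ?thesis by (simp add: pw_def u_def)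
  qed
  have Ps: "pw a y z = P * u ^ 4" "pw (a + 1) y z = P * u ^ 3" "pw (a + 2) y z = P * u\<^sup>2"
     "pw (a + 3) y z = P * u" "pw (a + 4) y z = P"
    using P[of 0] P[of 1] P[of 2] P[of 3] P[of 4] by simp_all
  have "K_ker l \<mu> z w = mat P ** diag3 (u\<^sup>2) u 1 ** Lo 1 2 y ** B_mat l \<mu> ** Up 1 2 z ** diag3 (u\<^sup>2) u 1"
  proof -
    have e: "- (a + 4) = - 2 * l - 2" by (simp add: a_def)
    show ?thesis
      unfolding K_ker_Lo_Up D_mat_def u_def y_def P_def pw_def e by simp
  qed
  also have "B_mat l \<mu> = diag3 1 (of_real (d_coeff l \<mu> 1)) (of_real (d_coeff l \<mu> 2))"
    using assms(3) by (simp add: B_mat_def d_coeff_0)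
  finally show ?thesis
    unfolding Ps by (simp add: diag3_m3 mat_m3 Lo_def Up_m3 m3_eq_iff)
      (simp add: algebra_simps power2_eq_square power3_eq_cube power4_eq_xxxx)
qed

section \<open>Polynomials in the reproducing kernel space\<close>

lemma cdot_axis: "cdot x (axis k 1) = x $ k"
  by (simp add: cdot_def axis_def if_distrib[of cnj] if_distrib[of "(*) _"] sum.delta cong: if_cong)

locale kernel_space =
  fixes l :: real and \<mu> :: "nat \<Rightarrow> real" and H :: "(complex \<Rightarrow> cvec3) set"
    and ip :: "(complex \<Rightarrow> cvec3) \<Rightarrow> (complex \<Rightarrow> cvec3) \<Rightarrow> complex"
  assumes adm: "admissible l \<mu>" and rkhs: "is_rkhs (K_ker l \<mu>) H ip"
begin

sublocale function_hilbert_space H ip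
  using rkhs by unfold_locales (simp add: is_rkhs_def)

abbreviation ksec :: "complex \<Rightarrow> cvec3 \<Rightarrow> complex \<Rightarrow> cvec3" where
  "ksec \<equiv> kernel_section (K_ker l \<mu>)"

lemma holo: "f \<in> H \<Longrightarrow> (\<lambda>z. f z $ i) holomorphic_on unit_disc"
  and vanish: "f \<in> H \<Longrightarrow> z \<notin> unit_disc \<Longrightarrow> f z = 0"
  and ksec_in: "w \<in> unit_disc \<Longrightarrow> ksec w x \<in> H"
  and repro: "w \<in> unit_disc \<Longrightarrow> f \<in> H \<Longrightarrow> ip f (ksec w x) = cdot (f w) x"
  using rkhs unfolding is_rkhs_def by blast+

lemma ksec_axis: "z \<in> unit_disc \<Longrightarrow> ksec w (axis k 1) z = column k (K_ker l \<mu> z w)"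
  by (simp add: kernel_section_def matrix_vector_mult_def column_def axis_def vec_eq_iff
      if_distrib[of "(*) _"] cong: if_cong)

definition \<alpha> :: real where "\<alpha> = 2 * l - 2"
definition d1 :: real where "d1 = d_coeff l \<mu> 1"
definition d2 :: real where "d2 = d_coeff l \<mu> 2"

lemma entries:
  assumes "z \<in> unit_disc" "w \<in> unit_disc"
  shows "K_ker l \<mu> z w = m3
    (1 * (pw \<alpha> (cnj w) z * z ^ 0)) (1 * (pw (\<alpha> + 1) (cnj w) z * z ^ 1)) (1 * (pw (\<alpha> + 2) (cnj w) z * z ^ 2))
    (cnj w * (pw (\<alpha> + 1) (cnj w) z * z ^ 0))
    (cnj w * (pw (\<alpha> + 2) (cnj w) z * z ^ 1) + of_real d1 * (pw (\<alpha> + 2) (cnj w) z * z ^ 0))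
    (cnj w * (pw (\<alpha> + 3) (cnj w) z * z ^ 2) + 2 * of_real d1 * (pw (\<alpha> + 3) (cnj w) z * z ^ 1))
    ((cnj w)\<^sup>2 * (pw (\<alpha> + 2) (cnj w) z * z ^ 0))
    ((cnj w)\<^sup>2 * (pw (\<alpha> + 3) (cnj w) z * z ^ 1) + 2 * of_real d1 * cnj w * (pw (\<alpha> + 3) (cnj w) z * z ^ 0))
    ((cnj w)\<^sup>2 * (pw (\<alpha> + 4) (cnj w) z * z ^ 2) + 4 * of_real d1 * cnj w * (pw (\<alpha> + 4) (cnj w) z * z ^ 1)
      + of_real d2 * (pw (\<alpha> + 4) (cnj w) z * z ^ 0))"
  unfolding \<alpha>_def d1_def d2_def
  using adm by (intro K_ker_entries assms) (simp add: admissible_def)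

text \<open>On a circle about the origin the diagonal entries of the kernel are constant.\<close>

lemma point_bound: "\<exists>M. \<forall>f\<in>H. \<forall>w. norm w = 1 / 2 \<longrightarrow> (cmod (f w $ k))\<^sup>2 \<le> M * sqnorm f"
proof -
  have K: "K_ker l \<mu> w w $ k $ k = K_ker l \<mu> (1 / 2) (1 / 2) $ k $ k" if "norm w = 1 / 2" for w
  proof -
    have diag: "K_ker l \<mu> u u $ 1 $ 1 = P \<alpha>" "K_ker l \<mu> u u $ 2 $ 2 = P (\<alpha> + 2) / 4 + of_real d1 * P (\<alpha> + 2)"
      "K_ker l \<mu> u u $ 3 $ 3 = P (\<alpha> + 4) / 16 + 4 * of_real d1 * (P (\<alpha> + 4) / 4) + of_real d2 * P (\<alpha> + 4)"
      if u: "norm u = 1 / 2" and P: "P = (\<lambda>\<beta>. (3 / 4) powr of_real (- \<beta>))" for u P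
    proof -
      have disc: "u \<in> unit_disc" using u by simp
      have uu: "u * cnj u = 1 / 4"
        by (simp add: u power2_eq_square flip: complex_norm_square)
      have pw: "pw \<beta> (cnj u) u = P \<beta>" for \<beta>
        by (simp add: pw_def uu P)
      have 1: "cnj u * (c * u ^ 1) = c / 4" for c
      proof -
        have "cnj u * (c * u ^ 1) = c * (u * cnj u)" by (simp add: ac_simps)
        then show ?thesis by (simp add: uu)
      qed
      have 2: "(cnj u)\<^sup>2 * (c * u ^ 2) = c / 16" for c
      proof -
        have "(cnj u)\<^sup>2 * (c * u ^ 2) = c * (u * cnj u)\<^sup>2" by (simp only: power_mult_distrib ac_simps)
        then show ?thesis unfolding uu by (simp add: power2_eq_square)
      qed
      show "K_ker l \<mu> u u $ 1 $ 1 = P \<alpha>" "K_ker l \<mu> u u $ 2 $ 2 = P (\<alpha> + 2) / 4 + of_real d1 * P (\<alpha> + 2)"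
        "K_ker l \<mu> u u $ 3 $ 3 = P (\<alpha> + 4) / 16 + 4 * of_real d1 * (P (\<alpha> + 4) / 4) + of_real d2 * P (\<alpha> + 4)"
        unfolding entries[OF disc disc] m3_nth pw mult.assoc 1 2 by simp_all
    qed
    have half: "norm (1 / 2 :: complex) = 1 / 2" by (simp add: norm_divide)
    from exhaust_3[of k] consider "k = 1" | "k = 2" | "k = 3" by blast
    then show ?thesis
      by cases (simp_all only: diag[OF that refl] diag[OF half refl])
  qed
  \<comment> \<open>Cauchy-Schwarz is applied to f and the kernel section representing the k-th
    component at w; the squared norm of the section is a diagonal entry of the kernel.\<close>
  have "(cmod (f w $ k))\<^sup>2 \<le> Re (K_ker l \<mu> (1 / 2) (1 / 2) $ k $ k) * sqnorm f"
    if "f \<in> H" "norm w = 1 / 2" for f w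
  proof -
    have w: "w \<in> unit_disc" using that by simp
    have "f w $ k = ip f (ksec w (axis k 1))"
      using repro[OF w that(1)] by (simp add: cdot_axis)
    moreover have "ip (ksec w (axis k 1)) (ksec w (axis k 1)) = K_ker l \<mu> (1 / 2) (1 / 2) $ k $ k"
      using repro[OF w ksec_in[OF w]] K[OF that(2)] by (simp add: cdot_axis ksec_axis[OF w] column_def)
    ultimately show ?thesis
      using Cauchy_Schwarz[OF that(1) ksec_in[OF w, of "axis k 1"]] by (simp add: mult.commute)
  qed
  then show ?thesis by blast
qed

text \<open>Cauchy's inequality on the circle of radius 1/2 bounds the functional by
  \<open>point_bound\<close>, so Riesz applies. Testing g against kernel sections expresses its
  values by derivatives of the kernel in the first variable.\<close>

lemma coefficient_representer:
  obtains g where "g \<in> H" "\<And>f. f \<in> H \<Longrightarrow> ip f g = (deriv ^^ n) (\<lambda>z. f z $ k) 0"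
    "\<And>w j. w \<in> unit_disc \<Longrightarrow> g w $ j = cnj ((deriv ^^ n) (\<lambda>z. ksec w (axis j 1) z $ k) 0)"
proof -
  obtain M where M: "\<And>f w. f \<in> H \<Longrightarrow> norm w = 1 / 2 \<Longrightarrow> (cmod (f w $ k))\<^sup>2 \<le> M * sqnorm f"
    using point_bound by blast
  have z0: "(0 :: complex) \<in> unit_disc" by simp
  obtain g where g: "g \<in> H" "\<And>f. f \<in> H \<Longrightarrow> ip f g = (deriv ^^ n) (\<lambda>z. f z $ k) 0"
  proof (rule Riesz[of "\<lambda>f. (deriv ^^ n) (\<lambda>z. f z $ k) 0" "(fact n / (1 / 2) ^ n)\<^sup>2 * M"])
    fix f g assume "f \<in> H" "g \<in> H"
    then show "(deriv ^^ n) (\<lambda>z. (f z + g z) $ k) 0 = (deriv ^^ n) (\<lambda>z. f z $ k) 0 + (deriv ^^ n) (\<lambda>z. g z $ k) 0"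
      using higher_deriv_add[OF holo holo open_ball z0] by simp
  next
    fix c f assume "f \<in> H"
    then show "(deriv ^^ n) (\<lambda>z. (c *s f z) $ k) 0 = c * (deriv ^^ n) (\<lambda>z. f z $ k) 0"
      using higher_deriv_cmult[OF holo z0 open_ball] by simp
  next
    fix f assume f: "f \<in> H"
    have "cmod ((deriv ^^ n) (\<lambda>z. f z $ k) 0) \<le> fact n * sqrt (M * sqnorm f) / (1 / 2) ^ n"
    proof (rule Cauchy_inequality)
      show "(\<lambda>z. f z $ k) holomorphic_on ball 0 (1 / 2)"
        by (rule holomorphic_on_subset[OF holo[OF f]]) auto
      show "continuous_on (cball 0 (1 / 2)) (\<lambda>z. f z $ k)"
        by (intro holomorphic_on_imp_continuous_on holomorphic_on_subset[OF holo[OF f]]) auto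
      show "cmod (f w $ k) \<le> sqrt (M * sqnorm f)" if "cmod (0 - w) = 1 / 2" for w
        using M[OF f, of w] that by (simp add: real_le_rsqrt)
    qed simp
    then have "(cmod ((deriv ^^ n) (\<lambda>z. f z $ k) 0))\<^sup>2 \<le> (fact n * sqrt (M * sqnorm f) / (1 / 2) ^ n)\<^sup>2"
      by (rule power_mono) simp
    also have "\<dots> = (fact n / (1 / 2) ^ n)\<^sup>2 * M * sqnorm f"
    proof -
      have "0 \<le> M * sqnorm f"
        using order_trans[OF zero_le_power2 M[OF f, of "1 / 2"]] by simp
      then show ?thesis by (simp add: power_mult_distrib power_divide)
    qed
    finally show "(cmod ((deriv ^^ n) (\<lambda>z. f z $ k) 0))\<^sup>2 \<le> (fact n / (1 / 2) ^ n)\<^sup>2 * M * sqnorm f" .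
  qed blast
  have "g w $ j = cnj ((deriv ^^ n) (\<lambda>z. ksec w (axis j 1) z $ k) 0)" if w: "w \<in> unit_disc" for w j
  proof -
    have "g w $ j = ip g (ksec w (axis j 1))"
      using repro[OF w g(1)] by (simp add: cdot_axis)
    also have "\<dots> = cnj (ip (ksec w (axis j 1)) g)"
      by (rule ip_cnj[OF ksec_in[OF w] g(1)])
    finally show ?thesis using g(2)[OF ksec_in[OF w]] by simp
  qed
  with g that show thesis by blast
qed

definition vec_monomial :: "3 \<Rightarrow> nat \<Rightarrow> complex \<Rightarrow> cvec3" where
  "vec_monomial k n = (\<lambda>z. if z \<in> unit_disc then axis k (z ^ n) else 0)"

text \<open>The three monomials that occur together in one Taylor coefficient of a row of the
  kernel. The exponents N - 1 and N - 2 are truncated at 0; in \<open>row1\<close>,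
  \<open>row2\<close> and \<open>row3\<close> the coefficient of a truncated exponent is 0.\<close>

definition comb :: "nat \<Rightarrow> real \<Rightarrow> real \<Rightarrow> real \<Rightarrow> complex \<Rightarrow> cvec3" where
  "comb N p q r = (\<lambda>z. of_real p *s vec_monomial 1 N z + (of_real q *s vec_monomial 2 (N - 1) z + of_real r *s vec_monomial 3 (N - 2) z))"

lemma comb_nth:
  assumes "z \<in> unit_disc"
  shows "comb N p q r z $ 1 = of_real p * z ^ N" "comb N p q r z $ 2 = of_real q * z ^ (N - 1)"
    "comb N p q r z $ 3 = of_real r * z ^ (N - 2)"
  using assms by (simp_all add: comb_def vec_monomial_def axis_def)

lemma comb_outside: "z \<notin> unit_disc \<Longrightarrow> comb N p q r z = 0"
  by (simp add: comb_def vec_monomial_def)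

text \<open>The n-th Taylor coefficient in z of row k is a polynomial in \<open>cnj w\<close> with
  real coefficients. Conjugation turns it into a polynomial in w, namely the representer of the n-th
  derivative of component k, up to the factor n!. Hence both membership in H and the meaning of
  orthogonality to it.\<close>

lemma kernel_row:
  assumes F: "\<And>w. w \<in> unit_disc \<Longrightarrow> (\<lambda>z. K_ker l \<mu> z w $ k $ 1) has_fps_expansion Abs_fps (F1 (cnj w))"
    "\<And>w. w \<in> unit_disc \<Longrightarrow> (\<lambda>z. K_ker l \<mu> z w $ k $ 2) has_fps_expansion Abs_fps (F2 (cnj w))"
    "\<And>w. w \<in> unit_disc \<Longrightarrow> (\<lambda>z. K_ker l \<mu> z w $ k $ 3) has_fps_expansion Abs_fps (F3 (cnj w))"
    and c: "\<And>y. F1 y n = of_real p * y ^ N" "\<And>y. F2 y n = of_real q * y ^ (N - 1)"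
      "\<And>y. F3 y n = of_real r * y ^ (N - 2)"
  shows "comb N p q r \<in> H"
    "v \<in> H \<Longrightarrow> ip v (comb N p q r) = 0 \<Longrightarrow> (deriv ^^ n) (\<lambda>z. v z $ k) 0 = 0"
proof -
  obtain g where g: "g \<in> H" "\<And>f. f \<in> H \<Longrightarrow> ip f g = (deriv ^^ n) (\<lambda>z. f z $ k) 0"
    "\<And>w j. w \<in> unit_disc \<Longrightarrow> g w $ j = cnj ((deriv ^^ n) (\<lambda>z. ksec w (axis j 1) z $ k) 0)"
    by (rule coefficient_representer) blast
  have z0: "(0 :: complex) \<in> unit_disc" by simp
  have gF: "g w $ j = fact n * cnj (G n)"
    if w: "w \<in> unit_disc" and "(\<lambda>z. K_ker l \<mu> z w $ k $ j) has_fps_expansion Abs_fps G" for w j G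
  proof -
    have "(\<lambda>z. ksec w (axis j 1) z $ k) has_fps_expansion Abs_fps G \<longleftrightarrow>
        (\<lambda>z. K_ker l \<mu> z w $ k $ j) has_fps_expansion Abs_fps G"
    proof (rule has_fps_expansion_cong)
      show "\<forall>\<^sub>F z in nhds 0. ksec w (axis j 1) z $ k = K_ker l \<mu> z w $ k $ j"
        using eventually_nhds_in_open[OF open_ball z0] by eventually_elim (simp add: ksec_axis column_def)
    qed simp
    then have "fps_nth (Abs_fps G) n = (deriv ^^ n) (\<lambda>z. ksec w (axis j 1) z $ k) 0 / fact n"
      using that(2) by (intro fps_nth_fps_expansion) simp
    then have "(deriv ^^ n) (\<lambda>z. ksec w (axis j 1) z $ k) 0 = fact n * G n"
      by simp
    then show ?thesis using g(3)[OF w] by simp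
  qed
  have eq: "g = (\<lambda>z. fact n *s comb N p q r z)"
  proof
    fix z show "g z = fact n *s comb N p q r z"
    proof (cases "z \<in> unit_disc")
      case True
      then show ?thesis
        using gF[OF True F(1)[OF True]] gF[OF True F(2)[OF True]] gF[OF True F(3)[OF True]]
        by (simp add: vec_eq_iff forall_3 comb_nth c)
    next
      case False
      then show ?thesis using vanish[OF g(1)] by (simp add: comb_outside)
    qed
  qed
  have "comb N p q r = (\<lambda>z. (1 / fact n) *s g z)"
    by (simp add: eq fun_eq_iff vec_eq_iff)
  then show in_H: "comb N p q r \<in> H"
    using scale_in[OF g(1)] by simp
  show "(deriv ^^ n) (\<lambda>z. v z $ k) 0 = 0" if v: "v \<in> H" "ip v (comb N p q r) = 0"
    using g(2)[OF v(1)] ip_scale_right[OF in_H v(1), of "fact n"] v(2) by (simp flip: eq)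
qed

definition term_coeff :: "complex \<Rightarrow> real \<Rightarrow> nat \<Rightarrow> complex \<Rightarrow> nat \<Rightarrow> complex" where
  "term_coeff c \<beta> i y n = c * (of_real (neg_binom_shift \<beta> i n) * y ^ (n - i))"

lemma term_expansion: "(\<lambda>z. c * (pw \<beta> y z * z ^ i)) has_fps_expansion Abs_fps (term_coeff c \<beta> i y)"
  unfolding pw_def term_coeff_def by (rule has_fps_expansion_one_minus_powr_mult)

lemma sum_expansion:
  assumes "f has_fps_expansion Abs_fps F" "g has_fps_expansion Abs_fps G"
  shows "(\<lambda>z. f z + g z) has_fps_expansion Abs_fps (\<lambda>n. F n + G n)"
proof -
  have "Abs_fps (\<lambda>n. F n + G n) = Abs_fps F + Abs_fps G" by (rule fps_ext) simp
  then show ?thesis using has_fps_expansion_add[OF assms] by simp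
qed

lemma entry_expansion:
  assumes "w \<in> unit_disc" "f has_fps_expansion F" "\<And>z. z \<in> unit_disc \<Longrightarrow> K_ker l \<mu> z w $ k $ j = f z"
  shows "(\<lambda>z. K_ker l \<mu> z w $ k $ j) has_fps_expansion F"
proof -
  have z0: "(0 :: complex) \<in> unit_disc" by simp
  have "(\<lambda>z. K_ker l \<mu> z w $ k $ j) has_fps_expansion F \<longleftrightarrow> f has_fps_expansion F"
  proof (rule has_fps_expansion_cong)
    show "\<forall>\<^sub>F z in nhds 0. K_ker l \<mu> z w $ k $ j = f z"
      using eventually_nhds_in_open[OF open_ball z0] by eventually_elim (use assms in auto)
  qed simp
  then show ?thesis using assms by simp
qed

text \<open>Rows 1, 2, 3 yield representers with N = n, n + 1, n + 2. So each N of at least 2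
  receives three combinations of the same three monomials.\<close>

lemma row1:
  shows "comb n (neg_binom \<alpha> n) (neg_binom_shift (\<alpha> + 1) 1 n) (neg_binom_shift (\<alpha> + 2) 2 n) \<in> H" (is ?A)
    and "v \<in> H \<Longrightarrow> ip v (comb n (neg_binom \<alpha> n) (neg_binom_shift (\<alpha> + 1) 1 n) (neg_binom_shift (\<alpha> + 2) 2 n)) = 0 \<Longrightarrow>
      (deriv ^^ n) (\<lambda>z. v z $ 1) 0 = 0"
proof -
  note E = entry_expansion[OF _ term_expansion]
  have 1: "(\<lambda>z. K_ker l \<mu> z w $ 1 $ 1) has_fps_expansion Abs_fps (term_coeff 1 \<alpha> 0 (cnj w))"
    and 2: "(\<lambda>z. K_ker l \<mu> z w $ 1 $ 2) has_fps_expansion Abs_fps (term_coeff 1 (\<alpha> + 1) 1 (cnj w))"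
    and 3: "(\<lambda>z. K_ker l \<mu> z w $ 1 $ 3) has_fps_expansion Abs_fps (term_coeff 1 (\<alpha> + 2) 2 (cnj w))"
    if w: "w \<in> unit_disc" for w
    by (rule E[OF w], simp only: entries[OF _ w] m3_nth)+
  note R = kernel_row[where ?F1.0 = "term_coeff 1 \<alpha> 0" and ?F2.0 = "term_coeff 1 (\<alpha> + 1) 1"
      and ?F3.0 = "term_coeff 1 (\<alpha> + 2) 2" and k = 1 and n = n and N = n, OF 1 2 3]
  show ?A by (rule R(1)) (simp_all add: term_coeff_def)
  show "v \<in> H \<Longrightarrow> ip v (comb n (neg_binom \<alpha> n) (neg_binom_shift (\<alpha> + 1) 1 n) (neg_binom_shift (\<alpha> + 2) 2 n)) = 0 \<Longrightarrow>
      (deriv ^^ n) (\<lambda>z. v z $ 1) 0 = 0"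
    by (rule R(2)) (simp_all add: term_coeff_def)
qed

lemma row2:
  fixes n :: nat
  defines "q \<equiv> neg_binom_shift (\<alpha> + 2) 1 n + d1 * neg_binom (\<alpha> + 2) n"
    and "r \<equiv> neg_binom_shift (\<alpha> + 3) 2 n + 2 * d1 * neg_binom_shift (\<alpha> + 3) 1 n"
  shows "comb (n + 1) (neg_binom (\<alpha> + 1) n) q r \<in> H" (is ?A)
    and "v \<in> H \<Longrightarrow> ip v (comb (n + 1) (neg_binom (\<alpha> + 1) n) q r) = 0 \<Longrightarrow> (deriv ^^ n) (\<lambda>z. v z $ 2) 0 = 0"
proof -
  note E = entry_expansion[OF _ term_expansion]
  note E2 = entry_expansion[OF _ sum_expansion[OF term_expansion term_expansion]]
  let ?F1 = "\<lambda>y. term_coeff y (\<alpha> + 1) 0 y"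
  let ?F2 = "\<lambda>y n. term_coeff y (\<alpha> + 2) 1 y n + term_coeff (of_real d1) (\<alpha> + 2) 0 y n"
  let ?F3 = "\<lambda>y n. term_coeff y (\<alpha> + 3) 2 y n + term_coeff (2 * of_real d1) (\<alpha> + 3) 1 y n"
  have 1: "(\<lambda>z. K_ker l \<mu> z w $ 2 $ 1) has_fps_expansion Abs_fps (?F1 (cnj w))"
    if w: "w \<in> unit_disc" for w
    by (rule E[OF w]) (simp only: entries[OF _ w] m3_nth)
  have 2: "(\<lambda>z. K_ker l \<mu> z w $ 2 $ 2) has_fps_expansion Abs_fps (?F2 (cnj w))"
    and 3: "(\<lambda>z. K_ker l \<mu> z w $ 2 $ 3) has_fps_expansion Abs_fps (?F3 (cnj w))"
    if w: "w \<in> unit_disc" for w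
    by (rule E2[OF w], simp only: entries[OF _ w] m3_nth)+
  note R = kernel_row[where ?F1.0 = ?F1 and ?F2.0 = ?F2
      and ?F3.0 = ?F3 and k = 2 and n = n and N = "n + 1" and p = "neg_binom (\<alpha> + 1) n" and q = q and r = r, OF 1 2 3]
  have c: "?F1 y n = of_real (neg_binom (\<alpha> + 1) n) * y ^ (n + 1)" "?F2 y n = of_real q * y ^ (n + 1 - 1)"
     "?F3 y n = of_real r * y ^ (n + 1 - 2)" for y
  proof -
    \<comment> \<open>For smaller n the truncated exponent is wrong, but then
      \<open>neg_binom_shift\<close> is 0.\<close>
    have y1: "y * y ^ (n - 1) = y ^ n" if "1 \<le> n"
      using that by (simp flip: power_Suc)
    have y2: "y * y ^ (n - 2) = y ^ (n - 1)" if "2 \<le> n"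
    proof -
      have "Suc (n - 2) = n - 1" using that by simp
      then show ?thesis by (metis power_Suc)
    qed
    show "?F1 y n = of_real (neg_binom (\<alpha> + 1) n) * y ^ (n + 1)"
      by (simp add: term_coeff_def)
    show "?F2 y n = of_real q * y ^ (n + 1 - 1)"
      using y1 by (cases "1 \<le> n") (auto simp: term_coeff_def q_def neg_binom_shift_def algebra_simps)
    show "?F3 y n = of_real r * y ^ (n + 1 - 2)"
      using y2
      by (cases "1 \<le> n"; cases "2 \<le> n") (auto simp: term_coeff_def r_def neg_binom_shift_def algebra_simps)
  qed
  show ?A by (rule R(1)) (use c in simp_all)
  show "v \<in> H \<Longrightarrow> ip v (comb (n + 1) (neg_binom (\<alpha> + 1) n) q r) = 0 \<Longrightarrow> (deriv ^^ n) (\<lambda>z. v z $ 2) 0 = 0"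
    by (rule R(2)) (use c in simp_all)
qed

lemma row3:
  fixes n :: nat
  defines "q \<equiv> neg_binom_shift (\<alpha> + 3) 1 n + 2 * d1 * neg_binom (\<alpha> + 3) n"
    and "r \<equiv> neg_binom_shift (\<alpha> + 4) 2 n + 4 * d1 * neg_binom_shift (\<alpha> + 4) 1 n + d2 * neg_binom (\<alpha> + 4) n"
  shows "comb (n + 2) (neg_binom (\<alpha> + 2) n) q r \<in> H" (is ?A)
    and "v \<in> H \<Longrightarrow> ip v (comb (n + 2) (neg_binom (\<alpha> + 2) n) q r) = 0 \<Longrightarrow> (deriv ^^ n) (\<lambda>z. v z $ 3) 0 = 0"
proof -
  note E = entry_expansion[OF _ term_expansion]
  note E2 = entry_expansion[OF _ sum_expansion[OF term_expansion term_expansion]]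
  note E3 = entry_expansion[OF _ sum_expansion[OF sum_expansion[OF term_expansion term_expansion] term_expansion]]
  let ?F1 = "\<lambda>y. term_coeff (y\<^sup>2) (\<alpha> + 2) 0 y"
  let ?F2 = "\<lambda>y n. term_coeff (y\<^sup>2) (\<alpha> + 3) 1 y n + term_coeff (2 * of_real d1 * y) (\<alpha> + 3) 0 y n"
  let ?F3 = "\<lambda>y n. term_coeff (y\<^sup>2) (\<alpha> + 4) 2 y n + term_coeff (4 * of_real d1 * y) (\<alpha> + 4) 1 y n
      + term_coeff (of_real d2) (\<alpha> + 4) 0 y n"
  have 1: "(\<lambda>z. K_ker l \<mu> z w $ 3 $ 1) has_fps_expansion Abs_fps (?F1 (cnj w))"
    if w: "w \<in> unit_disc" for w
    by (rule E[OF w]) (simp only: entries[OF _ w] m3_nth)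
  have 2: "(\<lambda>z. K_ker l \<mu> z w $ 3 $ 2) has_fps_expansion Abs_fps (?F2 (cnj w))"
    if w: "w \<in> unit_disc" for w
    by (rule E2[OF w]) (simp only: entries[OF _ w] m3_nth)
  have 3: "(\<lambda>z. K_ker l \<mu> z w $ 3 $ 3) has_fps_expansion Abs_fps (?F3 (cnj w))"
    if w: "w \<in> unit_disc" for w
    by (rule E3[OF w]) (simp only: entries[OF _ w] m3_nth)
  note R = kernel_row[where ?F1.0 = ?F1 and ?F2.0 = ?F2
      and ?F3.0 = ?F3 and k = 3 and n = n and N = "n + 2" and p = "neg_binom (\<alpha> + 2) n" and q = q and r = r, OF 1 2 3]
  have y: "y\<^sup>2 * y ^ (n - 1) = y ^ (n + 1)" if "1 \<le> n" for y :: complex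
    using that by (simp flip: power_add)
  have y2: "y\<^sup>2 * y ^ (n - 2) = y ^ n" if "2 \<le> n" for y :: complex
    using that by (simp only: power_add[symmetric] le_add_diff_inverse)
  have y1: "y * y ^ (n - 1) = y ^ n" if "1 \<le> n" for y :: complex
    using that by (simp flip: power_Suc)
  have c: "?F1 y n = of_real (neg_binom (\<alpha> + 2) n) * y ^ (n + 2)" "?F2 y n = of_real q * y ^ (n + 2 - 1)"
     "?F3 y n = of_real r * y ^ (n + 2 - 2)" for y
  proof -
    show "?F1 y n = of_real (neg_binom (\<alpha> + 2) n) * y ^ (n + 2)"
      by (simp add: term_coeff_def power_add power2_eq_square)
    show "?F2 y n = of_real q * y ^ (n + 2 - 1)"
      using y[of y] by (cases "1 \<le> n") (auto simp: term_coeff_def q_def neg_binom_shift_def algebra_simps)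
    have "term_coeff (y\<^sup>2) (\<alpha> + 4) 2 y n = of_real (neg_binom_shift (\<alpha> + 4) 2 n) * (y\<^sup>2 * y ^ (n - 2))"
      "term_coeff (4 * of_real d1 * y) (\<alpha> + 4) 1 y n = of_real (4 * d1 * neg_binom_shift (\<alpha> + 4) 1 n) * (y * y ^ (n - 1))"
      by (simp_all add: term_coeff_def)
    moreover have "of_real (neg_binom_shift (\<alpha> + 4) 2 n) * (y\<^sup>2 * y ^ (n - 2)) = of_real (neg_binom_shift (\<alpha> + 4) 2 n) * y ^ n"
      using y2[of y] by (cases "2 \<le> n") (simp_all add: neg_binom_shift_def)
    moreover have "of_real (4 * d1 * neg_binom_shift (\<alpha> + 4) 1 n) * (y * y ^ (n - 1)) = of_real (4 * d1 * neg_binom_shift (\<alpha> + 4) 1 n) * y ^ n"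
      using y1[of y] by (cases "1 \<le> n") (simp_all add: neg_binom_shift_def)
    ultimately have terms: "term_coeff (y\<^sup>2) (\<alpha> + 4) 2 y n = of_real (neg_binom_shift (\<alpha> + 4) 2 n) * y ^ n"
      "term_coeff (4 * of_real d1 * y) (\<alpha> + 4) 1 y n = of_real (4 * d1 * neg_binom_shift (\<alpha> + 4) 1 n) * y ^ n"
      by (simp_all only:)
    show "?F3 y n = of_real r * y ^ (n + 2 - 2)"
      unfolding terms by (simp add: r_def term_coeff_def[of "of_real d2"] algebra_simps)
  qed
  show ?A by (rule R(1)) (use c in simp_all)
  show "v \<in> H \<Longrightarrow> ip v (comb (n + 2) (neg_binom (\<alpha> + 2) n) q r) = 0 \<Longrightarrow> (deriv ^^ n) (\<lambda>z. v z $ 3) 0 = 0"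
    by (rule R(2)) (use c in simp_all)
qed

section \<open>Isolating the monomials\<close>

lemma comb_lin_in:
  assumes "comb N p q r \<in> H" "comb N p' q' r' \<in> H"
  shows "comb N (x * p + x' * p') (x * q + x' * q') (x * r + x' * r') \<in> H"
proof -
  have "comb N (x * p + x' * p') (x * q + x' * q') (x * r + x' * r') =
     (\<lambda>z. of_real x *s comb N p q r z + of_real x' *s comb N p' q' r' z)"
    by (simp add: comb_def fun_eq_iff vec_eq_iff algebra_simps)
  then show ?thesis using assms by (simp add: add_in scale_in)
qed

text \<open>Elimination along the factorization \<open>L diag(c0, c1, c2) L\<^sup>T\<close> of the coefficient matrix; it comes
  from the presentation of the kernel as a sum of three differentiated Bergman kernels.\<close>

lemma elimination:
  assumes in_H: "comb N c0 (c0 * v01) (c0 * v02) \<in> H"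
    "comb N (c0 * v01) (c0 * v01\<^sup>2 + c1) (c0 * v01 * v02 + c1 * v12) \<in> H"
    "comb N (c0 * v02) (c0 * v01 * v02 + c1 * v12) (c0 * v02\<^sup>2 + c1 * v12\<^sup>2 + c2) \<in> H"
    and nz: "c0 \<noteq> 0" "c1 \<noteq> 0" "c2 \<noteq> 0"
  shows "comb N 1 0 0 \<in> H" "comb N 0 1 0 \<in> H" "comb N 0 0 1 \<in> H"
proof -
  have S1: "comb N 0 c1 (c1 * v12) \<in> H"
    using comb_lin_in[OF in_H(2) in_H(1), of 1 "- v01"] by (simp add: power2_eq_square algebra_simps)
  have "comb N 0 (c1 * v12) (c1 * v12\<^sup>2 + c2) \<in> H"
    using comb_lin_in[OF in_H(3) in_H(1), of 1 "- v02"] by (simp add: power2_eq_square algebra_simps)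
  from comb_lin_in[OF this S1, of 1 "- v12"] have S2: "comb N 0 0 c2 \<in> H"
    by (simp add: power2_eq_square algebra_simps)
  show 3: "comb N 0 0 1 \<in> H"
    using comb_lin_in[OF S2 S2, of "1 / c2" 0] nz by simp
  show 2: "comb N 0 1 0 \<in> H"
    using comb_lin_in[OF S1 3, of "1 / c1" "- v12"] nz by simp
  have "comb N 1 v01 v02 \<in> H"
    using comb_lin_in[OF in_H(1) in_H(1), of "1 / c0" 0] nz by simp
  from comb_lin_in[OF this 2, of 1 "- v01"] have "comb N 1 0 v02 \<in> H" by simp
  from comb_lin_in[OF this 3, of 1 "- v02"] show "comb N 1 0 0 \<in> H" by simp
qed

lemma parameters_pos: "0 < \<alpha>" "0 < (\<mu> 1)\<^sup>2" "0 < (\<mu> 2)\<^sup>2"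
  using adm by (simp_all add: admissible_def \<alpha>_def)

lemma d1_eq: "d1 = 1 / \<alpha> + (\<mu> 1)\<^sup>2"
  and d2_eq: "d2 = 2 / (\<alpha> * (\<alpha> + 1)) + 4 * (\<mu> 1)\<^sup>2 / (\<alpha> + 2) + (\<mu> 2)\<^sup>2"
proof -
  have \<mu>0: "\<mu> 0 = 1" using adm by (simp add: admissible_def)
  show "d1 = 1 / \<alpha> + (\<mu> 1)\<^sup>2"
    unfolding d1_def d_coeff_1[of \<mu>, OF \<mu>0] \<alpha>_def ..
  show "d2 = 2 / (\<alpha> * (\<alpha> + 1)) + 4 * (\<mu> 1)\<^sup>2 / (\<alpha> + 2) + (\<mu> 2)\<^sup>2"
    unfolding d2_def d_coeff_2[of \<mu>, OF \<mu>0] \<alpha>_def by simp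
qed

text \<open>With N = M + 2, the pivot c_j is (\<mu>_j)^2 times the coefficient of x^(N-j) in (1 -
  x)^(-(\<alpha> + 2 j)). All three are positive since \<alpha> and the \<mu>_j are, so
  \<open>elimination\<close> applies.\<close>

lemma comb_units:
  shows "comb (M + 2) 1 0 0 \<in> H" "comb (M + 2) 0 1 0 \<in> H" "comb (M + 2) 0 0 1 \<in> H"
proof -
  \<comment> \<open>All binomial coefficients are written as rational multiples of the single number
    t, which reduces the matrix entries to rational identities in A and m.\<close>
  define A m t where "A = \<alpha>" "m = real M" "t = neg_binom (\<alpha> + 2) M"
  have A: "A > 0" and m: "m \<ge> 0" and t: "t > 0"
    using parameters_pos by (simp_all add: A_m_t_def neg_binom_pos)
  define b1 where "b1 = (A + 1) / (m + 1) * t"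
  define c0 where "c0 = A / (m + 2) * b1"
  define b2 where "b2 = (A + 2 + m) / (m + 1) * t"
  define b3 where "b3 = (A + 2 + m) / (A + 2) * t"
  define b4 where "b4 = (A + 3 + m) / (A + 3) * b3"
  define c1 where "c1 = (\<mu> 1)\<^sup>2 * b2"
  define c2 where "c2 = (\<mu> 2)\<^sup>2 * b4"
  define v01 where "v01 = (m + 2) / A"
  define v02 where "v02 = (m + 2) * (m + 1) / (A * (A + 1))"
  define v12 where "v12 = 2 * (m + 1) / (A + 2)"
  have pos: "0 < c0" "0 < c1" "0 < c2"
    unfolding c0_def b1_def c1_def b2_def c2_def b4_def b3_def
    using A m t parameters_pos by (auto intro!: mult_pos_pos divide_pos_pos)
  have B1: "neg_binom (\<alpha> + 1) (M + 1) = b1"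
    using neg_binom_Suc'[of "\<alpha> + 1" M] by (simp add: b1_def A_m_t_def add_ac)
  have B0: "neg_binom \<alpha> (M + 2) = c0"
    using neg_binom_Suc'[of \<alpha> "M + 1"] B1 by (simp add: c0_def A_m_t_def add_ac)
  have B2: "neg_binom (\<alpha> + 2) (M + 1) = b2"
    using neg_binom_Suc[of "\<alpha> + 2" M] by (simp add: b2_def A_m_t_def add_ac)
  have B3: "neg_binom (\<alpha> + 3) M = b3"
    using neg_binom_add_one[of "\<alpha> + 2" M] A by (simp add: b3_def A_m_t_def add_ac)
  have B4: "neg_binom (\<alpha> + 4) M = b4"
    using neg_binom_add_one[of "\<alpha> + 3" M] A B3 by (simp add: b4_def A_m_t_def add_ac)
  have S3: "neg_binom_shift (\<alpha> + 3) 1 M = m / (A + m + 2) * b3"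
    using neg_binom_shift_1[of "\<alpha> + 3" M] A B3 by (simp add: A_m_t_def algebra_simps)
  have S4: "neg_binom_shift (\<alpha> + 4) 1 M = m / (A + m + 3) * b4"
    using neg_binom_shift_1[of "\<alpha> + 4" M] A B4 by (simp add: A_m_t_def algebra_simps)
  have S42: "neg_binom_shift (\<alpha> + 4) 2 M = m * (m - 1) / ((A + m + 3) * (A + m + 2)) * b4"
    using neg_binom_shift_2[of "\<alpha> + 4" M] A B4 by (simp add: A_m_t_def algebra_simps)
  have shift: "neg_binom_shift \<beta> 1 (M + 1) = neg_binom \<beta> M" "neg_binom_shift \<beta> 2 (M + 2) = neg_binom \<beta> M"
    "neg_binom_shift \<beta> 1 (M + 2) = neg_binom \<beta> (M + 1)" "neg_binom_shift \<beta> 2 (M + 1) = neg_binom_shift \<beta> 1 M" for \<beta>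
    by (auto simp: neg_binom_shift_def numeral_2_eq_2)
  have e01: "b1 = c0 * v01" and e02: "t = c0 * v02"
    using A m unfolding c0_def v01_def v02_def b1_def by (simp_all add: add_nonneg_pos)
  \<comment> \<open>In this and the next two identities \<open>d1\<close> and \<open>d2\<close> are
    split by the \<mu>_j: the part free of \<mu>_1 and \<mu>_2 comes from c0, the part with \<mu>_1
    from c1, and the part with \<mu>_2 from c2.\<close>
  have e11: "t + d1 * b2 = c0 * v01\<^sup>2 + c1"
  proof -
    have "c0 * v01\<^sup>2 = b1 * v01" by (simp add: e01 power2_eq_square)
    also have "\<dots> = t + 1 / A * b2"
      using A m unfolding b1_def b2_def v01_def by (simp add: divide_simps) (simp add: algebra_simps)
    finally show ?thesis by (simp add: c1_def d1_eq A_m_t_def(1) distrib_right)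
  qed
  have e12: "m / (A + m + 2) * b3 + 2 * d1 * b3 = c0 * v01 * v02 + c1 * v12"
  proof -
    have "c0 * v01 * v02 = b1 * v02" by (simp add: e01)
    also have "\<dots> = m / (A + m + 2) * b3 + 2 * (1 / A) * b3"
      using A m unfolding b1_def b3_def v02_def by (simp add: divide_simps) (simp add: algebra_simps)
    finally have "c0 * v01 * v02 = m / (A + m + 2) * b3 + 2 * (1 / A) * b3" .
    moreover have "c1 * v12 = 2 * (\<mu> 1)\<^sup>2 * b3"
      using A m unfolding c1_def b2_def b3_def v12_def by (simp add: divide_simps)
    ultimately show ?thesis by (simp add: d1_eq A_m_t_def(1) algebra_simps)
  qed
  have e22: "m * (m - 1) / ((A + m + 3) * (A + m + 2)) * b4 + 4 * d1 * (m / (A + m + 3) * b4) + d2 * b4 =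
      c0 * v02\<^sup>2 + c1 * v12\<^sup>2 + c2"
  proof -
    have "c0 * v02\<^sup>2 = t * v02" by (simp add: e02 power2_eq_square)
    also have "\<dots> = m * (m - 1) / ((A + m + 3) * (A + m + 2)) * b4 + 4 * (1 / A) * (m / (A + m + 3) * b4)
       + 2 / (A * (A + 1)) * b4"
      using A m unfolding v02_def b4_def b3_def by (simp add: divide_simps) (simp add: algebra_simps)
    finally have "c0 * v02\<^sup>2 = m * (m - 1) / ((A + m + 3) * (A + m + 2)) * b4 + 4 * (1 / A) * (m / (A + m + 3) * b4)
       + 2 / (A * (A + 1)) * b4" .
    moreover have "c1 * v12\<^sup>2 = 4 * (\<mu> 1)\<^sup>2 * (m / (A + m + 3) * b4) + 4 * (\<mu> 1)\<^sup>2 / (A + 2) * b4"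
      using A m unfolding c1_def b2_def v12_def b4_def b3_def
      by (simp add: divide_simps power2_eq_square) (simp add: algebra_simps)
    ultimately show ?thesis by (simp add: c2_def d1_eq d2_eq A_m_t_def(1) algebra_simps)
  qed
  have R1: "comb (M + 2) c0 (c0 * v01) (c0 * v02) \<in> H"
    using row1(1)[of "M + 2"] unfolding B0 shift B1 A_m_t_def(3)[symmetric] e01 e02[symmetric] .
  have R2: "comb (M + 2) (c0 * v01) (c0 * v01\<^sup>2 + c1) (c0 * v01 * v02 + c1 * v12) \<in> H"
    using row2(1)[of "M + 1"] e01 e11 e12
    unfolding B1 B2 B3 shift S3 A_m_t_def(3)[symmetric] by (simp add: add.commute)
  have R3: "comb (M + 2) (c0 * v02) (c0 * v01 * v02 + c1 * v12) (c0 * v02\<^sup>2 + c1 * v12\<^sup>2 + c2) \<in> H"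
    using row3(1)[of M] e02 e12 e22
    unfolding B3 B4 S3 S4 S42 A_m_t_def(3)[symmetric] by simp
  show "comb (M + 2) 1 0 0 \<in> H" "comb (M + 2) 0 1 0 \<in> H" "comb (M + 2) 0 0 1 \<in> H"
    using elimination[OF R1 R2 R3] pos by simp_all
qed

text \<open>The general elimination covers N of at least 2. For N = 0 and N = 1 only one and two
  monomials occur, and these cases are solved by hand.\<close>

lemma vec_monomial_in: "vec_monomial k n \<in> H"
proof -
  have comb_mono: "comb N 1 0 0 = vec_monomial 1 N" "comb N 0 1 0 = vec_monomial 2 (N - 1)" "comb N 0 0 1 = vec_monomial 3 (N - 2)" for N
    by (simp_all add: comb_def)
  have 0: "vec_monomial 1 0 \<in> H"
    using row1(1)[of 0] by (simp add: neg_binom_shift_def comb_mono)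
  have R1: "comb 1 \<alpha> 1 0 \<in> H"
    using row1(1)[of 1] by (simp add: neg_binom_shift_def neg_binom_def)
  have R2: "comb 1 1 d1 0 \<in> H"
    using row2(1)[of 0] by (simp add: neg_binom_shift_def)
  \<comment> \<open>The determinant of the 2x2 system for N = 1, with rows (\<alpha>, 1) and (1,
    d1).\<close>
  have det: "\<alpha> * d1 - 1 = \<alpha> * (\<mu> 1)\<^sup>2" "\<alpha> * (\<mu> 1)\<^sup>2 \<noteq> 0"
    using parameters_pos by (simp_all add: d1_eq field_simps)
  have "comb 1 0 (\<alpha> * d1 - 1) 0 \<in> H"
    using comb_lin_in[OF R2 R1, of \<alpha> "- 1"] by simp
  then have 1: "comb 1 0 1 0 \<in> H"
    using comb_lin_in[of 1 0 "\<alpha> * d1 - 1" 0 0 "\<alpha> * d1 - 1" 0 "1 / (\<alpha> * d1 - 1)" 0] det by simp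
  have "comb 1 1 0 0 \<in> H"
    using comb_lin_in[OF R2 1, of 1 "- d1"] by simp
  then have 2: "vec_monomial 1 1 \<in> H" "vec_monomial 2 0 \<in> H"
    using 1 unfolding comb_mono by simp_all
  have "vec_monomial 1 n \<in> H"
  proof (cases n)
    case (Suc j)
    then show ?thesis using 2 comb_units(1)[of "j - 1"] unfolding comb_mono by (cases j) auto
  qed (use 0 in simp)
  moreover have "vec_monomial 2 n \<in> H"
    using 2 comb_units(2)[of "n - 1"] unfolding comb_mono by (cases n) auto
  moreover have "vec_monomial 3 n \<in> H"
    using comb_units(3)[of n] unfolding comb_mono by simp
  ultimately show ?thesis using exhaust_3[of k] by auto
qed

text \<open>Representers of Taylor coefficients are combinations of monomials, so every Taylor
  coefficient of v at 0 vanishes and v is zero on the disc.\<close>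

lemma eq_zero_if_orthogonal:
  assumes v: "v \<in> H" and orth: "\<And>k n. ip v (vec_monomial k n) = 0"
  shows "v = (\<lambda>z. 0)"
proof -
  have "ip v (comb N p q r) = 0" for N p q r
    unfolding comb_def using v vec_monomial_in by (simp add: ip_add_right ip_scale_right add_in scale_in orth)
  then have "(deriv ^^ n) (\<lambda>z. v z $ 1) 0 = 0" "(deriv ^^ n) (\<lambda>z. v z $ 2) 0 = 0"
    "(deriv ^^ n) (\<lambda>z. v z $ 3) 0 = 0" for n
    using row1(2)[OF v] row2(2)[OF v] row3(2)[OF v] by blast+
  then have "(deriv ^^ n) (\<lambda>z. v z $ k) 0 = 0" for n k
    using exhaust_3[of k] by auto
  then have "v z $ k = 0" if "z \<in> unit_disc" for z k
    using holomorphic_fun_eq_0_on_ball[OF holo[OF v] that] by blast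
  then show ?thesis
    using vanish[OF v] by (auto simp: fun_eq_iff vec_eq_iff)
qed

end

section \<open>From unitary equivalence to intertwined curvatures\<close>

lemma cdot_eqI:
  assumes "\<And>y. cdot x y = cdot x' y"
  shows "x = x'"
  using assms cdot_axis by (metis vec_eq_iff)

text \<open>The columns of \<open>\<Phi>\<close> are the images of the constant unit vectors, and
  intertwining multiplication gives U(z^n e_k) = z^n \<Phi> e_k. This determines which function U
  sends to a given kernel section of the second space; inner products of two such sections then give
  the kernel identity.\<close>

lemma kernel_intertwiner:
  assumes "admissible l \<mu>" "admissible l' \<mu>'"
    and "is_rkhs (K_ker l \<mu>) H ip" "is_rkhs (K_ker l' \<mu>') H' ip'"
    and "unitarily_equivalent_ops H ip mult_op H' ip' mult_op"
  obtains \<Phi> where "\<And>z w. z \<in> unit_disc \<Longrightarrow> w \<in> unit_disc \<Longrightarrow>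
    K_ker l' \<mu>' z w = \<Phi> z ** K_ker l \<mu> z w ** conj_transpose (\<Phi> w)"
proof -
  interpret X: kernel_space l \<mu> H ip using assms by unfold_locales
  interpret Y: kernel_space l' \<mu>' H' ip' using assms by unfold_locales
  obtain U where bij: "bij_betw U H H'"
    and iso: "\<And>f g. f \<in> H \<Longrightarrow> g \<in> H \<Longrightarrow> ip' (U f) (U g) = ip f g"
    and mult: "\<And>f. f \<in> H \<Longrightarrow> U (mult_op f) = mult_op (U f)"
    using assms(5) unfolding unitarily_equivalent_ops_def by blast
  have U_in: "U f \<in> H'" if "f \<in> H" for f
    using bij that by (auto simp: bij_betw_def)
  define \<Phi> :: "complex \<Rightarrow> cmat3" where "\<Phi> z = (\<chi> i k. U (X.vec_monomial k 0) z $ i)" for z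
  have U_mono: "U (X.vec_monomial k n) = (\<lambda>z. z ^ n *s U (X.vec_monomial k 0) z)" for k n
  proof (induction n)
    case (Suc n)
    have "X.vec_monomial k (Suc n) = mult_op (X.vec_monomial k n)"
      by (auto simp: X.vec_monomial_def mult_op_def axis_def vec_eq_iff)
    then show ?case
      using mult[OF X.vec_monomial_in] Suc by (simp add: mult_op_def vec_eq_iff mult.assoc)
  qed simp
  have preimage: "U (X.ksec w (conj_transpose (\<Phi> w) *v x)) = Y.ksec w x" if w: "w \<in> unit_disc" for w x
  proof -
    obtain u where u: "u \<in> H" "U u = Y.ksec w x"
      using bij Y.ksec_in[OF w] by (metis bij_betw_iff_bijections)
    define y where "y = conj_transpose (\<Phi> w) *v x"
    define v where "v = (\<lambda>z. u z - X.ksec w y z)"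
    have v: "v \<in> H" unfolding v_def using u X.ksec_in[OF w] by (simp add: X.diff_in)
    \<comment> \<open>Both the true preimage u and the expected section have inner product w^n cnj
      (y $ k) with the monomial, so their difference is orthogonal to all monomials.\<close>
    have "ip (X.vec_monomial k n) v = 0" for k n
    proof -
      have "ip (X.vec_monomial k n) u = cdot (U (X.vec_monomial k n) w) x"
        using iso[OF X.vec_monomial_in u(1), of k n] u(2) Y.repro[OF w U_in[OF X.vec_monomial_in[of k n]], of x] by simp
      also have "\<dots> = w ^ n * cdot (U (X.vec_monomial k 0) w) x"
        by (simp add: U_mono[of k n] cdot_def sum_distrib_left mult.assoc)
      also have "cdot (U (X.vec_monomial k 0) w) x = cnj (y $ k)"
        by (simp add: y_def cdot_def matrix_vector_mult_def conj_transpose_def \<Phi>_def)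
      also have "w ^ n * cnj (y $ k) = cdot (X.vec_monomial k n w) y"
        using w by (simp add: X.vec_monomial_def cdot_def axis_def if_distrib[of "\<lambda>a. a * _"] sum.delta cong: if_cong)
      also have "\<dots> = ip (X.vec_monomial k n) (X.ksec w y)"
        using X.repro[OF w X.vec_monomial_in] by simp
      finally show ?thesis
        unfolding v_def using X.ip_diff_right[OF u(1) X.ksec_in[OF w] X.vec_monomial_in] by simp
    qed
    then have "ip v (X.vec_monomial k n) = 0" for k n
      using X.ip_cnj[OF X.vec_monomial_in v] by simp
    then have "v = (\<lambda>z. 0)"
      by (rule X.eq_zero_if_orthogonal[OF v])
    then have "u = X.ksec w y"
      by (auto simp: v_def fun_eq_iff)
    then show ?thesis using u(2) by (simp add: y_def)
  qed
  have "K_ker l' \<mu>' z w = \<Phi> z ** K_ker l \<mu> z w ** conj_transpose (\<Phi> w)"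
    if z: "z \<in> unit_disc" and w: "w \<in> unit_disc" for z w
  proof -
    have "K_ker l' \<mu>' z w *v x = (\<Phi> z ** K_ker l \<mu> z w ** conj_transpose (\<Phi> w)) *v x" for x
    proof (rule cdot_eqI)
      fix x'
      have "cdot (K_ker l' \<mu>' z w *v x) x' = ip' (Y.ksec w x) (Y.ksec z x')"
        using Y.repro[OF z Y.ksec_in[OF w]] z by (simp add: kernel_section_def)
      also have "\<dots> = ip (X.ksec w (conj_transpose (\<Phi> w) *v x)) (X.ksec z (conj_transpose (\<Phi> z) *v x'))"
        using iso[OF X.ksec_in[OF w] X.ksec_in[OF z]] preimage[OF w] preimage[OF z] by metis
      also have "\<dots> = cdot (K_ker l \<mu> z w *v (conj_transpose (\<Phi> w) *v x)) (conj_transpose (\<Phi> z) *v x')"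
        using X.repro[OF z X.ksec_in[OF w]] z by (simp add: kernel_section_def)
      also have "\<dots> = cdot ((\<Phi> z ** K_ker l \<mu> z w ** conj_transpose (\<Phi> w)) *v x) x'"
      proof -
        have "conj_transpose (conj_transpose (\<Phi> z)) = \<Phi> z"
          by (simp add: conj_transpose_def vec_eq_iff)
        then show ?thesis
          by (simp add: cdot_conj_transpose matrix_vector_mul_assoc matrix_mul_assoc)
      qed
      finally show "cdot (K_ker l' \<mu>' z w *v x) x' =
          cdot ((\<Phi> z ** K_ker l \<mu> z w ** conj_transpose (\<Phi> w)) *v x) x'" .
    qed
    then show ?thesis by (simp add: matrix_eq)
  qed
  then show thesis using that by blast
qed

lemma B_mat_inverse:
  assumes "admissible l \<mu>"
  obtains Bi Ri where "B_mat l \<mu> ** Bi = mat 1" "mat_sqrt (B_mat l \<mu>) ** Ri = mat 1"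
proof -
  define r1 r2 where "r1 = sqrt (d_coeff l \<mu> 1)" "r2 = sqrt (d_coeff l \<mu> 2)"
  have r: "r1 > 0" "r2 > 0"
    using assms by (simp_all add: r1_r2_def d_coeff_1_pos d_coeff_2_pos del: One_nat_def)
  have B: "B_mat l \<mu> = diag3 (of_real (1\<^sup>2)) (of_real (r1\<^sup>2)) (of_real (r2\<^sup>2))"
    using assms d_coeff_1_pos[OF assms(1)] d_coeff_2_pos[OF assms(1)]
    by (simp add: B_mat_def r1_r2_def admissible_def d_coeff_0)
  have "B_mat l \<mu> ** diag3 1 (of_real (1 / r1\<^sup>2)) (of_real (1 / r2\<^sup>2)) = mat 1"
    using r by (simp add: B diag3_m3 mat_m3)
  moreover have "mat_sqrt (B_mat l \<mu>) ** diag3 1 (of_real (1 / r1)) (of_real (1 / r2)) = mat 1"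
    unfolding B using mat_sqrt_diag3[of 1 r1 r2] r by (simp add: diag3_m3 mat_m3)
  ultimately show thesis using that by blast
qed

text \<open>In the product of K'(z,0)^-1, K'(z,z) and K'(0,z)^-1 the factors \<open>\<Phi> z\<close>
  and their adjoints cancel, and only \<Phi>(0) survives at the ends. The two metrics thus differ by
  constant matrices, to which \<open>metric_gauge\<close> applies.\<close>

lemma unitarily_equivalent_curvature_intertwiner:
  assumes adm: "admissible l \<mu>" "admissible l' \<mu>'"
    and rkhs: "is_rkhs (K_ker l \<mu>) H ip" "is_rkhs (K_ker l' \<mu>') H' ip'"
    and equiv: "unitarily_equivalent_ops H ip mult_op H' ip' mult_op"
  obtains W Wi where "W ** Wi = mat 1"
    "\<And>z. z \<in> unit_disc \<Longrightarrow> W ** curvature l' \<mu>' z = curvature l \<mu> z ** W"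
proof -
  obtain \<Phi> where \<Phi>: "\<And>z w. z \<in> unit_disc \<Longrightarrow> w \<in> unit_disc \<Longrightarrow>
    K_ker l' \<mu>' z w = \<Phi> z ** K_ker l \<mu> z w ** conj_transpose (\<Phi> w)"
    using kernel_intertwiner[OF adm rkhs equiv] by blast
  define R R' where "R = mat_sqrt (B_mat l \<mu>)" "R' = mat_sqrt (B_mat l' \<mu>')"
  obtain Bi Ri where B: "B_mat l \<mu> ** Bi = mat 1" "R ** Ri = mat 1"
    using B_mat_inverse[OF adm(1)] unfolding R_R'_def by blast
  obtain Bi' Ri' where B': "B_mat l' \<mu>' ** Bi' = mat 1" "R' ** Ri' = mat 1"
    using B_mat_inverse[OF adm(2)] unfolding R_R'_def by blast
  have RiR: "Ri ** R = mat 1" using B matrix_left_right_inverse by blast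
  define E where "E = \<Phi> 0"
  have z0: "(0 :: complex) \<in> unit_disc" by simp
  have K': "K_ker l' \<mu>' z 0 = \<Phi> z ** (B_mat l \<mu> ** Up 1 2 z) ** conj_transpose E"
    "K_ker l' \<mu>' z 0 = B_mat l' \<mu>' ** Up 1 2 z"
    "K_ker l' \<mu>' 0 z = E ** (Lo 1 2 (cnj z) ** B_mat l \<mu>) ** conj_transpose (\<Phi> z)"
    "K_ker l' \<mu>' z z = \<Phi> z ** K_ker l \<mu> z z ** conj_transpose (\<Phi> z)"
    if "z \<in> unit_disc" for z
    using \<Phi>[OF that z0] \<Phi>[OF z0 that] \<Phi>[OF that that]
    by (simp_all add: E_def K_ker_0_left K_ker_0_right)
  \<comment> \<open>\<open>\<Phi> z\<close> is a left factor of the invertible matrix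
    K'(z,0).\<close>
  have \<Phi>_inv: "\<exists>\<Psi>. \<Phi> z ** \<Psi> = mat 1" if z: "z \<in> unit_disc" for z
  proof -
    have "\<Phi> z ** ((B_mat l \<mu> ** Up 1 2 z) ** conj_transpose E ** (Up 1 2 (- z) ** Bi')) =
       B_mat l' \<mu>' ** (Up 1 2 z ** Up 1 2 (- z)) ** Bi'"
      using K'(1,2)[OF z] by (simp only: matrix_mul_assoc)
    then show ?thesis by (auto simp: Up_add B')
  qed
  then obtain \<Psi> where \<Psi>: "\<And>z. z \<in> unit_disc \<Longrightarrow> \<Phi> z ** \<Psi> z = mat 1" by metis
  have \<Psi>': "\<Psi> z ** \<Phi> z = mat 1" "conj_transpose (\<Psi> z) ** conj_transpose (\<Phi> z) = mat 1"
    "conj_transpose (\<Phi> z) ** conj_transpose (\<Psi> z) = mat 1" if "z \<in> unit_disc" for z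
    using \<Psi>[OF that] matrix_left_right_inverse conj_transpose_inverse by blast+
  define F where "F = \<Psi> 0"
  have EF: "E ** F = mat 1" "F ** E = mat 1" "conj_transpose E ** conj_transpose F = mat 1"
    "conj_transpose F ** conj_transpose E = mat 1"
    using \<Psi>[OF z0] \<Psi>'[OF z0] by (simp_all add: E_def F_def)
  define C where "C = R' ** conj_transpose F ** Ri"
  define D where "D = Ri ** F ** R'"
  have CC: "C ** (R ** conj_transpose E ** Ri') = mat 1"
  proof -
    have "C ** (R ** conj_transpose E ** Ri') =
      R' ** (conj_transpose F ** ((Ri ** R) ** conj_transpose E)) ** Ri'"
      by (simp only: C_def matrix_mul_assoc)
    then show ?thesis by (simp add: RiR EF B')
  qed
  have DD: "(Ri' ** E ** R) ** D = mat 1"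
  proof -
    have "Ri' ** R' = mat 1" using B' matrix_left_right_inverse by blast
    moreover have "(Ri' ** E ** R) ** D = Ri' ** (E ** ((R ** Ri) ** F)) ** R'"
      by (simp only: D_def matrix_mul_assoc)
    ultimately show ?thesis by (simp add: EF B)
  qed
  have gauge: "metric l' \<mu>' z = transpose D ** metric l \<mu> z ** transpose C" if z: "z \<in> unit_disc" for z
  proof -
    let ?P = "\<Phi> z" and ?Q = "\<Psi> z" and ?L = "Lo 1 2 (- cnj z)" and ?V = "Up 1 2 (- z)"
    have iK: "matrix_inv (K_ker l \<mu> z 0) = ?V ** Bi"
    proof (rule matrix_inv_eqI)
      have "K_ker l \<mu> z 0 ** (?V ** Bi) = B_mat l \<mu> ** (Up 1 2 z ** ?V) ** Bi"
        by (simp only: K_ker_0_right matrix_mul_assoc)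
      then show "K_ker l \<mu> z 0 ** (?V ** Bi) = mat 1" by (simp add: Up_add B)
    qed
    have iK2: "matrix_inv (K_ker l \<mu> 0 z) = Bi ** ?L"
    proof (rule matrix_inv_eqI)
      have "K_ker l \<mu> 0 z ** (Bi ** ?L) = Lo 1 2 (cnj z) ** (B_mat l \<mu> ** Bi) ** ?L"
        by (simp only: K_ker_0_left matrix_mul_assoc)
      then show "K_ker l \<mu> 0 z ** (Bi ** ?L) = mat 1" by (simp add: Lo_add B)
    qed
    have iK': "matrix_inv (K_ker l' \<mu>' z 0) = conj_transpose F ** (?V ** Bi) ** ?Q"
    proof (rule matrix_inv_eqI)
      have "K_ker l' \<mu>' z 0 ** (conj_transpose F ** (?V ** Bi) ** ?Q) =
        ?P ** (B_mat l \<mu> ** (Up 1 2 z ** ((conj_transpose E ** conj_transpose F) ** ?V)) ** Bi) ** ?Q"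
        unfolding K'(1)[OF z] by (simp only: matrix_mul_assoc)
      then show "K_ker l' \<mu>' z 0 ** (conj_transpose F ** (?V ** Bi) ** ?Q) = mat 1"
        by (simp add: EF Up_add B \<Psi>[OF z])
    qed
    have iK2': "matrix_inv (K_ker l' \<mu>' 0 z) = conj_transpose ?Q ** (Bi ** ?L) ** F"
    proof (rule matrix_inv_eqI)
      have "K_ker l' \<mu>' 0 z ** (conj_transpose ?Q ** (Bi ** ?L) ** F) =
        E ** (Lo 1 2 (cnj z) ** (B_mat l \<mu> ** ((conj_transpose ?P ** conj_transpose ?Q) ** Bi)) ** ?L) ** F"
        unfolding K'(3)[OF z] by (simp only: matrix_mul_assoc)
      then show "K_ker l' \<mu>' 0 z ** (conj_transpose ?Q ** (Bi ** ?L) ** F) = mat 1"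
        by (simp add: EF Lo_add B \<Psi>'[OF z])
    qed
    have K00: "K_ker l \<mu> 0 0 = B_mat l \<mu>" "K_ker l' \<mu>' 0 0 = B_mat l' \<mu>'"
      by (simp_all add: K_ker_0_left)
    have "normalized_kernel (K_ker l' \<mu>') z z = R' ** (conj_transpose F ** (?V ** Bi) ** ?Q) **
        (?P ** K_ker l \<mu> z z ** conj_transpose ?P) ** (conj_transpose ?Q ** (Bi ** ?L) ** F) ** R'"
      unfolding normalized_kernel_def K00 iK' iK2' R_R'_def K'(4)[OF z] ..
    also have "\<dots> = R' ** conj_transpose F ** ?V ** Bi ** (?Q ** ?P) **
        K_ker l \<mu> z z ** (conj_transpose ?P ** conj_transpose ?Q) ** Bi ** ?L ** F ** R'"
      by (simp only: matrix_mul_assoc)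
    \<comment> \<open>Inserting \<open>Ri ** R\<close> and \<open>R ** Ri\<close> produces the outer
      factors R of the first normalized kernel.\<close>
    also have "\<dots> = R' ** conj_transpose F ** (Ri ** R) ** ?V ** Bi **
        K_ker l \<mu> z z ** Bi ** ?L ** (R ** Ri) ** F ** R'"
      by (simp only: \<Psi>'[OF z] RiR B matrix_mul_rid)
    also have "\<dots> = C ** normalized_kernel (K_ker l \<mu>) z z ** D"
      unfolding normalized_kernel_def K00 iK iK2 R_R'_def(1)[symmetric] C_def D_def
      by (simp only: matrix_mul_assoc)
    finally show ?thesis
      unfolding metric_def by (simp add: matrix_transpose_mul matrix_mul_assoc)
  qed
  have tr: "transpose (mat 1 :: cmat3) = mat 1" by (simp add: mat_m3)
  have "transpose D ** transpose (Ri' ** E ** R) = mat 1"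
    using DD tr by (metis matrix_transpose_mul)
  moreover have tC: "transpose C ** transpose (R ** conj_transpose E ** Ri') = mat 1"
  proof -
    have "(R ** conj_transpose E ** Ri') ** C = mat 1" using CC matrix_left_right_inverse by blast
    then show ?thesis using tr by (metis matrix_transpose_mul)
  qed
  ultimately have "transpose C ** curvature l' \<mu>' z = curvature l \<mu> z ** transpose C"
    if "z \<in> unit_disc" for z
    using metric_gauge[OF adm _ _ gauge that] by blast
  with tC that show thesis by blast
qed

section \<open>Comparison of parameters and conclusion\<close>

lemma curvature_0_trace:
  assumes "admissible l \<mu>" "curvature l \<mu> 0 = diag3 (of_real a) (of_real b) (of_real c)"
  shows "6 * l = a + b + c"
proof -
  have "complex_of_real (6 * l) = of_real (a + b + c)"
    using curvature_0[OF assms(1)] assms(2) by (auto simp: curv0_def diag3_m3 m3_eq_iff)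
  then show ?thesis by (simp only: of_real_eq_iff)
qed

lemma curvatures_equivalent_if_permuted:
  assumes adm: "admissible l \<mu>" "admissible l \<mu>'" and z: "z \<in> unit_disc"
    and C: "curvature l \<mu> 0 = diag3 a b c"
    and C': "curvature l \<mu>' 0 = diag3 b a c \<or> curvature l \<mu>' 0 = diag3 a c b"
  shows "curvatures_unitarily_equivalent l \<mu> l \<mu>' z"
proof -
  let ?e = "complex_of_real (2 * l)" and ?s = "complex_of_real (s_of l \<mu>)" and ?t = "complex_of_real (t_of l \<mu>)"
  let ?s' = "complex_of_real (s_of l \<mu>')" and ?t' = "complex_of_real (t_of l \<mu>')"
  have p: "defect z \<noteq> 0" by (rule defect_nonzero[OF z])
  define T where "T = (if curvature l \<mu>' 0 = diag3 b a c then swap12 (defect z) else swap23 (defect z))"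
  have "T ** curv0 ?e ?s ?t = curv0 ?e ?s' ?t' ** T"
    using C C' unfolding curvature_0[OF adm(1)] curvature_0[OF adm(2)]
    by (auto simp: T_def curvature_0[OF adm(2)] swap12_def swap23_def diag3_m3 m3_eq_iff)
  moreover have "T ** T = mat 1" "conj_transpose T ** weight ?e z ** T = weight ?e z"
    using swap_involution[OF p] swap_weight[OF z] by (simp_all add: T_def)
  ultimately show ?thesis
    using hcurvatures_equivalent[of ?s ?t ?s' ?t' T ?e z]
    unfolding curvatures_unitarily_equivalent_def metric_hmetric[OF adm(1) z] metric_hmetric[OF adm(2) z]
      curvature_hcurvature[OF adm(1) z] curvature_hcurvature[OF adm(2) z] by simp
qed

lemma invertible_row_nonzero:
  fixes W :: cmat3
  assumes "W ** Wi = mat 1" "W $ i $ 1 = 0" "W $ i $ 2 = 0" "W $ i $ 3 = 0"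
  shows False
proof -
  have "(W ** Wi) $ i $ i = 0"
    using assms(2-4) by (simp add: matrix_matrix_mult_def sum_3)
  then show False using assms(1) by (simp add: mat_def)
qed

theorem theorem3p19:
  fixes \<delta>\<^sub>1 \<delta>\<^sub>2 \<delta>\<^sub>3 l l' :: real and \<mu> \<mu>' :: "nat \<Rightarrow> real"
  assumes "\<delta>\<^sub>1 > 0" and "\<delta>\<^sub>2 > 0" and "\<delta>\<^sub>3 > 0"
    and "admissible l \<mu>" and "admissible l' \<mu>'"
  shows
    "(\<delta>\<^sub>1 \<noteq> \<delta>\<^sub>2 \<and> 2 * (\<delta>\<^sub>1 + \<delta>\<^sub>2) > \<delta>\<^sub>3 - 6 \<and> \<delta>\<^sub>3 - 6 > max (2 * \<delta>\<^sub>1 - \<delta>\<^sub>2) (2 * \<delta>\<^sub>2 - \<delta>\<^sub>1) \<and>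
      curvature l \<mu> 0 = diag3 (of_real \<delta>\<^sub>1) (of_real \<delta>\<^sub>2) (of_real \<delta>\<^sub>3) \<and>
      curvature l' \<mu>' 0 = diag3 (of_real \<delta>\<^sub>2) (of_real \<delta>\<^sub>1) (of_real \<delta>\<^sub>3)
      \<longrightarrow>
      (\<forall>H ip H' ip'. is_rkhs (K_ker l \<mu>) H ip \<longrightarrow> is_rkhs (K_ker l' \<mu>') H' ip' \<longrightarrow>
         \<not> unitarily_equivalent_ops H ip mult_op H' ip' mult_op) \<and>
      (\<forall>z\<in>unit_disc. curvatures_unitarily_equivalent l \<mu> l' \<mu>' z))
     \<and>
     (\<delta>\<^sub>3 > \<delta>\<^sub>2 \<and> \<delta>\<^sub>2 > 3 + \<delta>\<^sub>3 / 2 \<and> \<delta>\<^sub>1 < min (2 * \<delta>\<^sub>3 - \<delta>\<^sub>2) (2 * \<delta>\<^sub>2 - \<delta>\<^sub>3) - 6 \<and>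
      curvature l \<mu> 0 = diag3 (of_real \<delta>\<^sub>1) (of_real \<delta>\<^sub>2) (of_real \<delta>\<^sub>3) \<and>
      curvature l' \<mu>' 0 = diag3 (of_real \<delta>\<^sub>1) (of_real \<delta>\<^sub>3) (of_real \<delta>\<^sub>2)
      \<longrightarrow>
      (\<forall>H ip H' ip'. is_rkhs (K_ker l \<mu>) H ip \<longrightarrow> is_rkhs (K_ker l' \<mu>') H' ip' \<longrightarrow>
         \<not> unitarily_equivalent_ops H ip mult_op H' ip' mult_op) \<and>
      (\<forall>z\<in>unit_disc. curvatures_unitarily_equivalent l \<mu> l' \<mu>' z))"
proof (intro conjI impI allI ballI notI; (elim conjE)?)
  fix H ip H' ip'
  assume ne: "\<delta>\<^sub>1 \<noteq> \<delta>\<^sub>2" and max: "max (2 * \<delta>\<^sub>1 - \<delta>\<^sub>2) (2 * \<delta>\<^sub>2 - \<delta>\<^sub>1) < \<delta>\<^sub>3 - 6"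
    and C: "curvature l \<mu> 0 = diag3 (of_real \<delta>\<^sub>1) (of_real \<delta>\<^sub>2) (of_real \<delta>\<^sub>3)"
    and C': "curvature l' \<mu>' 0 = diag3 (of_real \<delta>\<^sub>2) (of_real \<delta>\<^sub>1) (of_real \<delta>\<^sub>3)"
    and rkhs: "is_rkhs (K_ker l \<mu>) H ip" "is_rkhs (K_ker l' \<mu>') H' ip'"
    and equiv: "unitarily_equivalent_ops H ip mult_op H' ip' mult_op"
  \<comment> \<open>delta_1 is the weighted mean (2 (2 delta_1 - delta_2) + (2 delta_2 - delta_1)) /
    3 of the two arguments of the maximum; symmetrically for delta_2.\<close>
  have lt: "\<delta>\<^sub>1 < \<delta>\<^sub>3" "\<delta>\<^sub>2 < \<delta>\<^sub>3"
    using max by linarith+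
  obtain W Wi where W: "W ** Wi = mat 1"
    "\<And>z. z \<in> unit_disc \<Longrightarrow> W ** curvature l' \<mu>' z = curvature l \<mu> z ** W"
    by (rule unitarily_equivalent_curvature_intertwiner[OF assms(4,5) rkhs equiv]) blast
  note I = curvature_intertwiner[OF assms(4,5) W(2) C C']
  \<comment> \<open>An entry of W vanishes where the diagonal values it would match differ. This
    leaves W $ 3 $ 3 in row 3, and the (3,2) entry of the derivative relation ties it to W $ 2 $ 2,
    which is 0 because delta_1 and delta_2 differ.\<close>
  have 1: "W $ 3 $ 1 = 0" "W $ 3 $ 2 = 0" "W $ 2 $ 2 = 0"
    using I(1,2)[of 3] I(2)[of 2] lt ne by (auto simp: diag3_m3 mult.commute[of "W $ _ $ _"])
  then have "W $ 3 $ 3 = 0"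
    using I(5) lt t_of_pos[OF assms(5)] by simp
  then show False using invertible_row_nonzero[OF W(1)] 1 by blast
next
  fix H ip H' ip'
  assume ne: "\<delta>\<^sub>2 < \<delta>\<^sub>3" and min: "\<delta>\<^sub>1 < min (2 * \<delta>\<^sub>3 - \<delta>\<^sub>2) (2 * \<delta>\<^sub>2 - \<delta>\<^sub>3) - 6"
    and C: "curvature l \<mu> 0 = diag3 (of_real \<delta>\<^sub>1) (of_real \<delta>\<^sub>2) (of_real \<delta>\<^sub>3)"
    and C': "curvature l' \<mu>' 0 = diag3 (of_real \<delta>\<^sub>1) (of_real \<delta>\<^sub>3) (of_real \<delta>\<^sub>2)"
    and rkhs: "is_rkhs (K_ker l \<mu>) H ip" "is_rkhs (K_ker l' \<mu>') H' ip'"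
    and equiv: "unitarily_equivalent_ops H ip mult_op H' ip' mult_op"
  have lt: "\<delta>\<^sub>1 < \<delta>\<^sub>2" "\<delta>\<^sub>1 < \<delta>\<^sub>3"
    using min ne by linarith+
  obtain W Wi where W: "W ** Wi = mat 1"
    "\<And>z. z \<in> unit_disc \<Longrightarrow> W ** curvature l' \<mu>' z = curvature l \<mu> z ** W"
    by (rule unitarily_equivalent_curvature_intertwiner[OF assms(4,5) rkhs equiv]) blast
  note I = curvature_intertwiner[OF assms(4,5) W(2) C C']
  \<comment> \<open>Here row 1 retains only W $ 1 $ 1, and the (2,1) entry of the derivative
    relation ties it to W $ 2 $ 2, which is 0 because delta_2 and delta_3 differ.\<close>
  have 1: "W $ 1 $ 2 = 0" "W $ 1 $ 3 = 0" "W $ 2 $ 2 = 0"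
    using I(2,3)[of 1] I(2)[of 2] lt ne by (auto simp: diag3_m3 mult.commute[of "W $ _ $ _"])
  then have "W $ 1 $ 1 = 0"
    using I(4) lt s_of_pos[OF assms(4)] by simp
  then show False using invertible_row_nonzero[OF W(1)] 1 by blast
next
  fix z :: complex
  assume C: "curvature l \<mu> 0 = diag3 (of_real \<delta>\<^sub>1) (of_real \<delta>\<^sub>2) (of_real \<delta>\<^sub>3)"
    and C': "curvature l' \<mu>' 0 = diag3 (of_real \<delta>\<^sub>2) (of_real \<delta>\<^sub>1) (of_real \<delta>\<^sub>3)"
    and z: "z \<in> unit_disc"
  have "l' = l"
    using curvature_0_trace[OF assms(4) C] curvature_0_trace[OF assms(5) C'] by simp
  then show "curvatures_unitarily_equivalent l \<mu> l' \<mu>' z"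
    using curvatures_equivalent_if_permuted[OF assms(4) _ z C] assms(5) C' by simp
next
  fix z :: complex
  assume C: "curvature l \<mu> 0 = diag3 (of_real \<delta>\<^sub>1) (of_real \<delta>\<^sub>2) (of_real \<delta>\<^sub>3)"
    and C': "curvature l' \<mu>' 0 = diag3 (of_real \<delta>\<^sub>1) (of_real \<delta>\<^sub>3) (of_real \<delta>\<^sub>2)"
    and z: "z \<in> unit_disc"
  have "l' = l"
    using curvature_0_trace[OF assms(4) C] curvature_0_trace[OF assms(5) C'] by simp
  then show "curvatures_unitarily_equivalent l \<mu> l' \<mu>' z"
    using curvatures_equivalent_if_permuted[OF assms(4) _ z C] assms(5) C' by simp
qed

end
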